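(* Let $(f_t)_{t\in[0,1]}$ be an isotopy in $\mathrm{Diff}^1(\mathbb{T}^2)$ joining $\mathrm{Id}_{\mathbb{T}^2}$ to $f_1=f$. Let $(F_t)_t$ in $\mathrm{Diff}^1(\mathbb{R}^2)$ be the lift of the isotopy $(f_t)_t$ such that $F_0=\mathrm{Id}_{\mathbb{R}^2}$. Assume that there exist two points $x,y\in\mathbb{R}^2$, $x\neq y$, such that $\mathrm{Linking}((F_t)_t,x,y)$ exists and equals $l\in\mathbb{R}$. Then there exists an $f$-invariant Borel probability measure $\mu$ on $\mathbb{T}^2$ such that $\mathrm{Torsion}((f_t)_t,\mu)=l$. Moreover, there exist points in $\mathbb{T}^2$ whose torsion (exists and) is greater than or equal to $l$, and also points whose torsion (exists and) is smaller than or equal to $l$.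
   Context: $\mathbb{T}=\mathbb{R}/2\pi\mathbb{Z}$, $\mathbb{T}^2=\mathbb{R}^2/(2\pi\mathbb{Z})^2$, with the flat metric, the standard trivialization of the tangent bundle and the counterclockwise orientation (likewise on $\mathbb{R}^2$). An isotopy joining the identity to a diffeomorphism $g$ of $S$ ($S=\mathbb{T}^2$ or $\mathbb{R}^2$) is a path $(g_t)_{t\in[0,1]}$ in $\mathrm{Diff}^1(S)$, continuous for the weak (compact-open) $C^1$ topology, with $g_0=\mathrm{Id}$ and $g_1=g$; it is extended to $t\ge0$ by $g_t=g_{\{t\}}\circ g^{\lfloor t\rfloor}$ ($\{t\}$ fractional part, $\lfloor t\rfloor$ integer part). $\theta(u,v)\in\mathbb{T}$ is the oriented angle from $u$ to $v$. For $z\in\mathbb{T}^2$, $\xi\in T_z\mathbb{T}^2\setminus\{0\}$ and $n\ge1$: $\mathrm{Torsion}_n((f_t)_t,z,\xi)=\frac1n(\tilde v(n)-\tilde v(0))$, where $\tilde v$ is any continuous lift to $\mathbb{R}$ of $t\mapsto\theta((1,0),Df_t(z)\xi)$, $t\ge0$. If it converges as $n\to+\infty$ for some $\xi\neq0$, the limit is denoted $\mathrm{Torsion}((f_t)_t,z)$ (existence and value do not depend on $\xi$). For an $f$-invariant Borel probability measure $\mu$ on $\mathbb{T}^2$, $\mathrm{Torsion}((f_t)_t,\cdot)$ is defined $\mu$-almost everywhere and integrable, and $\mathrm{Torsion}((f_t)_t,\mu)=\int_{\mathbb{T}^2}\mathrm{Torsion}((f_t)_t,z)\,d\mu(z)$.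 For $x\ne y$ in $\mathbb{R}^2$: $\mathrm{Linking}_n((F_t)_t,x,y)=\frac1n(\tilde u(n)-\tilde u(0))$, where $\tilde u$ is any continuous lift of $t\mapsto\theta((1,0),F_t(y)-F_t(x))$, and $\mathrm{Linking}((F_t)_t,x,y)=\lim_{n\to+\infty}\mathrm{Linking}_n((F_t)_t,x,y)$ whenever the limit exists. *)

theory Defs
  imports "HOL-Probability.Probability"
begin

section \<open>The circle \<open>\<real>/2\<pi>\<int>\<close> and the flat torus\<close>

definition circle_rel :: "real \<Rightarrow> real \<Rightarrow> bool" where
  "circle_rel a b \<longleftrightarrow> (\<exists>k::int. a - b = 2 * pi * of_int k)"

lemma equivp_circle_rel: "equivp circle_rel"
proof (rule equivpI)
  show "reflp circle_rel"
    by (auto simp: reflp_def circle_rel_def intro: exI[of _ 0])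
  show "symp circle_rel"
  proof (rule sympI)
    fix a b assume "circle_rel a b"
    then obtain k :: int where "a - b = 2 * pi * of_int k" by (auto simp: circle_rel_def)
    then have "b - a = 2 * pi * of_int (- k)" by simp
    then show "circle_rel b a" unfolding circle_rel_def by blast
  qed
  show "transp circle_rel"
  proof (rule transpI)
    fix a b c assume "circle_rel a b" "circle_rel b c"
    then obtain k l :: int where "a - b = 2 * pi * of_int k" "b - c = 2 * pi * of_int l"
      by (auto simp: circle_rel_def)
    then have "a - c = 2 * pi * of_int (k + l)" by (simp add: algebra_simps)
    then show "circle_rel a c" unfolding circle_rel_def by blast
  qed
qed

quotient_type circle = real / circle_rel
  morphisms rep_circle circle_of
  by (rule equivp_circle_rel)

lemma circle_of_eq_iff: "circle_of a = circle_of b \<longleftrightarrow> (\<exists>k::int. a - b = 2 * pi * of_int k)"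
  using Quotient_rel[OF Quotient_circle, of a b] equivp_reflp[OF equivp_circle_rel]
  by (auto simp: circle_rel_def)

lemma circle_of_surj: obtains a where "circle_of a = x"
  by (metis Quotient_abs_rep[OF Quotient_circle])

definition flat_dist :: "circle \<Rightarrow> circle \<Rightarrow> real" where
  "flat_dist x y = setdist (circle_of -` {x}) (circle_of -` {y})"

lemma flat_dist_le: "flat_dist (circle_of a) (circle_of b) \<le> \<bar>a - b\<bar>"
  unfolding flat_dist_def
  using setdist_le_dist[of a "circle_of -` {circle_of a}" b "circle_of -` {circle_of b}"]
  by (simp add: dist_real_def)

lemma flat_dist_attained:
  obtains b where "circle_of b = y" "\<bar>a - b\<bar> = flat_dist (circle_of a) y"
proof -
  obtain c where c: "circle_of c = y" by (rule circle_of_surj)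
  define b where "b = c + 2 * pi * of_int (round ((a - c) / (2 * pi)))"
  have b: "circle_of b = y"
    unfolding c[symmetric] circle_of_eq_iff b_def by (intro exI) auto
  have min: "\<bar>a - b\<bar> \<le> \<bar>a - c - 2 * pi * of_int k\<bar>" for k :: int
  proof -
    have *: "\<bar>a - c - 2 * pi * of_int m\<bar> = 2 * pi * \<bar>(a - c) / (2 * pi) - of_int m\<bar>" for m :: int
    proof -
      have "a - c - 2 * pi * of_int m = 2 * pi * ((a - c) / (2 * pi) - of_int m)"
        by (simp add: field_simps)
      then show ?thesis by (simp add: abs_mult)
    qed
    have "\<bar>(a - c) / (2 * pi) - of_int (round ((a - c) / (2 * pi)))\<bar>
        \<le> \<bar>(a - c) / (2 * pi) - of_int k\<bar>"
      by (rule round_diff_minimal)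
    then have "\<bar>a - c - 2 * pi * of_int (round ((a - c) / (2 * pi)))\<bar>
        \<le> \<bar>a - c - 2 * pi * of_int k\<bar>"
      unfolding * by (intro mult_left_mono) auto
    moreover have "a - b = a - c - 2 * pi * of_int (round ((a - c) / (2 * pi)))"
      by (simp add: b_def)
    ultimately show ?thesis by simp
  qed
  have "\<bar>a - b\<bar> \<le> flat_dist (circle_of a) y"
    unfolding flat_dist_def
  proof (rule le_setdistI)
    show "circle_of -` {circle_of a} \<noteq> {}" "circle_of -` {y} \<noteq> {}" using c by auto
    fix a' c' assume "a' \<in> circle_of -` {circle_of a}" "c' \<in> circle_of -` {y}"
    then have "circle_of a' = circle_of a" "circle_of c' = circle_of c" using c by auto
    then obtain k l :: int where "a' - a = 2 * pi * of_int k" "c' - c = 2 * pi * of_int l"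
      unfolding circle_of_eq_iff by auto
    then have "a' - c' = a - c - 2 * pi * of_int (l - k)" by (simp add: algebra_simps)
    then show "\<bar>a - b\<bar> \<le> dist a' c'" using min[of "l - k"] by (simp add: dist_real_def)
  qed
  moreover have "flat_dist (circle_of a) y \<le> \<bar>a - b\<bar>" using flat_dist_le[of a b] b by simp
  ultimately show thesis using that b by simp
qed

instantiation circle :: metric_space
begin

definition dist_circle :: "circle \<Rightarrow> circle \<Rightarrow> real" where
  "dist_circle = flat_dist"

definition uniformity_circle :: "(circle \<times> circle) filter" where
  "uniformity_circle = (INF e\<in>{0<..}. principal {(x, y). dist x y < e})"

definition open_circle :: "circle set \<Rightarrow> bool" where
  "open_circle U = (\<forall>x\<in>U. eventually (\<lambda>(x', y). x' = x \<longrightarrow> y \<in> U) uniformity)"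

instance
proof
  fix x y z :: circle
  show "(dist x y = 0) = (x = y)"
    unfolding dist_circle_def
  proof
    assume "flat_dist x y = 0"
    obtain a where a: "circle_of a = x" by (rule circle_of_surj)
    obtain b where "circle_of b = y" "\<bar>a - b\<bar> = flat_dist (circle_of a) y" by (rule flat_dist_attained)
    then show "x = y" using a \<open>flat_dist x y = 0\<close> by auto
  next
    assume "x = y"
    moreover obtain a where "circle_of a = x" by (rule circle_of_surj)
    ultimately show "flat_dist x y = 0"
      using flat_dist_le[of a a] setdist_pos_le[of "circle_of -` {x}" "circle_of -` {x}"]
      unfolding flat_dist_def by (metis abs_zero diff_self order_antisym)
  qed
  obtain c where c: "circle_of c = z" by (rule circle_of_surj)
  obtain a where a: "circle_of a = x" "\<bar>c - a\<bar> = flat_dist (circle_of c) x" by (rule flat_dist_attained)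
  obtain b where b: "circle_of b = y" "\<bar>c - b\<bar> = flat_dist (circle_of c) y" by (rule flat_dist_attained)
  have sym: "flat_dist u v = flat_dist v u" for u v :: circle
    by (simp add: flat_dist_def setdist_sym)
  have "flat_dist x y \<le> \<bar>a - b\<bar>" using flat_dist_le[of a b] a b by simp
  also have "\<dots> \<le> \<bar>c - a\<bar> + \<bar>c - b\<bar>" by simp
  finally show "dist x y \<le> dist x z + dist y z"
    using a b c by (simp add: sym[of z] dist_circle_def)
qed (simp_all add: uniformity_circle_def open_circle_def)
end

lemma open_circle_iff_quotient: "open U \<longleftrightarrow> open (circle_of -` U)"
proof
  have "continuous_on UNIV circle_of"
    unfolding continuous_on_iff
  proof (intro ballI allI impI)
    fix a e :: real assume "e > 0"
    then show "\<exists>d>0. \<forall>b\<in>UNIV. dist b a < d \<longrightarrow> dist (circle_of b) (circle_of a) < e"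
      using flat_dist_le[of _ a]
      by (intro exI[of _ e]) (auto simp: dist_circle_def dist_real_def intro: le_less_trans)
  qed
  then show "open U \<Longrightarrow> open (circle_of -` U)"
    by (simp add: continuous_on_open_vimage)
  assume *: "open (circle_of -` U)"
  show "open U"
    unfolding open_dist
  proof
    fix x assume "x \<in> U"
    obtain a where a: "circle_of a = x" by (rule circle_of_surj)
    then obtain e where e: "e > 0" "\<And>b. dist b a < e \<Longrightarrow> b \<in> circle_of -` U"
      using * \<open>x \<in> U\<close> unfolding open_dist by (metis vimageI)
    show "\<exists>e>0. \<forall>y. dist y x < e \<longrightarrow> y \<in> U"
    proof (intro exI[of _ e] conjI allI impI e(1))
      fix y assume "dist y x < e"
      obtain b where "circle_of b = y" "\<bar>a - b\<bar> = dist (circle_of a) y"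
        unfolding dist_circle_def by (rule flat_dist_attained)
      then show "y \<in> U" using e(2)[of b] a \<open>dist y x < e\<close>
        by (auto simp: dist_commute dist_real_def)
    qed
  qed
qed

type_synonym plane = "real \<times> real"

text \<open>The product metric on \<open>circle \<times> circle\<close> is the flat metric of
  \<open>\<real>\<^sup>2/(2\<pi>\<int>)\<^sup>2\<close>.\<close>
type_synonym torus = "circle \<times> circle"

definition torus_of :: "plane \<Rightarrow> torus" where
  "torus_of = map_prod circle_of circle_of"

section \<open>\<open>C\<^sup>1\<close> diffeomorphisms and isotopies\<close>

definition has_deriv_plane :: "(plane \<Rightarrow> plane) \<Rightarrow> plane \<Rightarrow> (plane \<Rightarrow>\<^sub>L plane) \<Rightarrow> bool" where
  "has_deriv_plane g p A \<longleftrightarrow> (g has_derivative blinfun_apply A) (at p)"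

text \<open>In the standard trivialization of the tangent bundle, the derivative of a torus map
  is the derivative of any of its local lifts to the plane.\<close>
definition has_deriv_torus :: "(torus \<Rightarrow> torus) \<Rightarrow> torus \<Rightarrow> (plane \<Rightarrow>\<^sub>L plane) \<Rightarrow> bool" where
  "has_deriv_torus g z A \<longleftrightarrow>
    (\<exists>p G. torus_of p = z \<and> (\<forall>\<^sub>F q in nhds p. torus_of (G q) = g (torus_of q)) \<and>
           has_deriv_plane G p A)"

text \<open>The notions below are shared by the two surfaces; the argument \<open>D\<close> is
  \<^const>\<open>has_deriv_plane\<close> or \<^const>\<open>has_deriv_torus\<close>.\<close>

type_synonym 's deriv_rel = "('s \<Rightarrow> 's) \<Rightarrow> 's \<Rightarrow> (plane \<Rightarrow>\<^sub>L plane) \<Rightarrow> bool"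

definition the_deriv :: "'s deriv_rel \<Rightarrow> ('s \<Rightarrow> 's) \<Rightarrow> 's \<Rightarrow> (plane \<Rightarrow>\<^sub>L plane)" where
  "the_deriv D g z = (THE A. D g z A)"

text \<open>The derivative does not depend on the local lift, so \<^const>\<open>the_deriv\<close> is meaningful.\<close>
lemma has_deriv_torus_unique:
  assumes "has_deriv_torus g z A" "has_deriv_torus g z B"
  shows "A = B"
proof -
  obtain p G where p: "torus_of p = z" and G: "\<forall>\<^sub>F q in nhds p. torus_of (G q) = g (torus_of q)"
    and A: "(G has_derivative blinfun_apply A) (at p)"
    using assms(1) unfolding has_deriv_torus_def has_deriv_plane_def by blast
  obtain p' H where p': "torus_of p' = z" and H: "\<forall>\<^sub>F q in nhds p'. torus_of (H q) = g (torus_of q)"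
    and B: "(H has_derivative blinfun_apply B) (at p')"
    using assms(2) unfolding has_deriv_torus_def has_deriv_plane_def by blast
  define w where "w = p' - p"
  have fib: "torus_of a = torus_of b \<longleftrightarrow> (\<exists>k l :: int. a - b = (2 * pi * of_int k, 2 * pi * of_int l))"
    for a b by (cases a; cases b) (simp add: torus_of_def circle_of_eq_iff)
  have "torus_of (q + w) = torus_of q" for q
    using fib[of p' p] fib[of "q + w" q] p p' by (simp add: w_def)
  note per = this
  have "filterlim (\<lambda>q. q + w) (nhds (p + w)) (nhds p)"
    by (intro tendsto_intros filterlim_ident)
  then have "\<forall>\<^sub>F q in nhds p. torus_of (H (q + w)) = g (torus_of (q + w))"
    by (rule eventually_compose_filterlim[rotated]) (use H in \<open>simp add: w_def\<close>)
  then have H': "\<forall>\<^sub>F q in nhds p. torus_of (H (q + w)) = g (torus_of q)"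
    by (simp only: per)
  have B': "((\<lambda>q. H (q + w)) has_derivative blinfun_apply B) (at p)"
  proof -
    have "((\<lambda>q. q + w) has_derivative (\<lambda>h. h)) (at p)"
      by (auto intro!: derivative_eq_intros)
    from has_derivative_compose[OF this, of H "blinfun_apply B"] B show ?thesis
      by (simp add: w_def)
  qed
  define E where "E = (\<lambda>q. H (q + w) - G q)"
  have dE: "(E has_derivative (\<lambda>h. B h - A h)) (at p)"
    unfolding E_def by (intro has_derivative_diff A B')
  have lat: "\<forall>\<^sub>F q in nhds p. torus_of (H (q + w)) = torus_of (G q)"
    using G H' by eventually_elim simp
  have "isCont E p"
    using dE by (rule has_derivative_continuous)
  then have "(E \<longlongrightarrow> E p) (nhds p)"
    by (simp add: isCont_def tendsto_at_iff_tendsto_nhds)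
  then have near: "\<forall>\<^sub>F q in nhds p. dist (E q) (E p) < 2 * pi"
    by (rule tendstoD) simp
  have small: "a = b" if "a = 2 * pi * of_int k" "b = 2 * pi * of_int l" "\<bar>a - b\<bar> < 2 * pi"
    for a b :: real and k l :: int
  proof -
    have "\<bar>a - b\<bar> = 2 * pi * \<bar>of_int (k - l)\<bar>"
      unfolding that(1,2) right_diff_distrib[symmetric] of_int_diff[symmetric] by (simp add: abs_mult)
    then have "\<bar>real_of_int (k - l)\<bar> < 1" using that(3) by simp
    then have "k = l" by linarith
    then show ?thesis using that by simp
  qed
  have fibp: "\<exists>k l :: int. E p = (2 * pi * of_int k, 2 * pi * of_int l)"
    using eventually_nhds_x_imp_x[OF lat] unfolding fib E_def .
  have "\<forall>\<^sub>F q in nhds p. E q = E p"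
    using lat near
  proof eventually_elim
    case (elim q)
    have "\<bar>fst (E q) - fst (E p)\<bar> < 2 * pi" "\<bar>snd (E q) - snd (E p)\<bar> < 2 * pi"
      using dist_fst_le[of "E q" "E p"] dist_snd_le[of "E q" "E p"] elim(2)
      by (auto simp: dist_real_def)
    moreover obtain k l :: int where "E q = (2 * pi * of_int k, 2 * pi * of_int l)"
      using elim(1) unfolding fib E_def by blast
    moreover obtain k' l' :: int where "E p = (2 * pi * of_int k', 2 * pi * of_int l')"
      using fibp by blast
    ultimately show ?case
      using small[of "fst (E q)" k "fst (E p)" k'] small[of "snd (E q)" l "snd (E p)" l']
      by (simp add: prod_eq_iff)
  qed
  then obtain S where S: "open S" "p \<in> S" "\<And>q. q \<in> S \<Longrightarrow> E p = E q"
    unfolding eventually_nhds by metis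
  have "(E has_derivative (\<lambda>h. 0)) (at p)"
    by (rule has_derivative_transform_within_open[OF has_derivative_const S])
  from has_derivative_unique[OF dE this] have "blinfun_apply B h = blinfun_apply A h" for h
    by (cases h) (simp add: fun_eq_iff)
  then show ?thesis by (intro blinfun_eqI) simp
qed

definition C1_map :: "('s::metric_space) deriv_rel \<Rightarrow> ('s \<Rightarrow> 's) \<Rightarrow> bool" where
  "C1_map D g \<longleftrightarrow> (\<forall>z. \<exists>A. D g z A) \<and> continuous_on UNIV (the_deriv D g)"

definition Diff1 :: "('s::metric_space) deriv_rel \<Rightarrow> ('s \<Rightarrow> 's) set" where
  "Diff1 D = {g. bij g \<and> C1_map D g \<and> C1_map D (inv g)}"

text \<open>Continuity of a path for the weak \<open>C\<^sup>1\<close> topology: maps and derivatives vary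
  continuously for uniform convergence on compact sets.\<close>
definition C1_continuous_path :: "('s::metric_space) deriv_rel \<Rightarrow> (real \<Rightarrow> 's \<Rightarrow> 's) \<Rightarrow> bool" where
  "C1_continuous_path D g \<longleftrightarrow>
    (\<forall>t\<in>{0..1}. \<forall>K. compact K \<longrightarrow>
       uniform_limit K g (g t) (at t within {0..1}) \<and>
       uniform_limit K (\<lambda>s. the_deriv D (g s)) (the_deriv D (g t)) (at t within {0..1}))"

text \<open>An isotopy joining the identity to \<open>g 1\<close>; values of \<open>g\<close> outside \<open>[0,1]\<close>
  are irrelevant.\<close>
definition isotopy :: "('s::metric_space) deriv_rel \<Rightarrow> (real \<Rightarrow> 's \<Rightarrow> 's) \<Rightarrow> bool" where
  "isotopy D g \<longleftrightarrow>
    (\<forall>t\<in>{0..1}. g t \<in> Diff1 D) \<and> C1_continuous_path D g \<and> g 0 = id"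

definition extend :: "(real \<Rightarrow> 's \<Rightarrow> 's) \<Rightarrow> real \<Rightarrow> 's \<Rightarrow> 's" where
  "extend g t = g (frac t) \<circ> (g 1 ^^ nat \<lfloor>t\<rfloor>)"

section \<open>Angles, torsion and linking\<close>

definition to_complex :: "plane \<Rightarrow> complex" where
  "to_complex u = Complex (fst u) (snd u)"

text \<open>The oriented (counterclockwise) angle from \<open>u\<close> to \<open>v\<close>, for nonzero \<open>u\<close>, \<open>v\<close>.\<close>
definition oriented_angle :: "plane \<Rightarrow> plane \<Rightarrow> circle" where
  "oriented_angle u v = circle_of (Arg (to_complex v / to_complex u))"

definition is_lift :: "(real \<Rightarrow> circle) \<Rightarrow> (real \<Rightarrow> real) \<Rightarrow> bool" where
  "is_lift \<alpha> \<phi> \<longleftrightarrow> continuous_on {0..} \<phi> \<and> (\<forall>t\<ge>0. circle_of (\<phi> t) = \<alpha> t)"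

text \<open>The choice of the lift is immaterial: two lifts differ by a constant.\<close>
definition mean_variation :: "(real \<Rightarrow> circle) \<Rightarrow> nat \<Rightarrow> real" where
  "mean_variation \<alpha> n = (let \<phi> = (SOME \<phi>. is_lift \<alpha> \<phi>) in (\<phi> (real n) - \<phi> 0) / real n)"

definition torsion_n :: "(real \<Rightarrow> torus \<Rightarrow> torus) \<Rightarrow> torus \<Rightarrow> plane \<Rightarrow> nat \<Rightarrow> real" where
  "torsion_n f z \<xi> =
    mean_variation (\<lambda>t. oriented_angle (1, 0) (the_deriv has_deriv_torus (extend f t) z \<xi>))"

definition has_torsion :: "(real \<Rightarrow> torus \<Rightarrow> torus) \<Rightarrow> torus \<Rightarrow> real \<Rightarrow> bool" where
  "has_torsion f z \<tau> \<longleftrightarrow> (\<exists>\<xi>. \<xi> \<noteq> 0 \<and> torsion_n f z \<xi> \<longlonglongrightarrow> \<tau>)"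

definition torsion :: "(real \<Rightarrow> torus \<Rightarrow> torus) \<Rightarrow> torus \<Rightarrow> real" where
  "torsion f z = (THE \<tau>. has_torsion f z \<tau>)"

definition torsion_measure :: "(real \<Rightarrow> torus \<Rightarrow> torus) \<Rightarrow> torus measure \<Rightarrow> real" where
  "torsion_measure f \<mu> = (\<integral>z. torsion f z \<partial>\<mu>)"

definition linking_n :: "(real \<Rightarrow> plane \<Rightarrow> plane) \<Rightarrow> plane \<Rightarrow> plane \<Rightarrow> nat \<Rightarrow> real" where
  "linking_n F x y = mean_variation (\<lambda>t. oriented_angle (1, 0) (extend F t y - extend F t x))"

definition has_linking :: "(real \<Rightarrow> plane \<Rightarrow> plane) \<Rightarrow> plane \<Rightarrow> plane \<Rightarrow> real \<Rightarrow> bool" where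
  "has_linking F x y l \<longleftrightarrow> linking_n F x y \<longlonglongrightarrow> l"

definition invariant_prob :: "(torus \<Rightarrow> torus) \<Rightarrow> torus measure \<Rightarrow> bool" where
  "invariant_prob g \<mu> \<longleftrightarrow> sets \<mu> = sets borel \<and> prob_space \<mu> \<and> distr \<mu> borel g = \<mu>"

end

theory Submission
  imports Defs
begin

text \<open>
  Fix a time \<open>n\<close> and transport the segment \<open>[x, y]\<close> by the flow. On the triangle \<open>s \<le> s'\<close> the
  direction of the chord from the image of the point \<open>s\<close> to the image of the point \<open>s'\<close> has a
  continuous lift, equal on the diagonal to the angle of the tangent. A Hopf-type argument shows that
  the value at the corner \<open>(0, 1)\<close>, which is the linking of \<open>x\<close> and \<open>y\<close>, is attained on the
  diagonal; so some point of \<open>[x, y]\<close> has torsion at time \<open>n\<close> equal to the linking at time \<open>n\<close>.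

  Torsion at time \<open>n\<close> is a Birkhoff average of a continuous function for the action of the
  diffeomorphism on the compact space of directions \<open>torus \<times> circle\<close>. A weak limit of the empirical
  measures of the directions found above is therefore an invariant measure for which that function
  has integral \<open>l\<close>. By Birkhoff's theorem torsion exists almost everywhere for its projection to
  the torus and has integral \<open>l\<close>, so it takes values on both sides of \<open>l\<close>.

  Weak limits are taken on the real line, where Helly's theorem is available, and pushed forward by
  a space-filling curve.
\<close>

section \<open>Chords and tangents of plane arcs\<close>

text \<open>A mean value theorem would give a tangent parallel to the chord only modulo
  \<open>pi\<close>, whereas linking and torsion count turns: the equality needed is between real
  lifts, and this is why plane topology enters. At time 0 all chords and tangents of the segment
  have one common angle, so equality of lifted angles at time \<open>n\<close> is equality of the
  angles turned. The point so found depends on \<open>n\<close>, hence does not by itself yield a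
  point of torsion \<open>l\<close>; only averages along its orbit survive in the limit. They are
  taken over directions because the derivative moves the vector as well: the angle turned is an
  exactly additive cocycle over the action on directions, while for a fixed reference vector it is
  additive over the torus only up to a bounded error. Two directions at the same point turn by
  amounts that differ by at most \<open>2 * pi\<close>, so the limit is a function of the base point
  and the measure can be projected.\<close>

lemma cis_eq_1_iff: "cis t = 1 \<longleftrightarrow> (\<exists>k::int. t = 2 * pi * of_int k)"
proof -
  have "cis t = 1 \<longleftrightarrow> cos t = 1"
    by (auto simp: complex_eq_iff cos_one_sin_zero)
  also have "\<dots> \<longleftrightarrow> (\<exists>k::int. t = 2 * pi * of_int k)"
    by (simp add: cos_one_2pi_int mult.commute mult.left_commute)
  finally show ?thesis .
qed

lemma cis_eq_iff: "cis s = cis t \<longleftrightarrow> (\<exists>k::int. s - t = 2 * pi * of_int k)"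
  unfolding cis_eq_1_iff[symmetric] by (simp flip: cis_divide)

lemma cis_1_imp_constant:
  fixes f :: "'a::topological_space \<Rightarrow> real"
  assumes "connected S" "continuous_on S f" "\<And>x. x \<in> S \<Longrightarrow> cis (f x) = 1" "x \<in> S" "y \<in> S"
  shows "f x = f y"
proof -
  have "f constant_on S"
  proof (rule continuous_discrete_range_constant[OF assms(1,2)])
    fix x assume x: "x \<in> S"
    show "\<exists>e>0. \<forall>y. y \<in> S \<and> f y \<noteq> f x \<longrightarrow> e \<le> norm (f y - f x)"
    proof (intro exI[of _ "2 * pi"] conjI allI impI)
      fix y assume y: "y \<in> S \<and> f y \<noteq> f x"
      obtain k l :: int where "f x = 2 * pi * of_int k" "f y = 2 * pi * of_int l"
        using x y assms(3) unfolding cis_eq_1_iff by metis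
      then have *: "f y - f x = 2 * pi * of_int (l - k)" by (simp add: algebra_simps)
      with y have "l - k \<noteq> 0" by auto
      then have "\<bar>of_int (l - k) :: real\<bar> \<ge> 1" by linarith
      then have "2 * pi * \<bar>of_int (l - k) :: real\<bar> \<ge> 2 * pi * 1" by (intro mult_left_mono) auto
      then show "2 * pi \<le> norm (f y - f x)" unfolding * by (simp add: abs_mult)
    qed simp
  qed
  then show ?thesis using assms(4,5) by (auto simp: constant_on_def)
qed

text \<open>If the oscillation exceeded \<open>pi\<close>, there would be two values less than
  \<open>pi\<close> apart that are taken together with their translates by \<open>pi\<close>. As
  \<open>sin (v + pi) = - sin v\<close>, the sign condition makes \<open>sin\<close> vanish at both
  values, but distinct zeros of \<open>sin\<close> are at least \<open>pi\<close> apart.\<close>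

lemma sin_sign_imp_oscillation_le_pi:
  fixes f :: "real \<Rightarrow> real"
  assumes "continuous_on {c..d} f" "x \<in> {c..d}" "y \<in> {c..d}"
    and \<sigma>: "\<bar>\<sigma>\<bar> = 1" "\<And>t. t \<in> {c..d} \<Longrightarrow> \<sigma> * sin (f t) \<le> 0"
  shows "f y - f x \<le> pi"
proof (rule ccontr)
  assume "\<not> f y - f x \<le> pi"
  define h where "h = min (f y - f x - pi) (pi / 2)"
  have h: "0 < h" "h < pi" "f x + h + pi \<le> f y" using \<open>\<not> _\<close> by (auto simp: h_def min_def)
  have "connected (f ` {c..d})"
    using assms(1) by (intro connected_continuous_image) auto
  then have "v \<in> f ` {c..d}" if "f x \<le> v" "v \<le> f y" for v
    by (rule connectedD_interval[OF _ imageI[OF assms(2)] imageI[OF assms(3)] that])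
  then have sgn: "\<sigma> * sin v \<le> 0" if "f x \<le> v" "v \<le> f y" for v
    using that \<sigma>(2) by blast
  have "\<sigma> * sin (f x) = 0" "\<sigma> * sin (f x + h) = 0"
    using sgn[of "f x"] sgn[of "f x + pi"] sgn[of "f x + h"] sgn[of "f x + h + pi"] h
    by (simp_all del: mult_le_0_iff mult_eq_0_iff)
  then have "sin (f x) = 0" "sin (f x + h) = 0" using \<sigma>(1) by auto
  then have "cos (f x) * sin h = 0" by (simp add: sin_add)
  moreover have "sin h > 0" using h by (intro sin_gt_zero) auto
  moreover have "cos (f x) \<noteq> 0" using \<open>sin (f x) = 0\<close> sin_cos_squared_add[of "f x"] by auto
  ultimately show False by auto
qed

text \<open>On the diagonal \<open>\<Phi>\<close> is constrained only by continuity: its values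
  there are limits of chord directions and play the part of the tangent angle, so the arc is never
  differentiated.\<close>

locale chord_lift =
  fixes \<gamma> :: "real \<Rightarrow> complex" and \<Phi> :: "real \<times> real \<Rightarrow> real" and a b :: real
  assumes ab: "a \<le> b"
    and cont_arc: "continuous_on {a..b} \<gamma>"
    and cont_lift: "continuous_on {(s, s'). a \<le> s \<and> s \<le> s' \<and> s' \<le> b} \<Phi>"
    and arc: "\<And>s s'. a \<le> s \<Longrightarrow> s < s' \<Longrightarrow> s' \<le> b \<Longrightarrow> \<gamma> s' \<noteq> \<gamma> s"
    and chord: "\<And>s s'. a \<le> s \<Longrightarrow> s < s' \<Longrightarrow> s' \<le> b \<Longrightarrow>
      \<gamma> s' - \<gamma> s = of_real (norm (\<gamma> s' - \<gamma> s)) * cis (\<Phi> (s, s'))"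
begin

lemma continuous_on_lift [continuous_intros]:
  assumes "continuous_on S f" "continuous_on S g" "\<And>x. x \<in> S \<Longrightarrow> a \<le> f x \<and> f x \<le> g x \<and> g x \<le> b"
  shows "continuous_on S (\<lambda>x. \<Phi> (f x, g x))"
  by (rule continuous_on_compose2[OF cont_lift]) (use assms in \<open>auto intro!: continuous_intros\<close>)

lemma cis_lift:
  assumes "a \<le> s" "s < s'" "s' \<le> b"
  shows "cis (\<Phi> (s, s')) = (\<gamma> s' - \<gamma> s) / of_real (norm (\<gamma> s' - \<gamma> s))"
  using chord[OF assms] arc[OF assms] by (simp add: field_simps)

lemma sin_lift:
  assumes "a \<le> s" "s < s'" "s' \<le> b"
  shows "sin (\<Phi> (s, s')) = (Im (\<gamma> s') - Im (\<gamma> s)) / norm (\<gamma> s' - \<gamma> s)"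
proof -
  have "sin (\<Phi> (s, s')) = Im (cis (\<Phi> (s, s')))" by simp
  then show ?thesis unfolding cis_lift[OF assms] by simp
qed

text \<open>Equal lifted angles mean the same direction and never the opposite one, so the two
  chords add up without backtracking. This turns a zero of
  \<open>\<Phi> (a, s) - \<Phi> (s, v)\<close>, found by the intermediate value theorem, into a
  crossing of a segment by the arc.\<close>

lemma parallel_chords_imp_between:
  assumes "a \<le> s" "s < u" "u < v" "v \<le> b" "\<Phi> (s, u) = \<Phi> (u, v)"
  shows "\<gamma> u \<in> open_segment (\<gamma> s) (\<gamma> v)"
proof -
  define m n where "m = norm (\<gamma> u - \<gamma> s)" and "n = norm (\<gamma> v - \<gamma> u)"
  have pos: "m > 0" "n > 0" using arc[of s u] arc[of u v] assms by (auto simp: m_def n_def)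
  have 1: "\<gamma> u - \<gamma> s = of_real m * cis (\<Phi> (s, u))" "\<gamma> v - \<gamma> u = of_real n * cis (\<Phi> (s, u))"
    using chord[of s u] chord[of u v] assms by (auto simp: m_def n_def)
  define c where "c = cis (\<Phi> (s, u))"
  have eq: "\<gamma> u = \<gamma> s + of_real m * c" "\<gamma> v = \<gamma> s + of_real m * c + of_real n * c"
    using 1 by (auto simp: c_def algebra_simps)
  have "(m / (m + n)) *\<^sub>R (of_real m * c + of_real n * c) = (m / (m + n) * (m + n)) *\<^sub>R c"
    by (simp add: scaleR_conv_of_real algebra_simps add_divide_distrib)
  also have "m / (m + n) * (m + n) = m" using pos by simp
  finally have "\<gamma> u = (1 - m / (m + n)) *\<^sub>R \<gamma> s + (m / (m + n)) *\<^sub>R \<gamma> v"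
    unfolding eq by (simp add: scaleR_conv_of_real algebra_simps)
  moreover have "0 < m / (m + n)" "m / (m + n) < 1" using pos by auto
  moreover have "\<gamma> s \<noteq> \<gamma> v" using arc[of s v] assms by auto
  ultimately show ?thesis unfolding in_segment by blast
qed

end


lemma continuous_le_at_left_endpoint:
  fixes f :: "real \<Rightarrow> real"
  assumes "continuous_on {c..d} f" "c < d" "\<And>x. c < x \<Longrightarrow> x \<le> d \<Longrightarrow> v \<le> f x"
  shows "v \<le> f c"
proof (rule tendsto_lowerbound)
  show "(f \<longlongrightarrow> f c) (at_right c)"
    using assms(1,2) continuous_on_Icc_at_rightD by blast
  show "\<forall>\<^sub>F x in at_right c. v \<le> f x"
    using assms(2,3) by (auto simp: eventually_at_right intro!: exI[of _ d])
qed simp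

lemma continuous_le_at_right_endpoint:
  fixes f :: "real \<Rightarrow> real"
  assumes "continuous_on {c..d} f" "c < d" "\<And>x. c \<le> x \<Longrightarrow> x < d \<Longrightarrow> v \<le> f x"
  shows "v \<le> f d"
proof (rule tendsto_lowerbound)
  show "(f \<longlongrightarrow> f d) (at_left d)"
    using assms(1,2) continuous_on_Icc_at_leftD by blast
  show "\<forall>\<^sub>F x in at_left d. v \<le> f x"
    using assms(2,3) by (auto simp: eventually_at_left intro!: exI[of _ c])
qed simp

text \<open>If no tangent had the direction of the chord \<open>(0, 1)\<close>, a shortest parameter interval \<open>[a, b]\<close>
  whose chord has that direction would, after a rotation and possibly a reflection, be of the
  following kind; this is shown to be impossible.\<close>
locale extremal_chord_lift = chord_lift +
  assumes nontrivial: "a < b"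
    and corner: "\<Phi> (a, b) = 0"
    and pos: "\<And>s s'. a \<le> s \<Longrightarrow> s \<le> s' \<Longrightarrow> s' \<le> b \<Longrightarrow> (s, s') \<noteq> (a, b) \<Longrightarrow> \<Phi> (s, s') > 0"
begin

lemma Im_end: "Im (\<gamma> b) = Im (\<gamma> a)"
  using sin_lift[of a b] nontrivial corner arc[of a b] by simp

lemma Re_end: "Re (\<gamma> a) < Re (\<gamma> b)"
proof -
  have "\<gamma> b - \<gamma> a = of_real (norm (\<gamma> b - \<gamma> a))"
    using chord[of a b] corner nontrivial by simp
  then have "Re (\<gamma> b) - Re (\<gamma> a) = norm (\<gamma> b - \<gamma> a)"
    by (metis Re_complex_of_real minus_complex.sel(1))
  moreover have "norm (\<gamma> b - \<gamma> a) > 0" using arc[of a b] nontrivial by simp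
  ultimately show ?thesis by linarith
qed

text \<open>\<open>\<Phi> (s, b)\<close> is positive and tends to 0 as \<open>s\<close> decreases to
  \<open>a\<close>, so the chord from \<open>\<gamma> s\<close> to \<open>\<gamma> b\<close> rises;
  and \<open>\<gamma> b\<close> is at the height of \<open>\<gamma> a\<close>.\<close>

lemma below_near_start: "\<exists>c. a < c \<and> c \<le> b \<and> (\<forall>s. a < s \<longrightarrow> s < c \<longrightarrow> Im (\<gamma> s) < Im (\<gamma> a))"
proof -
  have "continuous_on {a..b} (\<lambda>s. \<Phi> (s, b))"
    by (intro continuous_intros) auto
  then have "((\<lambda>s. \<Phi> (s, b)) \<longlongrightarrow> 0) (at_right a)"
    using continuous_on_Icc_at_rightD[of a b "\<lambda>s. \<Phi> (s, b)"] nontrivial corner by simp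
  then have "\<forall>\<^sub>F s in at_right a. \<Phi> (s, b) < pi"
    by (rule order_tendstoD) simp
  then obtain c where c: "c > a" "\<And>s. a < s \<Longrightarrow> s < c \<Longrightarrow> \<Phi> (s, b) < pi"
    unfolding eventually_at_right_field by blast
  show ?thesis
  proof (intro exI[of _ "min b c"] conjI allI impI)
    fix s assume s: "a < s" "s < min b c"
    then have "0 < sin (\<Phi> (s, b))" using c(2) pos[of s b] by (intro sin_gt_zero) auto
    then show "Im (\<gamma> s) < Im (\<gamma> a)"
      using sin_lift[of s b] s arc[of s b] Im_end by (simp add: zero_less_divide_iff)
  qed (use c nontrivial in auto)
qed

lemma above_near_end: "\<exists>c. a \<le> c \<and> c < b \<and> (\<forall>s. c < s \<longrightarrow> s < b \<longrightarrow> Im (\<gamma> a) < Im (\<gamma> s))"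
proof -
  have "continuous_on {a..b} (\<lambda>s. \<Phi> (a, s))"
    by (intro continuous_intros) auto
  then have "((\<lambda>s. \<Phi> (a, s)) \<longlongrightarrow> 0) (at_left b)"
    using continuous_on_Icc_at_leftD[of a b "\<lambda>s. \<Phi> (a, s)"] nontrivial corner by simp
  then have "\<forall>\<^sub>F s in at_left b. \<Phi> (a, s) < pi"
    by (rule order_tendstoD) simp
  then obtain c where c: "c < b" "\<And>s. c < s \<Longrightarrow> s < b \<Longrightarrow> \<Phi> (a, s) < pi"
    unfolding eventually_at_left_field by blast
  show ?thesis
  proof (intro exI[of _ "max a c"] conjI allI impI)
    fix s assume s: "max a c < s" "s < b"
    then have "0 < sin (\<Phi> (a, s))" using c(2) pos[of a s] by (intro sin_gt_zero) auto
    then show "Im (\<gamma> a) < Im (\<gamma> s)"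
      using sin_lift[of a s] s arc[of a s] by (simp add: zero_less_divide_iff)
  qed (use c nontrivial in auto)
qed

text \<open>The crossing is nearest to \<open>\<gamma> a\<close> in space, not earliest in time:
  what is used later is that the arc does not meet the open segment between
  \<open>\<gamma> a\<close> and \<open>\<gamma> s1\<close>, at any parameter.\<close>

lemma first_crossing:
  obtains s1 where "a < s1" "s1 < b" "Im (\<gamma> s1) = Im (\<gamma> a)" "Re (\<gamma> a) < Re (\<gamma> s1)" "Re (\<gamma> s1) < Re (\<gamma> b)"
    "\<And>s. a < s \<Longrightarrow> s \<le> b \<Longrightarrow> Im (\<gamma> s) = Im (\<gamma> a) \<Longrightarrow> Re (\<gamma> a) < Re (\<gamma> s) \<Longrightarrow> Re (\<gamma> s1) \<le> Re (\<gamma> s)"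
proof -
  obtain c where c: "a < c" "c \<le> b" "\<And>s. a < s \<Longrightarrow> s < c \<Longrightarrow> Im (\<gamma> s) < Im (\<gamma> a)"
    using below_near_start by blast
  \<comment> \<open>Starting at \<open>c\<close> keeps \<open>K\<close> compact while leaving out
    the parameter \<open>a\<close>; no crossing is lost, since the arc is strictly below the line
    before \<open>c\<close>.\<close>
  define K where "K = {c..b} \<inter> \<gamma> -` {z. Im z = Im (\<gamma> a) \<and> Re (\<gamma> a) \<le> Re z}"
  have "closed {z. Im z = Im (\<gamma> a) \<and> Re (\<gamma> a) \<le> Re z}"
    by (intro closed_Collect_conj closed_Collect_eq closed_Collect_le continuous_intros)
  then have "closed K" unfolding K_def
    by (intro continuous_closed_preimage)
       (use c in \<open>auto intro: continuous_on_subset[OF cont_arc]\<close>)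
  then have "compact K"
    using compact_Int_closed[of "{c..b}" K] by (simp add: K_def Int_absorb1 Int_assoc[symmetric])
  \<comment> \<open>The difference is positive at \<open>a\<close> and negative at \<open>b\<close>,
    because the corner value 0 is the strict minimum of \<open>\<Phi>\<close>.\<close>
  have "continuous_on {a..b} (\<lambda>s. \<Phi> (a, s) - \<Phi> (s, b))"
    by (intro continuous_intros) (use nontrivial in auto)
  then have "\<exists>s. a \<le> s \<and> s \<le> b \<and> \<Phi> (a, s) - \<Phi> (s, b) = 0"
    using pos[of a a] pos[of b b] corner nontrivial
    by (intro IVT2') (auto intro: less_imp_le)
  then obtain s0 where s0: "a \<le> s0" "s0 \<le> b" "\<Phi> (a, s0) = \<Phi> (s0, b)" by auto
  have "s0 \<noteq> a" "s0 \<noteq> b" using s0 pos[of a a] pos[of b b] corner nontrivial by auto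
  then have "\<gamma> s0 \<in> open_segment (\<gamma> a) (\<gamma> b)"
    using s0 by (intro parallel_chords_imp_between) auto
  then obtain u where u: "0 < u" "u < 1" "\<gamma> s0 = (1 - u) *\<^sub>R \<gamma> a + u *\<^sub>R \<gamma> b"
    unfolding in_segment by blast
  have Im0: "Im (\<gamma> s0) = Im (\<gamma> a)" using arg_cong[OF u(3), of Im] Im_end by (simp add: algebra_simps)
  have Re0: "Re (\<gamma> s0) = Re (\<gamma> a) + u * (Re (\<gamma> b) - Re (\<gamma> a))" using arg_cong[OF u(3), of Re] by (simp add: algebra_simps)
  have "0 < u * (Re (\<gamma> b) - Re (\<gamma> a))" "u * (Re (\<gamma> b) - Re (\<gamma> a)) < 1 * (Re (\<gamma> b) - Re (\<gamma> a))"
    using u Re_end by (auto intro: mult_strict_right_mono)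
  then have Re0': "Re (\<gamma> a) < Re (\<gamma> s0)" "Re (\<gamma> s0) < Re (\<gamma> b)" using Re0 by auto
  have "s0 \<in> K" unfolding K_def
    using c(3)[of s0] s0 \<open>s0 \<noteq> a\<close> Im0 Re0' by force
  have "continuous_on K (\<lambda>s. Re (\<gamma> s))"
    by (intro continuous_intros continuous_on_subset[OF cont_arc]) (use c in \<open>auto simp: K_def\<close>)
  then obtain s1 where s1: "s1 \<in> K" "\<And>s. s \<in> K \<Longrightarrow> Re (\<gamma> s1) \<le> Re (\<gamma> s)"
    using continuous_attains_inf[OF \<open>compact K\<close>, of "\<lambda>s. Re (\<gamma> s)"] \<open>s0 \<in> K\<close> by auto
  show thesis
  proof
    show "a < s1" using s1(1) c by (auto simp: K_def)
    show "Im (\<gamma> s1) = Im (\<gamma> a)" using s1(1) by (auto simp: K_def)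
    show "Re (\<gamma> s1) < Re (\<gamma> b)" using s1(2)[OF \<open>s0 \<in> K\<close>] Re0' by simp
    then have "s1 \<noteq> b" by auto
    then show "s1 < b" using s1(1) by (auto simp: K_def)
    have "\<gamma> s1 \<noteq> \<gamma> a" using arc[of a s1] \<open>a < s1\<close> \<open>s1 < b\<close> by auto
    then show "Re (\<gamma> a) < Re (\<gamma> s1)"
      using s1(1) by (auto simp: K_def complex_eq_iff)
    fix s assume "a < s" "s \<le> b" "Im (\<gamma> s) = Im (\<gamma> a)" "Re (\<gamma> a) < Re (\<gamma> s)"
    then show "Re (\<gamma> s1) \<le> Re (\<gamma> s)"
      using c(3)[of s] by (intro s1(2)) (force simp: K_def)
  qed
qed

text \<open>Let \<open>s1\<close> be the crossing of the open segment from \<open>\<gamma> a\<close> to \<open>\<gamma> b\<close> nearest to \<open>\<gamma> a\<close>. The arc from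
  \<open>\<gamma> a\<close> to \<open>\<gamma> s1\<close>, closed up by a segment that it does not meet, winds \<open>W b / (2 * pi) \<ge> 1\<close> times around
  every \<open>\<gamma> s\<close> with \<open>s > s1\<close>. An extreme point of the arc lies outside the closed curve, hence comes
  before \<open>s1\<close>, and the winding seen from points just after \<open>s1\<close> fixes the orientation of the
  curve there. The reversed arc gives the opposite orientation.\<close>
lemma tangent_at_extreme_height:
  assumes \<sigma>: "\<bar>\<sigma>\<bar> = (1::real)" and e: "a \<le> e" "e \<le> b"
    and ext: "\<And>s. a \<le> s \<Longrightarrow> s \<le> b \<Longrightarrow> \<sigma> * Im (\<gamma> e) \<le> \<sigma> * Im (\<gamma> s)"
  shows "cos (\<Phi> (e, e)) = \<sigma>"
proof -
  \<comment> \<open>The arc is below the line near \<open>a\<close> and above it near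
    \<open>b\<close>, so for either sign of \<open>\<sigma>\<close> the extreme point lies strictly
    off the line.\<close>
  have "\<exists>s. a \<le> s \<and> s \<le> b \<and> \<sigma> * Im (\<gamma> s) < \<sigma> * Im (\<gamma> a)"
  proof (cases "\<sigma> = 1")
    case True
    obtain c where "a < c" "c \<le> b" "\<And>s. a < s \<Longrightarrow> s < c \<Longrightarrow> Im (\<gamma> s) < Im (\<gamma> a)"
      using below_near_start by blast
    then show ?thesis using True by (intro exI[of _ "(a + c) / 2"]) auto
  next
    case False
    then have "\<sigma> = -1" using \<sigma> by auto
    moreover obtain c where "a \<le> c" "c < b" "\<And>s. c < s \<Longrightarrow> s < b \<Longrightarrow> Im (\<gamma> a) < Im (\<gamma> s)"
      using above_near_end by blast
    ultimately show ?thesis by (intro exI[of _ "(b + c) / 2"]) auto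
  qed
  then have off: "\<sigma> * Im (\<gamma> e) < \<sigma> * Im (\<gamma> a)" using ext by force
  then have "e \<noteq> a" "e \<noteq> b" using Im_end by auto
  then have e': "a < e" "e < b" using e by auto
  obtain s1 where s1: "a < s1" "s1 < b" "Im (\<gamma> s1) = Im (\<gamma> a)" "Re (\<gamma> a) < Re (\<gamma> s1)" "Re (\<gamma> s1) < Re (\<gamma> b)"
    "\<And>s. a < s \<Longrightarrow> s \<le> b \<Longrightarrow> Im (\<gamma> s) = Im (\<gamma> a) \<Longrightarrow> Re (\<gamma> a) < Re (\<gamma> s) \<Longrightarrow> Re (\<gamma> s1) \<le> Re (\<gamma> s)"
    by (rule first_crossing) blast
  have "e \<noteq> s1" using off s1 by auto

  \<comment> \<open>Seen from \<open>\<gamma> s\<close>, the arc from \<open>\<gamma> a\<close> to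
    \<open>\<gamma> s1\<close> sweeps the angle \<open>\<Phi> (s1, s) - \<Phi> (a, s)\<close> and
    the segment back to \<open>\<gamma> a\<close> sweeps \<open>Arg (Q s)\<close>.\<close>
  define Q where "Q s = (\<gamma> a - \<gamma> s) / (\<gamma> s1 - \<gamma> s)" for s
  define W where "W s = \<Phi> (s1, s) - \<Phi> (a, s) + Arg (Q s)" for s
  \<comment> \<open>A nonpositive real quotient would place \<open>\<gamma> s\<close> on the closed
    segment from \<open>\<gamma> a\<close> to \<open>\<gamma> s1\<close>. Excluding this keeps
    \<open>Arg (Q s)\<close> continuous.\<close>
  have Q: "Q s \<notin> \<real>\<^sub>\<le>\<^sub>0" if s: "s1 < s" "s \<le> b" for s
  proof
    assume "Q s \<in> \<real>\<^sub>\<le>\<^sub>0"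
    then obtain r where r: "r \<ge> 0" "Q s = of_real (- r)"
      by (metis nonpos_Reals_cases neg_0_le_iff_le minus_minus)
    have ne: "\<gamma> s \<noteq> \<gamma> s1" "\<gamma> s \<noteq> \<gamma> a" using arc[of s1 s] arc[of a s] s s1 by auto
    then have eq: "\<gamma> a - \<gamma> s = of_real (- r) * (\<gamma> s1 - \<gamma> s)"
      using r(2) unfolding Q_def by (simp add: field_simps)
    have "Im (\<gamma> a) - Im (\<gamma> s) = - r * (Im (\<gamma> a) - Im (\<gamma> s))"
      using arg_cong[OF eq, of Im] s1(3) by simp
    then have "(1 + r) * (Im (\<gamma> a) - Im (\<gamma> s)) = 0" by (simp add: algebra_simps)
    then have Im: "Im (\<gamma> s) = Im (\<gamma> a)" using r(1) by (simp add: add_nonneg_eq_0_iff)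
    have Re: "Re (\<gamma> a) - Re (\<gamma> s) = - r * (Re (\<gamma> s1) - Re (\<gamma> s))"
      using arg_cong[OF eq, of Re] by simp
    have "Re (\<gamma> s) \<noteq> Re (\<gamma> a)" "Re (\<gamma> s) \<noteq> Re (\<gamma> s1)" using ne Im s1(3) by (auto simp: complex_eq_iff)
    then consider "Re (\<gamma> s) < Re (\<gamma> a)" | "Re (\<gamma> s1) < Re (\<gamma> s)" using s1(6)[of s] Im s s1(1) by force
    then show False
    proof cases
      case 1
      then have "0 \<le> r * (Re (\<gamma> s1) - Re (\<gamma> s))" using s1(4) r(1) by (intro mult_nonneg_nonneg) auto
      then show False using Re 1 by simp
    next
      case 2
      then have "0 \<le> r * (Re (\<gamma> s) - Re (\<gamma> s1))" using r(1) by (intro mult_nonneg_nonneg) auto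
      then show False using Re 2 s1(4) by (simp add: algebra_simps)
    qed
  qed
  have "\<gamma> s1 - \<gamma> s \<noteq> 0" if "s \<in> {s1<..b}" for s
    using arc[of s1 s] s1(1) that by auto
  then have "continuous_on {s1<..b} Q"
    unfolding Q_def using s1
    by (intro continuous_intros continuous_on_subset[OF cont_arc]) auto
  then have contArg: "continuous_on {s1<..b} (\<lambda>s. Arg (Q s))"
    by (rule continuous_on_compose2[OF continuous_on_Arg]) (use Q in auto)
  have contW: "continuous_on {s1<..b} W"
    unfolding W_def by (intro continuous_intros contArg) (use s1 in auto)
  have cisW: "cis (W s) = 1" if s: "s \<in> {s1<..b}" for s
  proof -
    have ne: "\<gamma> s - \<gamma> s1 \<noteq> 0" "\<gamma> s - \<gamma> a \<noteq> 0" "\<gamma> a - \<gamma> s \<noteq> 0" "\<gamma> s1 - \<gamma> s \<noteq> 0"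
      using arc[of s1 s] arc[of a s] s s1 by auto
    define m n where "m = norm (\<gamma> s - \<gamma> s1)" and "n = norm (\<gamma> s - \<gamma> a)"
    have pos: "m \<noteq> 0" "n \<noteq> 0" using ne by (auto simp: m_def n_def)
    have "Q s = (\<gamma> s - \<gamma> a) / (\<gamma> s - \<gamma> s1)"
      using ne by (simp add: Q_def field_simps)
    moreover have "norm (Q s) = n / m" by (simp add: Q_def norm_divide m_def n_def norm_minus_commute)
    moreover have "Q s \<noteq> 0" using ne by (simp add: Q_def)
    then have "cis (Arg (Q s)) = Q s / of_real (norm (Q s))"
      by (simp add: cis_Arg sgn_eq)
    ultimately have "cis (Arg (Q s)) = (\<gamma> s - \<gamma> a) / (\<gamma> s - \<gamma> s1) / of_real (n / m)"
      by simp
    moreover have "cis (\<Phi> (s1, s)) = (\<gamma> s - \<gamma> s1) / of_real m" "cis (\<Phi> (a, s)) = (\<gamma> s - \<gamma> a) / of_real n"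
      using cis_lift[of s1 s] cis_lift[of a s] s s1 by (auto simp: m_def n_def)
    moreover have "cis (W s) = cis (\<Phi> (s1, s)) / cis (\<Phi> (a, s)) * cis (Arg (Q s))"
      by (simp add: W_def cis_mult cis_divide)
    ultimately have "cis (W s) = (\<gamma> s - \<gamma> s1) / of_real m / ((\<gamma> s - \<gamma> a) / of_real n) *
        ((\<gamma> s - \<gamma> a) / (\<gamma> s - \<gamma> s1) / of_real (n / m))" by simp
    also have "\<dots> = (\<gamma> s - \<gamma> s1) / (\<gamma> s - \<gamma> s1) * ((\<gamma> s - \<gamma> a) / (\<gamma> s - \<gamma> a))"
      using pos by (simp add: mult.commute)
    also have "\<dots> = 1" using ne(1,2) by simp
    finally show ?thesis .
  qed
  \<comment> \<open>\<open>\<gamma> b\<close> is on the line of the segment, beyond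
    \<open>\<gamma> s1\<close>. Hence \<open>W b\<close> is \<open>\<Phi> (s1, b)\<close>, a
    positive multiple of \<open>2 * pi\<close>.\<close>
  have "Arg (Q b) = 0"
  proof -
    have "Q b = of_real ((Re (\<gamma> b) - Re (\<gamma> a)) / (Re (\<gamma> b) - Re (\<gamma> s1)))"
      using s1 Im_end unfolding Q_def by (simp add: complex_eq_iff Re_divide_Reals Im_divide_Reals complex_is_Real_iff field_simps)
    moreover have "(Re (\<gamma> b) - Re (\<gamma> a)) / (Re (\<gamma> b) - Re (\<gamma> s1)) > 0" using s1 Re_end by simp
    ultimately show ?thesis by (auto simp only: Arg_of_real split: if_splits)
  qed
  then have "W b > 0" using corner pos[of s1 b] s1 by (simp add: W_def)
  moreover obtain k :: int where "W b = 2 * pi * of_int k"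
    using cisW[of b] s1 by (auto simp: cis_eq_1_iff)
  ultimately have "W b \<ge> 2 * pi"
    by (simp add: zero_less_mult_iff)
  have W: "W s \<ge> 2 * pi" if "s1 < s" "s \<le> b" for s
    using cis_1_imp_constant[OF _ contW cisW, of s b] that \<open>W b \<ge> 2 * pi\<close> by auto

  have sgnl: "\<sigma> * sin (\<Phi> (u, e)) \<le> 0" if "a \<le> u" "u < e" for u
    using sin_lift[of u e] that e ext[of u]
    by (simp add: divide_le_0_iff algebra_simps arc)
  have sgnr: "\<sigma> * sin (\<Phi> (e, u)) \<ge> 0" if "e < u" "u \<le> b" for u
    using sin_lift[of e u] that e ext[of u]
    by (simp add: zero_le_divide_iff algebra_simps arc)

  \<comment> \<open>From an extreme point after \<open>s1\<close> the whole arc is on one side, so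
    it sweeps at most \<open>pi\<close>, and the segment less than \<open>pi\<close>: too little for
    \<open>W e \<ge> 2 * pi\<close>.\<close>
  have "e < s1"
  proof (rule ccontr)
    assume "\<not> e < s1"
    then have "s1 < e" using \<open>e \<noteq> s1\<close> by simp
    have "continuous_on {a..s1} (\<lambda>u. \<Phi> (u, e))"
      by (intro continuous_intros) (use \<open>s1 < e\<close> e' s1 in auto)
    then have "\<Phi> (s1, e) - \<Phi> (a, e) \<le> pi"
      by (rule sin_sign_imp_oscillation_le_pi[OF _ _ _ \<sigma>]) (use \<open>s1 < e\<close> s1 sgnl in auto)
    moreover have "Arg (Q e) < pi"
      using Q[of e] \<open>s1 < e\<close> e Arg_le_pi[of "Q e"] Arg_eq_pi_iff[of "Q e"]
      by (auto simp: le_less complex_nonpos_Reals_iff complex_is_Real_iff)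
    ultimately show False using W[of e] \<open>s1 < e\<close> e by (auto simp: W_def)
  qed

  \<comment> \<open>The segment contributes at most \<open>pi\<close> to \<open>W s\<close>; the
    remaining part is continuous up to \<open>s1\<close>, where the tangent angle appears.\<close>
  have "pi \<le> \<Phi> (s1, s1) - \<Phi> (a, s1)"
  proof (rule continuous_le_at_left_endpoint[of s1 b "\<lambda>s. \<Phi> (s1, s) - \<Phi> (a, s)"])
    show "continuous_on {s1..b} (\<lambda>s. \<Phi> (s1, s) - \<Phi> (a, s))"
      by (intro continuous_intros) (use s1 in auto)
    show "pi \<le> \<Phi> (s1, s) - \<Phi> (a, s)" if "s1 < s" "s \<le> b" for s
      using W[OF that] Arg_le_pi[of "Q s"] by (simp add: W_def)
  qed (use s1 in auto)
  then have D1: "\<Phi> (a, s1) - \<Phi> (s1, s1) < 0" using pi_gt_zero by linarith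
  \<comment> \<open>A zero between \<open>e\<close> and \<open>s1\<close> would give a crossing of
    the segment nearer to \<open>\<gamma> a\<close> than \<open>\<gamma> s1\<close>.\<close>
  have De: "\<Phi> (a, e) - \<Phi> (e, s1) < 0"
  proof (rule ccontr)
    assume "\<not> ?thesis"
    moreover have "continuous_on {e..s1} (\<lambda>s. \<Phi> (a, s) - \<Phi> (s, s1))"
      by (intro continuous_intros) (use s1 e' in auto)
    ultimately have "\<exists>s. e \<le> s \<and> s \<le> s1 \<and> \<Phi> (a, s) - \<Phi> (s, s1) = 0"
      using D1 \<open>e < s1\<close> by (intro IVT2') auto
    then obtain s where s: "e \<le> s" "s \<le> s1" "\<Phi> (a, s) = \<Phi> (s, s1)" by auto
    then have "s \<noteq> s1" using D1 by auto
    then have "\<gamma> s \<in> open_segment (\<gamma> a) (\<gamma> s1)"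
      using s s1 e' by (intro parallel_chords_imp_between) auto
    then obtain u where u: "0 < u" "u < 1" "\<gamma> s = (1 - u) *\<^sub>R \<gamma> a + u *\<^sub>R \<gamma> s1"
      unfolding in_segment by blast
    have Im: "Im (\<gamma> s) = Im (\<gamma> a)" using arg_cong[OF u(3), of Im] s1(3) by (simp add: algebra_simps)
    have Re: "Re (\<gamma> s) = Re (\<gamma> a) + u * (Re (\<gamma> s1) - Re (\<gamma> a))"
      using arg_cong[OF u(3), of Re] by (simp add: algebra_simps)
    have "0 < u * (Re (\<gamma> s1) - Re (\<gamma> a))" "u * (Re (\<gamma> s1) - Re (\<gamma> a)) < 1 * (Re (\<gamma> s1) - Re (\<gamma> a))"
      using u s1 by (auto intro: mult_strict_right_mono)
    then have "Re (\<gamma> a) < Re (\<gamma> s)" "Re (\<gamma> s) < Re (\<gamma> s1)" unfolding Re by simp_all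
    then show False using s1(6)[OF _ _ Im] s e' s1(2) by linarith
  qed

  have contl: "continuous_on {a..e} (\<lambda>u. \<Phi> (u, e))"
    by (intro continuous_intros) (use e in auto)
  have contr: "continuous_on {e..b} (\<lambda>u. \<Phi> (e, u))"
    by (intro continuous_intros) (use e in auto)
  have "0 \<le> \<sigma> * sin (\<Phi> (e, e))"
    by (rule continuous_le_at_left_endpoint[where f = "\<lambda>u. \<sigma> * sin (\<Phi> (e, u))" and d = b])
       (use e' sgnr in \<open>auto intro!: continuous_intros contr\<close>)
  moreover have "0 \<le> - \<sigma> * sin (\<Phi> (e, e))"
    by (rule continuous_le_at_right_endpoint[where f = "\<lambda>u. - \<sigma> * sin (\<Phi> (u, e))" and c = a])
       (use e' sgnl in \<open>auto intro!: continuous_intros contl\<close>)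
  ultimately have sin0: "sin (\<Phi> (e, e)) = 0" using \<sigma> by (auto simp: abs_if split: if_splits)
  then have cos1: "\<bar>cos (\<Phi> (e, e))\<bar> = 1"
    using sin_cos_squared_add[of "\<Phi> (e, e)"] by (simp add: abs_square_eq_1)
  show ?thesis
  proof (rule ccontr)
    \<comment> \<open>With the tangent pointing the other way, \<open>\<Phi> (e, u)\<close> cannot
      rise above the tangent angle, nor \<open>\<Phi> (u, e)\<close> fall below it, without the sine
      taking the sign excluded by \<open>sgnr\<close> or \<open>sgnl\<close>. This gives
      \<open>\<Phi> (e, s1) \<le> \<Phi> (a, e)\<close>, against \<open>De\<close>.\<close>
    assume "cos (\<Phi> (e, e)) \<noteq> \<sigma>"
    then have opp: "\<sigma> * cos (\<Phi> (e, e)) = -1"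
      using cos1 \<sigma> by (auto simp: abs_if split: if_splits)
    have sinv: "\<sigma> * sin v = - sin (v - \<Phi> (e, e))" for v
    proof -
      have "sin v = sin (v - \<Phi> (e, e)) * cos (\<Phi> (e, e))"
        using sin_add[of "v - \<Phi> (e, e)" "\<Phi> (e, e)"] sin0 by simp
      then have "\<sigma> * sin v = (\<sigma> * cos (\<Phi> (e, e))) * sin (v - \<Phi> (e, e))" by simp
      then show ?thesis using opp by simp
    qed
    have "\<Phi> (e, s1) \<le> \<Phi> (e, e)"
    proof (rule ccontr)
      assume neg: "\<not> ?thesis"
      define v where "v = min (\<Phi> (e, s1)) (\<Phi> (e, e) + pi / 2)"
      have "\<exists>u. e \<le> u \<and> u \<le> s1 \<and> \<Phi> (e, u) = v"
        by (rule IVT') (use neg \<open>e < s1\<close> s1 in \<open>auto simp: v_def intro: continuous_on_subset[OF contr]\<close>)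
      then obtain u where u: "e \<le> u" "u \<le> s1" "\<Phi> (e, u) = v" by auto
      have v: "\<Phi> (e, e) < v" "v \<le> \<Phi> (e, e) + pi / 2" using neg by (auto simp: v_def)
      then have "u \<noteq> e" using u by auto
      then have "0 \<le> \<sigma> * sin v" using sgnr[of u] u s1 by auto
      moreover have "sin (v - \<Phi> (e, e)) > 0" using v by (intro sin_gt_zero) auto
      ultimately show False unfolding sinv by simp
    qed
    moreover have "\<Phi> (e, e) \<le> \<Phi> (a, e)"
    proof (rule ccontr)
      assume neg: "\<not> ?thesis"
      define v where "v = max (\<Phi> (a, e)) (\<Phi> (e, e) - pi / 2)"
      have "\<exists>u. a \<le> u \<and> u \<le> e \<and> \<Phi> (u, e) = v"
        by (rule IVT') (use neg e contl in \<open>auto simp: v_def\<close>)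
      then obtain u where u: "a \<le> u" "u \<le> e" "\<Phi> (u, e) = v" by auto
      have v: "v < \<Phi> (e, e)" "\<Phi> (e, e) - pi / 2 \<le> v" using neg by (auto simp: v_def)
      then have "u \<noteq> e" using u by auto
      then have "\<sigma> * sin v \<le> 0" using sgnl[of u] u by auto
      moreover have "sin (\<Phi> (e, e) - v) > 0" using v by (intro sin_gt_zero) auto
      then have "sin (v - \<Phi> (e, e)) < 0" using sin_minus[of "\<Phi> (e, e) - v"] by simp
      ultimately show False unfolding sinv by simp
    qed
    ultimately show False using De by simp
  qed
qed


text \<open>Reversal of the parameter combined with a point reflection preserves every chord
  direction but exchanges highest and lowest points.\<close>

lemma reversed: "extremal_chord_lift (\<lambda>s. - \<gamma> (a + b - s)) (\<lambda>(s, s'). \<Phi> (a + b - s', a + b - s)) a b"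
proof
  show "continuous_on {a..b} (\<lambda>s. - \<gamma> (a + b - s))"
    by (intro continuous_intros continuous_on_compose2[OF cont_arc]) auto
  show "continuous_on {(s, s'). a \<le> s \<and> s \<le> s' \<and> s' \<le> b} (\<lambda>(s, s'). \<Phi> (a + b - s', a + b - s))"
    unfolding case_prod_unfold by (intro continuous_intros) auto
  fix s s' assume s: "a \<le> s" "s < s'" "s' \<le> b"
  show "- \<gamma> (a + b - s') \<noteq> - \<gamma> (a + b - s)" using arc[of "a + b - s'" "a + b - s"] s by auto
  show "- \<gamma> (a + b - s') - - \<gamma> (a + b - s) = of_real (norm (- \<gamma> (a + b - s') - - \<gamma> (a + b - s))) *
      cis (case (s, s') of (s, s') \<Rightarrow> \<Phi> (a + b - s', a + b - s))"
    using chord[of "a + b - s'" "a + b - s"] s by simp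
qed (use nontrivial corner in \<open>auto intro!: pos\<close>)

text \<open>The highest point has a tangent pointing left; as the lowest point of the reversed arc
  it has the same tangent angle, now pointing right.\<close>

lemma contradiction: False
proof -
  have "continuous_on {a..b} (\<lambda>s. Im (\<gamma> s))" by (intro continuous_intros cont_arc)
  then obtain e where e: "e \<in> {a..b}" "\<And>s. s \<in> {a..b} \<Longrightarrow> Im (\<gamma> s) \<le> Im (\<gamma> e)"
    using continuous_attains_sup[of "{a..b}" "\<lambda>s. Im (\<gamma> s)"] ab by force
  have "cos (\<Phi> (e, e)) = -1"
    by (rule tangent_at_extreme_height) (use e in auto)
  moreover
  interpret R: extremal_chord_lift "\<lambda>s. - \<gamma> (a + b - s)" "\<lambda>(s, s'). \<Phi> (a + b - s', a + b - s)" a b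
    by (rule reversed)
  have "cos (case (a + b - e, a + b - e) of (s, s') \<Rightarrow> \<Phi> (a + b - s', a + b - s)) = 1"
    by (rule R.tangent_at_extreme_height) (use e in auto)
  ultimately show False by simp
qed

end

section \<open>Reduction of an arbitrary arc to the extremal case\<close>

context chord_lift begin

lemma subarc: "a \<le> c \<Longrightarrow> c \<le> d \<Longrightarrow> d \<le> b \<Longrightarrow> chord_lift \<gamma> \<Phi> c d"
proof
  fix s s' assume "a \<le> c" "d \<le> b" "c \<le> s" "s < s'" "s' \<le> d"
  then have s: "a \<le> s" "s < s'" "s' \<le> b" by auto
  show "\<gamma> s' \<noteq> \<gamma> s" by (rule arc[OF s])
  show "\<gamma> s' - \<gamma> s = of_real (norm (\<gamma> s' - \<gamma> s)) * cis (\<Phi> (s, s'))" by (rule chord[OF s])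
qed (auto intro: continuous_on_subset[OF cont_arc] continuous_on_subset[OF cont_lift])

lemma rotated: "chord_lift (\<lambda>s. \<gamma> s * cis (- c)) (\<lambda>x. \<Phi> x - c) a b"
proof
  show "continuous_on {a..b} (\<lambda>s. \<gamma> s * cis (- c))"
    by (intro continuous_intros cont_arc)
  fix s s' assume s: "a \<le> s" "s < s'" "s' \<le> b"
  show "\<gamma> s' * cis (- c) \<noteq> \<gamma> s * cis (- c)" using arc[OF s] by simp
  have *: "\<gamma> s' * cis (- c) - \<gamma> s * cis (- c) = (\<gamma> s' - \<gamma> s) * cis (- c)" by (simp add: algebra_simps)
  show "\<gamma> s' * cis (- c) - \<gamma> s * cis (- c) = of_real (norm (\<gamma> s' * cis (- c) - \<gamma> s * cis (- c))) *
      cis (\<Phi> (s, s') - c)"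
    unfolding * norm_mult norm_cis mult_1_right
    by (subst chord[OF s]) (simp add: cis_mult mult.assoc)
qed (auto intro!: continuous_intros cont_lift ab)

lemma reflected: "chord_lift (\<lambda>s. cnj (\<gamma> s)) (\<lambda>x. - \<Phi> x) a b"
proof
  fix s s' assume s: "a \<le> s" "s < s'" "s' \<le> b"
  show "cnj (\<gamma> s') \<noteq> cnj (\<gamma> s)" using arc[OF s] by simp
  have *: "cnj (\<gamma> s') - cnj (\<gamma> s) = cnj (\<gamma> s' - \<gamma> s)" by simp
  show "cnj (\<gamma> s') - cnj (\<gamma> s) = of_real (norm (cnj (\<gamma> s') - cnj (\<gamma> s))) * cis (- \<Phi> (s, s'))"
    unfolding * complex_mod_cnj
    by (subst chord[OF s]) (simp add: cis_cnj)
qed (auto intro!: continuous_intros cont_lift cont_arc ab)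

theorem tangent_parallel_to_chord: "\<exists>s\<in>{a..b}. \<Phi> (s, s) = \<Phi> (a, b)"
proof (rule ccontr)
  assume contra: "\<not> (\<exists>s\<in>{a..b}. \<Phi> (s, s) = \<Phi> (a, b))"
  define T where "T = {(s, s'). a \<le> s \<and> s \<le> s' \<and> s' \<le> b}"
  define Z where "Z = T \<inter> (\<lambda>x. \<Phi> x) -` {\<Phi> (a, b)}"
  have T: "T = ({a..b} \<times> {a..b}) \<inter> {x. fst x \<le> snd x}" by (auto simp: T_def)
  have "closed {x :: real \<times> real. fst x \<le> snd x}"
    by (intro closed_Collect_le continuous_intros)
  then have "compact T" unfolding T by (intro compact_Int_closed compact_Times compact_Icc)
  moreover have "closed Z" unfolding Z_def
    using cont_lift compact_imp_closed[OF \<open>compact T\<close>]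
    by (intro continuous_closed_preimage) (auto simp: T_def)
  ultimately have "compact Z" using compact_Int_closed[of T Z] by (simp add: Z_def Int_assoc[symmetric])
  moreover have "(a, b) \<in> Z" using ab by (simp add: Z_def T_def)
  moreover have "continuous_on Z (\<lambda>x. snd x - fst x)" by (intro continuous_intros)
  ultimately obtain x where "x \<in> Z" and xmin: "\<And>y. y \<in> Z \<Longrightarrow> snd x - fst x \<le> snd y - fst y"
    using continuous_attains_inf[of Z "\<lambda>x. snd x - fst x"] by blast
  obtain c d where cd: "x = (c, d)" by fastforce
  have cdZ: "a \<le> c" "c \<le> d" "d \<le> b" "\<Phi> (c, d) = \<Phi> (a, b)"
    using \<open>x \<in> Z\<close> by (auto simp: cd Z_def T_def)
  have "c \<noteq> d" using contra cdZ by auto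
  \<comment> \<open>The triangle over \<open>[c, d]\<close> without its corner. It is convex, hence
    connected, and by minimality of \<open>d - c\<close> the angle \<open>\<Phi> (a, b)\<close> is
    not attained on it, so \<open>\<Phi> - \<Phi> (a, b)\<close> keeps one sign; the sign decides
    whether a reflection is applied.\<close>
  define T' where "T' = {(s, s'). c \<le> s \<and> s \<le> s' \<and> s' \<le> d \<and> s' - s < d - c}"
  have ne: "\<Phi> y \<noteq> \<Phi> (a, b)" if "y \<in> T'" for y
    using xmin[of y] that cdZ by (auto simp: cd Z_def T_def T'_def)
  have "convex T'"
  proof (rule convexI)
    fix x y :: "real \<times> real" and u v :: real
    assume *: "x \<in> T'" "y \<in> T'" "0 \<le> u" "0 \<le> v" "u + v = 1"
    have "u * (- fst x) + v * (- fst y) \<le> - c" "u * snd x + v * snd y \<le> d"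
      by (rule convex_bound_le; use * in \<open>auto simp: T'_def\<close>)+
    moreover have "u * (snd x - fst x) + v * (snd y - fst y) < d - c"
      by (rule convex_bound_lt; use * in \<open>auto simp: T'_def\<close>)
    moreover have "u * fst x \<le> u * snd x" "v * fst y \<le> v * snd y"
      by (rule mult_left_mono; use * in \<open>auto simp: T'_def\<close>)+
    ultimately show "u *\<^sub>R x + v *\<^sub>R y \<in> T'"
      by (cases x; cases y) (auto simp: T'_def algebra_simps)
  qed
  moreover have "continuous_on T' \<Phi>"
    by (rule continuous_on_subset[OF cont_lift]) (use cdZ in \<open>auto simp: T'_def\<close>)
  ultimately have conn: "connected (\<Phi> ` T')"
    by (intro connected_continuous_image convex_connected)
  have cc: "(c, c) \<in> T'" using \<open>c \<noteq> d\<close> cdZ by (auto simp: T'_def)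
  have between: False if "x \<in> T'" "y \<in> T'" "\<Phi> x \<le> \<Phi> (a, b)" "\<Phi> (a, b) \<le> \<Phi> y" for x y
    using connectedD_interval[OF conn imageI[OF that(1)] imageI[OF that(2)] that(3,4)] ne by (metis imageE)
  have T'I: "(s, s') \<in> T'" if "c \<le> s" "s \<le> s'" "s' \<le> d" "(s, s') \<noteq> (c, d)" for s s'
    using that by (auto simp: T'_def)
  interpret C: chord_lift \<gamma> \<Phi> c d using cdZ by (intro subarc)
  interpret C: chord_lift "\<lambda>s. \<gamma> s * cis (- \<Phi> (a, b))" "\<lambda>x. \<Phi> x - \<Phi> (a, b)" c d
    by (rule C.rotated)
  show False
  proof (cases "\<Phi> (c, c) > \<Phi> (a, b)")
    case True
    interpret E: extremal_chord_lift "\<lambda>s. \<gamma> s * cis (- \<Phi> (a, b))" "\<lambda>x. \<Phi> x - \<Phi> (a, b)" c d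
    proof
      fix s s' assume "c \<le> s" "s \<le> s'" "s' \<le> d" "(s, s') \<noteq> (c, d)"
      then show "\<Phi> (s, s') - \<Phi> (a, b) > 0" using between[OF T'I cc] True by force
    qed (use \<open>c \<noteq> d\<close> cdZ in auto)
    show False by (rule E.contradiction)
  next
    case False
    interpret E: chord_lift "\<lambda>s. cnj (\<gamma> s * cis (- \<Phi> (a, b)))" "\<lambda>x. - (\<Phi> x - \<Phi> (a, b))" c d
      by (rule C.reflected)
    interpret E: extremal_chord_lift "\<lambda>s. cnj (\<gamma> s * cis (- \<Phi> (a, b)))" "\<lambda>x. - (\<Phi> x - \<Phi> (a, b))" c d
    proof
      fix s s' assume "c \<le> s" "s \<le> s'" "s' \<le> d" "(s, s') \<noteq> (c, d)"
      then show "- (\<Phi> (s, s') - \<Phi> (a, b)) > 0" using between[OF cc T'I] False by force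
    qed (use \<open>c \<noteq> d\<close> cdZ in auto)
    show False by (rule E.contradiction)
  qed
qed

end

section \<open>Birkhoff's ergodic theorem\<close>

locale measure_preserving_map = prob_space M for M :: "'a measure" +
  fixes T :: "'a \<Rightarrow> 'a"
  assumes T_measurable [measurable]: "T \<in> M \<rightarrow>\<^sub>M M"
    and T_preserves: "distr M M T = M"
begin

lemma funpow_measurable [measurable]: "T ^^ k \<in> M \<rightarrow>\<^sub>M M"
  by (induction k) (auto simp: id_def intro: measurable_comp)

lemma funpow_preserves: "distr M M (T ^^ k) = M"
proof (induction k)
  case 0
  then show ?case using distr_id by (simp add: id_def)
next
  case (Suc k)
  have "distr M M (T ^^ Suc k) = distr (distr M M (T ^^ k)) M T"
    by (simp add: distr_distr)
  then show ?case using Suc T_preserves by (simp del: funpow.simps)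
qed

lemma integral_compose:
  fixes g :: "'a \<Rightarrow> real"
  assumes [measurable]: "g \<in> borel_measurable M"
  shows "(\<integral>x. g ((T ^^ k) x) \<partial>M) = (\<integral>x. g x \<partial>M)"
  using integral_distr[of "T ^^ k" M M g] funpow_preserves[of k] by simp

definition birkhoff_sum :: "('a \<Rightarrow> real) \<Rightarrow> nat \<Rightarrow> 'a \<Rightarrow> real" where
  "birkhoff_sum g n x = (\<Sum>k<n. g ((T ^^ k) x))"

lemma birkhoff_sum_measurable [measurable]:
  assumes [measurable]: "g \<in> borel_measurable M"
  shows "birkhoff_sum g n \<in> borel_measurable M"
proof -
  have "(\<lambda>x. g ((T ^^ k) x)) \<in> borel_measurable M" for k
    by (rule measurable_compose[OF funpow_measurable assms])
  then show ?thesis unfolding birkhoff_sum_def by (intro borel_measurable_sum)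
qed

lemma birkhoff_sum_Suc: "birkhoff_sum g (Suc n) x = g x + birkhoff_sum g n (T x)"
  unfolding birkhoff_sum_def
  by (simp add: sum.lessThan_Suc_shift funpow_Suc_right del: funpow.simps sum.lessThan_Suc)

lemma birkhoff_sum_0 [simp]: "birkhoff_sum g 0 x = 0"
  by (simp add: birkhoff_sum_def)

lemma birkhoff_sum_bound:
  assumes "\<And>x. \<bar>g x\<bar> \<le> B"
  shows "\<bar>birkhoff_sum g n x\<bar> \<le> real n * B"
proof -
  have "\<bar>birkhoff_sum g n x\<bar> \<le> (\<Sum>k<n. \<bar>g ((T ^^ k) x)\<bar>)"
    unfolding birkhoff_sum_def by (rule sum_abs)
  also have "\<dots> \<le> real (card {..<n}) * B" by (rule sum_bounded_above) (rule assms)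
  finally show ?thesis by simp
qed

text \<open>The maximum of the first Birkhoff sums, including the empty one; the recursion is the
  form in which Garsia's argument uses it.\<close>
fun max_sum :: "('a \<Rightarrow> real) \<Rightarrow> nat \<Rightarrow> 'a \<Rightarrow> real" where
  "max_sum g 0 x = 0"
| "max_sum g (Suc N) x = max 0 (g x + max_sum g N (T x))"

lemma max_sum_measurable [measurable]:
  "g \<in> borel_measurable M \<Longrightarrow> max_sum g N \<in> borel_measurable M"
proof (induction N)
  case 0
  have "max_sum g 0 = (\<lambda>x. 0)" by auto
  then show ?case by simp
next
  case (Suc N)
  note [measurable] = Suc
  have "max_sum g (Suc N) = (\<lambda>x. max 0 (g x + max_sum g N (T x)))" by auto
  then show ?case by simp
qed

lemma max_sum_nonneg: "0 \<le> max_sum g N x"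
  by (cases N) auto

lemma max_sum_mono: "max_sum g N x \<le> max_sum g (Suc N) x"
proof (induction N arbitrary: x)
  case (Suc N)
  show ?case using Suc[of "T x"] by (subst (1 2) max_sum.simps(2)) (auto simp del: max_sum.simps)
qed simp

lemma birkhoff_sum_le_max_sum: "birkhoff_sum g N x \<le> max_sum g N x"
proof (induction N arbitrary: x)
  case (Suc N)
  show ?case using Suc[of "T x"] by (simp add: birkhoff_sum_Suc)
qed simp

lemma max_sum_bound: "(\<And>x. \<bar>g x\<bar> \<le> B) \<Longrightarrow> \<bar>max_sum g N x\<bar> \<le> real N * B"
proof (induction N arbitrary: x)
  case (Suc N)
  have "\<bar>g x\<bar> \<le> B" "\<bar>max_sum g N (T x)\<bar> \<le> real N * B" "0 \<le> B"
    using Suc.IH[of "T x", OF Suc.prems] Suc.prems[of x] order_trans[OF abs_ge_zero Suc.prems] by auto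
  then show ?case by (simp add: algebra_simps)
qed simp

lemma integrable_bounded:
  fixes g :: "'a \<Rightarrow> real"
  shows "g \<in> borel_measurable M \<Longrightarrow> (\<And>x. \<bar>g x\<bar> \<le> B) \<Longrightarrow> integrable M g"
  by (rule integrable_const_bound[where B = B]) auto

text \<open>Where \<open>max_sum g N\<close> is positive it is at most \<open>g\<close> plus its own
  composition with \<open>T\<close>, by the recursion and monotonicity in \<open>N\<close>; where it
  vanishes it is at most that composition. On integrating, the two maxima cancel by
  invariance.\<close>

lemma maximal_inequality_finite:
  assumes [measurable]: "g \<in> borel_measurable M" and B: "\<And>x. \<bar>g x\<bar> \<le> B"
  shows "0 \<le> (\<integral>x. (if 0 < max_sum g N x then g x else 0) \<partial>M)"
proof -
  have int: "integrable M (max_sum g N)" "integrable M (\<lambda>x. max_sum g N (T x))"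
    by (rule integrable_bounded[where B = "real N * B"]; use max_sum_bound[OF B] in auto)+
  have "0 = (\<integral>x. max_sum g N x - max_sum g N (T x) \<partial>M)"
    using integral_compose[of "max_sum g N" 1] by (simp add: Bochner_Integration.integral_diff int)
  also have "\<dots> \<le> (\<integral>x. (if 0 < max_sum g N x then g x else 0) \<partial>M)"
  proof (rule integral_mono)
    show "integrable M (\<lambda>x. max_sum g N x - max_sum g N (T x))"
      by (intro Bochner_Integration.integrable_diff int)
    show "integrable M (\<lambda>x. if 0 < max_sum g N x then g x else 0)"
      by (rule integrable_bounded[where B = B]) (use B order_trans[OF abs_ge_zero B] in auto)
    fix x
    show "max_sum g N x - max_sum g N (T x) \<le> (if 0 < max_sum g N x then g x else 0)"
    proof (cases N)
      case (Suc n)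
      then show ?thesis using max_sum_mono[of g n "T x"] max_sum_nonneg[of g N "T x"] by (auto simp del: max_sum.simps(2) simp: max_sum.simps(2)[of g n x])
    qed simp
  qed
  finally show ?thesis .
qed

text \<open>A positive Birkhoff sum makes the maxima positive from some \<open>N\<close> on, so the
  truncated integrands converge to \<open>g\<close>. Asking for it only where
  \<open>g x \<noteq> 0\<close> allows \<open>g\<close> to be cut off outside an invariant
  set.\<close>

lemma maximal_inequality:
  assumes [measurable]: "g \<in> borel_measurable M" and B: "\<And>x. \<bar>g x\<bar> \<le> B"
    and pos: "\<And>x. x \<in> space M \<Longrightarrow> g x \<noteq> 0 \<Longrightarrow> \<exists>n. 0 < birkhoff_sum g n x"
  shows "0 \<le> (\<integral>x. g x \<partial>M)"
proof (rule LIMSEQ_le_const)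
  show "(\<lambda>N. \<integral>x. (if 0 < max_sum g N x then g x else 0) \<partial>M) \<longlonglongrightarrow> (\<integral>x. g x \<partial>M)"
  proof (rule integral_dominated_convergence[where w = "\<lambda>_. B"])
    show "AE x in M. (\<lambda>N. if 0 < max_sum g N x then g x else 0) \<longlonglongrightarrow> g x"
    proof (rule AE_I2)
      fix x assume x: "x \<in> space M"
      show "(\<lambda>N. if 0 < max_sum g N x then g x else 0) \<longlonglongrightarrow> g x"
      proof (cases "g x = 0")
        case True
        then show ?thesis by (simp add: if_distrib cong: if_cong)
      next
        case False
        then obtain n where n: "0 < birkhoff_sum g n x" using pos x by blast
        have "0 < max_sum g N x" if "N \<ge> n" for N
          using lift_Suc_mono_le[of "\<lambda>N. max_sum g N x", OF max_sum_mono that]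
            birkhoff_sum_le_max_sum[of g n x] n by linarith
        then show ?thesis
          by (intro tendsto_eventually eventually_sequentiallyI[of n]) auto
      qed
    qed
    show "AE x in M. norm (if 0 < max_sum g N x then g x else 0) \<le> B" for N
      using B by (intro AE_I2) (auto intro: order_trans[OF abs_ge_zero])
  qed auto
  show "\<exists>N. \<forall>n\<ge>N. 0 \<le> (\<integral>x. (if 0 < max_sum g n x then g x else 0) \<partial>M)"
    using maximal_inequality_finite[of g B] B by auto
qed

text \<open>The maximal inequality for \<open>f - c\<close> cut off outside \<open>E\<close>: orbits
  starting in \<open>E\<close> stay there, so the cut-off does not change their Birkhoff
  sums.\<close>

lemma maximal_inequality_on_invariant_set:
  assumes [measurable]: "f \<in> borel_measurable M" and B: "\<And>x. \<bar>f x\<bar> \<le> B"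
    and E [measurable]: "E \<in> sets M"
    and inv: "\<And>x. x \<in> space M \<Longrightarrow> T x \<in> E \<longleftrightarrow> x \<in> E"
    and large: "\<And>x. x \<in> E \<Longrightarrow> \<exists>n. c * real n < birkhoff_sum f n x"
  shows "c * prob E \<le> (\<integral>x. indicator E x * f x \<partial>M)"
proof -
  define g where "g x = indicator E x * (f x - c)" for x :: 'a
  have [measurable]: "g \<in> borel_measurable M" unfolding g_def by measurable
  have Tk: "(T ^^ k) x \<in> space M \<and> ((T ^^ k) x \<in> E \<longleftrightarrow> x \<in> E)" if "x \<in> space M" for k x
    using that by (induction k) (auto simp: inv measurable_space[OF T_measurable])
  have "0 \<le> (\<integral>x. g x \<partial>M)"
  proof (rule maximal_inequality[where B = "B + \<bar>c\<bar>"])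
    show "\<bar>g x\<bar> \<le> B + \<bar>c\<bar>" for x
      using B[of x] by (auto simp: g_def indicator_def)
    fix x assume x: "x \<in> space M" "g x \<noteq> 0"
    then have "x \<in> E" by (auto simp: g_def indicator_def split: if_splits)
    then have "birkhoff_sum g n x = birkhoff_sum f n x - c * real n" for n
      using Tk[OF x(1)] by (simp add: birkhoff_sum_def g_def sum_subtractf)
    then show "\<exists>n. 0 < birkhoff_sum g n x" using large[OF \<open>x \<in> E\<close>] by auto
  qed simp
  also have "(\<integral>x. g x \<partial>M) = (\<integral>x. indicator E x * f x - c * indicator E x \<partial>M)"
    by (intro Bochner_Integration.integral_cong) (auto simp: g_def algebra_simps)
  also have "\<dots> = (\<integral>x. indicator E x * f x \<partial>M) - (\<integral>x. c * indicator E x \<partial>M)"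
  proof (rule Bochner_Integration.integral_diff)
    show "integrable M (\<lambda>x. indicator E x * f x)"
      by (rule integrable_bounded[where B = B]) (use B order_trans[OF abs_ge_zero] in \<open>auto simp: indicator_def\<close>)
    show "integrable M (\<lambda>x. c * indicator E x)"
      by (rule integrable_bounded[where B = "\<bar>c\<bar>"]) (auto simp: indicator_def)
  qed
  finally show ?thesis by simp
qed

text \<open>For \<open>a < b\<close> let \<open>E\<close> be the set where the lower limit is below
  \<open>a\<close> and the upper limit above \<open>b\<close>. It is invariant, and the maximal
  inequality for \<open>f\<close> and for \<open>- f\<close> bounds the integral of \<open>f\<close>
  over \<open>E\<close> below by \<open>b * prob E\<close> and above by \<open>a * prob E\<close>,
  so \<open>E\<close> is null.\<close>

theorem birkhoff_ergodic:
  assumes [measurable]: "f \<in> borel_measurable M" and B: "\<And>x. \<bar>f x\<bar> \<le> B"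
  shows "AE x in M. convergent (\<lambda>n. birkhoff_sum f n x / real n)"
proof -
  define A where "A n x = ereal (birkhoff_sum f n x / real n)" for n x
  have [measurable]: "A n \<in> borel_measurable M" for n unfolding A_def by measurable
  have bnd: "\<bar>birkhoff_sum f n x / real n\<bar> \<le> B" for n x
  proof (cases "n = 0")
    case True
    then show ?thesis using order_trans[OF abs_ge_zero B] by simp
  next
    case False
    then show ?thesis using birkhoff_sum_bound[of f B n x] B by (simp add: field_simps)
  qed
  have shift: "(\<lambda>n. birkhoff_sum f n (T x) / real n - birkhoff_sum f (Suc n) x / real (Suc n)) \<longlonglongrightarrow> 0" for x
  proof (rule Lim_null_comparison)
    show "\<forall>\<^sub>F n in sequentially. norm (birkhoff_sum f n (T x) / real n - birkhoff_sum f (Suc n) x / real (Suc n))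
        \<le> 2 * B / real (Suc n)"
    proof (rule eventually_sequentiallyI[of 1])
      fix n :: nat assume "1 \<le> n"
      define s where "s = birkhoff_sum f n (T x) / real n"
      have "birkhoff_sum f (Suc n) x = f x + real n * s"
        using \<open>1 \<le> n\<close> by (simp add: birkhoff_sum_Suc s_def)
      then have "s - birkhoff_sum f (Suc n) x / real (Suc n) = (s - f x) / real (Suc n)"
        by (simp add: field_simps)
      moreover have "\<bar>s - f x\<bar> \<le> 2 * B"
        using bnd[of n "T x"] B[of x] unfolding s_def by linarith
      ultimately show "norm (birkhoff_sum f n (T x) / real n - birkhoff_sum f (Suc n) x / real (Suc n))
          \<le> 2 * B / real (Suc n)"
        unfolding s_def[symmetric] by (simp add: divide_right_mono del: of_nat_Suc)
    qed
    show "(\<lambda>n. 2 * B / real (Suc n)) \<longlonglongrightarrow> 0"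
      by (rule LIMSEQ_Suc[OF lim_const_over_n])
  qed
  have split: "(\<lambda>n. A n (T x)) = (\<lambda>n. ereal (birkhoff_sum f n (T x) / real n - birkhoff_sum f (Suc n) x / real (Suc n)) + A (Suc n) x)" for x
    by (auto simp: A_def)
  have limsup_inv: "limsup (\<lambda>n. A n (T x)) = limsup (\<lambda>n. A n x)" for x
    unfolding split using ereal_limsup_lim_add[of _ 0 "\<lambda>n. A (Suc n) x"] shift[of x] limsup_shift[of "\<lambda>n. A n x"]
    by (simp add: zero_ereal_def)
  have liminf_inv: "liminf (\<lambda>n. A n (T x)) = liminf (\<lambda>n. A n x)" for x
    unfolding split using ereal_liminf_lim_add[of _ 0 "\<lambda>n. A (Suc n) x"] shift[of x] liminf_shift[of "\<lambda>n. A n x"]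
    by (simp add: zero_ereal_def)
  have gap: "AE x in M. \<not> (liminf (\<lambda>n. A n x) < ereal a \<and> ereal b < limsup (\<lambda>n. A n x))" if "a < b" for a b
  proof -
    define E where "E = {x \<in> space M. liminf (\<lambda>n. A n x) < ereal a \<and> ereal b < limsup (\<lambda>n. A n x)}"
    have E [measurable]: "E \<in> sets M" unfolding E_def by measurable
    have inv: "T x \<in> E \<longleftrightarrow> x \<in> E" if "x \<in> space M" for x
      using that measurable_space[OF T_measurable that] by (simp add: E_def limsup_inv liminf_inv)
    have up: "\<exists>n. b * real n < birkhoff_sum f n x" if "x \<in> E" for x
    proof (rule ccontr)
      assume "\<not> ?thesis"
      then have "\<forall>\<^sub>F n in sequentially. A n x \<le> ereal b"
        by (intro eventually_sequentiallyI[of 1]) (auto simp: A_def not_less field_simps)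
      then have "limsup (\<lambda>n. A n x) \<le> ereal b" by (rule Limsup_bounded)
      then show False using that by (auto simp: E_def)
    qed
    have down: "\<exists>n. - a * real n < birkhoff_sum (\<lambda>x. - f x) n x" if "x \<in> E" for x
    proof (rule ccontr)
      assume "\<not> ?thesis"
      then have "\<forall>\<^sub>F n in sequentially. ereal a \<le> A n x"
        by (intro eventually_sequentiallyI[of 1]) (auto simp: A_def birkhoff_sum_def sum_negf not_less field_simps)
      then have "ereal a \<le> liminf (\<lambda>n. A n x)" by (rule Liminf_bounded)
      then show False using that by (auto simp: E_def)
    qed
    have "b * prob E \<le> (\<integral>x. indicator E x * f x \<partial>M)"
      by (rule maximal_inequality_on_invariant_set[OF _ B E inv up]) auto
    moreover have "- a * prob E \<le> (\<integral>x. indicator E x * (- f x) \<partial>M)"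
      by (rule maximal_inequality_on_invariant_set[OF _ _ E inv down]) (use B in auto)
    ultimately have "(b - a) * prob E \<le> 0" by (simp add: algebra_simps)
    then have "prob E = 0" using \<open>a < b\<close> measure_nonneg[of M E] by (simp add: mult_le_0_iff)
    then show ?thesis
      using E by (intro AE_I[of _ _ E]) (auto simp: E_def emeasure_eq_measure)
  qed
  have "AE x in M. \<forall>a\<in>\<rat>. \<forall>b\<in>\<rat>. a < b \<longrightarrow> \<not> (liminf (\<lambda>n. A n x) < ereal a \<and> ereal b < limsup (\<lambda>n. A n x))"
    using gap by (intro AE_ball_countable' countable_rat) auto
  then show ?thesis
  proof eventually_elim
    case (elim x)
    have "limsup (\<lambda>n. A n x) \<le> liminf (\<lambda>n. A n x)"
    proof (rule ccontr)
      assume "\<not> ?thesis"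
      then have "liminf (\<lambda>n. A n x) < limsup (\<lambda>n. A n x)" by simp
      then obtain u v where uv: "liminf (\<lambda>n. A n x) < ereal u" "ereal u < ereal v" "ereal v < limsup (\<lambda>n. A n x)"
        by (metis ereal_dense2)
      obtain a b where "u < a" "a \<in> \<rat>" "a < v" "a < b" "b \<in> \<rat>" "b < v"
        using Rats_dense_in_real[of u v] uv(2) Rats_dense_in_real by (metis ereal_less_eq(3) not_le)
      then have "liminf (\<lambda>n. A n x) < ereal a" "ereal b < limsup (\<lambda>n. A n x)"
        using uv by (meson less_ereal.simps(1) less_trans)+
      then show False using elim \<open>a \<in> \<rat>\<close> \<open>b \<in> \<rat>\<close> \<open>a < b\<close> by blast
    qed
    then have eq: "liminf (\<lambda>n. A n x) = limsup (\<lambda>n. A n x)"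
      by (intro antisym Liminf_le_Limsup) auto
    then have lim: "(\<lambda>n. A n x) \<longlonglongrightarrow> limsup (\<lambda>n. A n x)"
      by (intro Liminf_eq_Limsup) auto
    moreover have "limsup (\<lambda>n. A n x) \<le> ereal B"
      by (intro Limsup_bounded always_eventually allI) (use abs_le_D1[OF bnd] in \<open>auto simp: A_def\<close>)
    moreover have "ereal (- B) \<le> limsup (\<lambda>n. A n x)"
      unfolding eq[symmetric] by (intro Liminf_bounded always_eventually allI) (use abs_le_D2[OF bnd] in \<open>auto simp: A_def minus_le_iff\<close>)
    ultimately obtain r where "limsup (\<lambda>n. A n x) = ereal r"
      by (cases "limsup (\<lambda>n. A n x)") auto
    then have "(\<lambda>n. birkhoff_sum f n x / real n) \<longlonglongrightarrow> r"
      using lim by (simp add: A_def)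
    then show ?case by (rule convergentI)
  qed
qed

end

section \<open>Invariant measures as limits of orbit averages\<close>

text \<open>Schoenberg's space-filling curve, with a truncated cosine in place of the usual piecewise linear
  function: all that matters is that it has period 2, is 0 on \<open>[0, 1/3]\<close> and 1 on \<open>[2/3, 1]\<close>, so
  that it reads off ternary digits 0 and 2.\<close>
definition schoenberg_base :: "real \<Rightarrow> real" where
  "schoenberg_base u = max 0 (min 1 (1 / 2 - cos (pi * u)))"

text \<open>The two coordinates of the curve: on the Cantor set, \<open>j = 0\<close> collects the
  digits in even places and \<open>j = 1\<close> those in odd places, as binary digits.\<close>

definition schoenberg :: "nat \<Rightarrow> real \<Rightarrow> real" where
  "schoenberg j t = (\<Sum>k. schoenberg_base (3 ^ (2 * k + j) * t) / 2 ^ Suc k)"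

lemma continuous_on_schoenberg: "continuous_on UNIV (schoenberg j)"
proof (rule uniform_limit_theorem)
  show "uniform_limit UNIV (\<lambda>n t. \<Sum>k<n. schoenberg_base (3 ^ (2 * k + j) * t) / 2 ^ Suc k)
      (schoenberg j) sequentially"
    unfolding schoenberg_def
  proof (rule Weierstrass_m_test)
    show "norm (schoenberg_base (3 ^ (2 * k + j) * t) / 2 ^ Suc k) \<le> (1 / 2) ^ Suc k" for k t
      by (auto simp: schoenberg_base_def power_one_over divide_simps)
    show "summable (\<lambda>k. (1 / 2 :: real) ^ Suc k)"
      by (subst summable_Suc_iff) (simp add: summable_geometric)
  qed
  show "\<forall>\<^sub>F n in sequentially. continuous_on UNIV (\<lambda>t. \<Sum>k<n. schoenberg_base (3 ^ (2 * k + j) * t) / 2 ^ Suc k)"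
    unfolding schoenberg_base_def
    by (intro always_eventually allI continuous_intros) auto
qed simp

text \<open>The point of the Cantor set with ternary digits \<open>2 * a k\<close>.\<close>

definition cantor_value :: "(nat \<Rightarrow> nat) \<Rightarrow> real" where
  "cantor_value a = (\<Sum>k. 2 * real (a k) / 3 ^ Suc k)"

lemma cantor_value_sums:
  assumes "\<And>k. a k \<le> 1"
  shows "(\<lambda>k. 2 * real (a k) / 3 ^ Suc k) sums cantor_value a" "cantor_value a \<in> {0..1}"
proof -
  have geo: "(\<lambda>k. 2 / 3 ^ Suc k :: real) sums 1"
    using sums_mult[OF geometric_sums[of "1 / 3 :: real"], of "2 / 3"]
    by (simp add: power_one_over field_simps)
  have le: "2 * real (a k) / 3 ^ Suc k \<le> 2 / 3 ^ Suc k" for k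
    using assms[of k] by (simp add: divide_right_mono)
  have summ: "summable (\<lambda>k. 2 * real (a k) / 3 ^ Suc k)"
    by (rule summable_comparison_test'[OF sums_summable[OF geo]]) (use le in auto)
  then show "(\<lambda>k. 2 * real (a k) / 3 ^ Suc k) sums cantor_value a"
    unfolding cantor_value_def by (rule summable_sums)
  moreover have "0 \<le> cantor_value a"
    unfolding cantor_value_def by (rule suminf_nonneg[OF summ]) simp
  ultimately show "cantor_value a \<in> {0..1}"
    using sums_le[OF le _ geo] by auto
qed

lemma cantor_value_shift:
  assumes "\<And>k. a k \<le> 1"
  shows "3 * cantor_value a = 2 * real (a 0) + cantor_value (\<lambda>k. a (Suc k))"
proof -
  have "(\<lambda>k. 2 * real (a (Suc k)) / 3 ^ Suc (Suc k)) sums (cantor_value a - 2 * real (a 0) / 3)"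
    using cantor_value_sums(1)[of a, OF assms] by (subst sums_Suc_iff) simp
  from sums_mult[OF this, of 3]
  have "(\<lambda>k. 2 * real (a (Suc k)) / 3 ^ Suc k) sums (3 * cantor_value a - 2 * real (a 0))"
    by (simp add: algebra_simps)
  moreover have "(\<lambda>k. 2 * real (a (Suc k)) / 3 ^ Suc k) sums cantor_value (\<lambda>k. a (Suc k))"
    by (rule cantor_value_sums) (rule assms)
  ultimately show ?thesis using sums_unique2 by force
qed

text \<open>The digits that move in front of the point are all even, so the integer they form is
  even and disappears under the period 2 of \<open>schoenberg_base\<close>.\<close>

lemma cantor_value_shifts:
  assumes "\<And>k. a k \<le> 1"
  shows "\<exists>j::nat. 3 ^ m * cantor_value a = 2 * real j + cantor_value (\<lambda>k. a (k + m))"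
proof (induction m)
  case (Suc m)
  then obtain j :: nat where "3 ^ m * cantor_value a = 2 * real j + cantor_value (\<lambda>k. a (k + m))" ..
  moreover have "3 * cantor_value (\<lambda>k. a (k + m)) = 2 * real (a m) + cantor_value (\<lambda>k. a (k + Suc m))"
    using cantor_value_shift[of "\<lambda>k. a (k + m)"] assms by simp
  ultimately have "3 ^ Suc m * cantor_value a = 2 * real (3 * j + a m) + cantor_value (\<lambda>k. a (k + Suc m))"
    by simp
  then show ?case by blast
qed (auto intro!: exI[of _ 0])

lemma schoenberg_base_periodic: "schoenberg_base (2 * real j + u) = schoenberg_base u"
proof -
  have "pi * (2 * real j + u) = pi * u + 2 * real j * pi" by (simp add: algebra_simps)
  then have "cos (pi * (2 * real j + u)) = cos (pi * u)"
    by (simp add: cos_add cos_2npi sin_2npi del: mult.commute)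
  then show ?thesis by (simp add: schoenberg_base_def)
qed

lemma schoenberg_base_cantor_value:
  assumes "\<And>k. a k \<le> 1"
  shows "schoenberg_base (cantor_value a) = real (a 0)"
proof -
  define v where "v = cantor_value (\<lambda>k. a (Suc k))"
  have v: "0 \<le> v" "v \<le> 1" using cantor_value_sums(2)[of "\<lambda>k. a (Suc k)"] assms by (auto simp: v_def)
  have eq: "cantor_value a = (2 * real (a 0) + v) / 3"
    using cantor_value_shift[of a] assms by (simp add: v_def)
  consider "a 0 = 0" | "a 0 = 1" using assms[of 0] by linarith
  then show ?thesis
  proof cases
    case 1
    have "cos (pi / 3) \<le> cos (pi * cantor_value a)"
      by (rule cos_monotone_0_pi_le) (use v 1 in \<open>auto simp: eq\<close>)
    then show ?thesis using 1 by (simp add: schoenberg_base_def cos_60)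
  next
    case 2
    have "cos (pi * cantor_value a) \<le> cos (2 * pi / 3)"
      by (rule cos_monotone_0_pi_le) (use v 2 in \<open>auto simp: eq\<close>)
    moreover have "cos (2 * pi / 3) = - 1 / 2"
      using cos_double_cos[of "pi / 3"] by (simp add: cos_60 power2_eq_square)
    ultimately show ?thesis using 2 by (simp add: schoenberg_base_def)
  qed
qed

lemma binary_digits:
  assumes "x \<in> {0..1::real}"
  obtains b :: "nat \<Rightarrow> nat" where "\<And>k. b k \<le> 1" "(\<lambda>k. real (b k) / 2 ^ Suc k) sums x"
proof -
  \<comment> \<open>Greedy expansion. The remainder map fixes 1, so the endpoint
    \<open>x = 1\<close> gets all digits 1.\<close>
  define B :: "real \<Rightarrow> nat" where "B = (\<lambda>u. if u \<ge> 1 / 2 then 1 else 0)"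
  define r where "r = rec_nat x (\<lambda>_ u. 2 * u - real (B u))"
  have r: "r 0 = x" "r (Suc k) = 2 * r k - real (B (r k))" for k by (auto simp: r_def)
  have rng: "r k \<in> {0..1}" for k
    by (induction k) (use assms in \<open>auto simp: r B_def\<close>)
  have "(\<Sum>k<n. real (B (r k)) / 2 ^ Suc k) = x - r n / 2 ^ n" for n
    by (induction n) (auto simp: r field_simps)
  moreover have "(\<lambda>n. r n / 2 ^ n) \<longlonglongrightarrow> 0"
  proof (rule Lim_null_comparison)
    show "\<forall>\<^sub>F n in sequentially. norm (r n / 2 ^ n) \<le> (1 / 2) ^ n"
      using rng by (intro always_eventually allI) (simp add: power_one_over divide_right_mono)
    show "(\<lambda>n. (1 / 2 :: real) ^ n) \<longlonglongrightarrow> 0" by (rule LIMSEQ_power_zero) simp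
  qed
  then have "(\<lambda>n. x - r n / 2 ^ n) \<longlonglongrightarrow> x - 0" by (intro tendsto_intros)
  ultimately have "(\<lambda>k. real (B (r k)) / 2 ^ Suc k) sums x" by (simp add: sums_def)
  then show thesis by (intro that[of "\<lambda>k. B (r k)"]) (auto simp: B_def)
qed

lemma schoenberg_surj:
  assumes "x \<in> {0..1}" "y \<in> {0..1}"
  obtains t where "t \<in> {0..1}" "schoenberg 0 t = x" "schoenberg 1 t = y"
proof -
  obtain b :: "nat \<Rightarrow> nat" where b: "\<And>k. b k \<le> 1" "(\<lambda>k. real (b k) / 2 ^ Suc k) sums x"
    using binary_digits[OF assms(1)] by blast
  obtain c :: "nat \<Rightarrow> nat" where c: "\<And>k. c k \<le> 1" "(\<lambda>k. real (c k) / 2 ^ Suc k) sums y"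
    using binary_digits[OF assms(2)] by blast
  define a where "a m = (if even m then b (m div 2) else c (m div 2))" for m
  have a: "a k \<le> 1" for k using b(1) c(1) by (simp add: a_def)
  have digit: "schoenberg_base (3 ^ m * cantor_value a) = real (a m)" for m
    using cantor_value_shifts[of a m, OF a] schoenberg_base_cantor_value[of "\<lambda>k. a (k + m)"] a
    by (auto simp: schoenberg_base_periodic)
  show thesis
  proof
    show "cantor_value a \<in> {0..1}" by (rule cantor_value_sums) (rule a)
    show "schoenberg 0 (cantor_value a) = x"
      unfolding schoenberg_def digit using b(2) by (simp add: a_def sums_iff)
    show "schoenberg 1 (cantor_value a) = y"
      unfolding schoenberg_def digit using c(2) by (simp add: a_def sums_iff)
  qed
qed

text \<open>Closed sets form an intersection-stable generator, and their indicators are limits of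
  continuous functions with values in \<open>[0, 1]\<close>.\<close>

lemma borel_measure_eqI_continuous:
  fixes M N :: "'a::metric_space measure"
  assumes sets: "sets M = sets borel" "sets N = sets borel"
    and "finite_measure M" "finite_measure N"
    and eq: "\<And>g :: 'a \<Rightarrow> real. continuous_on UNIV g \<Longrightarrow> (\<And>x. \<bar>g x\<bar> \<le> 1) \<Longrightarrow> (\<integral>x. g x \<partial>M) = (\<integral>x. g x \<partial>N)"
  shows "M = N"
proof (rule measure_eqI_generator_eq)
  interpret M: finite_measure M by fact
  interpret N: finite_measure N by fact
  define E where "E = {S :: 'a set. closed S}"
  show "Int_stable E" by (auto simp: Int_stable_def E_def)
  show "E \<subseteq> Pow UNIV" by auto
  show "sets M = sigma_sets UNIV E" "sets N = sigma_sets UNIV E"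
    using sets unfolding borel_eq_closed by (auto simp: E_def)
  show "range (\<lambda>_::nat. UNIV) \<subseteq> E" "(\<Union>i::nat. UNIV) = (UNIV :: 'a set)" by (auto simp: E_def)
  show "emeasure M UNIV \<noteq> \<infinity>" by simp
  fix C :: "'a set" assume "C \<in> E"
  then have "closed C" by (simp add: E_def)
  \<comment> \<open>\<open>infdist x {}\<close> is 0, so without the case distinction the empty set
    would get the constant 1.\<close>
  define g where "g n x = (if C = {} then 0 else max 0 (1 - real n * infdist x C))" for n and x :: 'a
  have cont: "continuous_on UNIV (g n)" for n
    unfolding g_def by (cases "C = {}") (auto intro!: continuous_intros)
  have bnd: "\<bar>g n x\<bar> \<le> 1" for n x
    by (auto simp: g_def infdist_nonneg)
  have lim: "(\<lambda>n. g n x) \<longlonglongrightarrow> indicator C x" for x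
  proof (cases "C = {} \<or> x \<in> C")
    case True
    then have "C = {} \<or> C \<noteq> {} \<and> x \<in> C" by blast
    then show ?thesis by (elim disjE conjE) (simp_all add: g_def)
  next
    case False
    then have pos: "infdist x C > 0"
      using in_closed_iff_infdist_zero[OF \<open>closed C\<close>, of x] infdist_nonneg[of x C] by auto
    obtain n0 :: nat where n0: "1 / infdist x C < real n0" using reals_Archimedean2 by blast
    have "g n x = 0" if "n \<ge> n0" for n
    proof -
      have "1 / infdist x C < real n" using n0 that by simp
      then show ?thesis using pos by (simp add: g_def field_simps)
    qed
    then show ?thesis using False
      by (intro tendsto_eventually eventually_sequentiallyI[of n0]) auto
  qed
  have "(\<lambda>n. \<integral>x. g n x \<partial>K) \<longlonglongrightarrow> (\<integral>x. indicator C x \<partial>K)"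
    if "sets K = sets borel" "finite_measure K" for K :: "'a measure"
  proof (rule integral_dominated_convergence[where w = "\<lambda>_. 1"])
    interpret finite_measure K by fact
    show "integrable K (\<lambda>_. 1 :: real)" by simp
    show "g n \<in> borel_measurable K" for n
      using borel_measurable_continuous_onI[OF cont[of n]] that(1) measurable_cong_sets by blast
    show "(indicator C :: 'a \<Rightarrow> real) \<in> borel_measurable K"
      using \<open>closed C\<close> that(1) by (intro borel_measurable_indicator) (simp add: borel_closed)
  qed (use lim bnd in auto)
  from this[of M] this[of N] have "(\<integral>x. indicator C x \<partial>M) = (\<integral>x. indicator C x \<partial>N :: real)"
    using eq[OF cont bnd] sets assms(3,4) LIMSEQ_unique by auto
  then have "measure M C = measure N C"
    using \<open>closed C\<close> sets sets_eq_imp_space_eq[OF sets(1)] sets_eq_imp_space_eq[OF sets(2)] by simp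
  then show "emeasure M C = emeasure N C"
    by (simp add: M.emeasure_eq_measure N.emeasure_eq_measure)
qed

text \<open>Krylov-Bogolyubov, with an initial point that changes with \<open>n\<close>. The
  empirical measures are carried to \<open>[0, 1]\<close> by a right inverse of \<open>h\<close>; a
  continuous \<open>g\<close> is then tested as the bounded continuous function
  \<open>g (h s)\<close> on the line.\<close>

lemma invariant_measure_from_orbit_averages:
  fixes h :: "real \<Rightarrow> 'a::metric_space" and T :: "'a \<Rightarrow> 'a" and \<phi> :: "'a \<Rightarrow> real"
  assumes h: "continuous_on UNIV h" "h ` {0..1} = UNIV"
    and T: "continuous_on UNIV T" and \<phi>: "continuous_on UNIV \<phi>"
    and lim: "(\<lambda>n. (\<Sum>k<n. \<phi> ((T ^^ k) (w n))) / real n) \<longlonglongrightarrow> l"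
  shows "\<exists>\<nu>. sets \<nu> = sets borel \<and> prob_space \<nu> \<and> distr \<nu> borel T = \<nu> \<and> (\<integral>x. \<phi> x \<partial>\<nu>) = l"
proof -
  have "\<exists>t\<in>{0..1}. h t = x" for x using h(2) by (metis UNIV_I imageE)
  \<comment> \<open>An arbitrary right inverse serves, as every function is measurable for the
    discrete measures pushed forward below. There \<open>Suc n\<close> avoids a uniform distribution
    on the empty set.\<close>
  then obtain t where t: "\<And>x. t x \<in> {0..1}" "\<And>x. h (t x) = x" by metis
  have bounded: "\<exists>B. \<forall>x. \<bar>g x\<bar> \<le> B" if "continuous_on UNIV g" for g :: "'a \<Rightarrow> real"
  proof -
    have "compact (g ` h ` {0..1})"
      by (intro compact_continuous_image continuous_on_subset[OF that] continuous_on_subset[OF h(1)]) auto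
    then have "bounded (range g)" unfolding h(2) by (rule compact_imp_bounded)
    then show ?thesis unfolding bounded_iff by auto
  qed
  define \<mu> where "\<mu> n = distr (measure_pmf (pmf_of_set {..<Suc n})) borel (\<lambda>k. t ((T ^^ k) (w (Suc n))))" for n
  have prob: "prob_space (\<mu> n)" for n
    unfolding \<mu>_def by (intro measure_pmf.prob_space_distr) simp
  have real_distr: "real_distribution (\<mu> n)" for n
    using prob[of n] by (simp add: real_distribution_def real_distribution_axioms_def \<mu>_def)
  \<comment> \<open>Tightness is phrased with intervals open on the left, and \<open>t\<close> may
    take the value 0.\<close>
  have "measure (\<mu> n) {-1<..1} = 1" for n
  proof -
    have "(\<lambda>k. t ((T ^^ k) (w (Suc n)))) -` {-1<..1} = UNIV"
      using t(1) by (fastforce intro: less_le_trans[of "- 1" 0])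
    then show ?thesis by (simp add: \<mu>_def measure_distr)
  qed
  then have "tight \<mu>"
    unfolding tight_def using real_distr
    by (intro conjI allI impI) (simp, rule exI[of _ "-1"], rule exI[of _ 1], simp)
  then obtain r M where r: "strict_mono r" "real_distribution M" "weak_conv_m (\<mu> \<circ> id \<circ> r) M"
    using tight_imp_convergent_subsubsequence[of \<mu> id] strict_mono_id by blast
  interpret M: real_distribution M by fact
  define \<nu> where "\<nu> = distr M borel h"
  define N where "N n = Suc (r n)" for n
  have N: "filterlim N at_top sequentially"
    unfolding N_def using filterlim_Suc filterlim_subseq[OF r(1)] filterlim_compose by blast
  have [measurable]: "h \<in> M \<rightarrow>\<^sub>M borel" "T \<in> borel \<rightarrow>\<^sub>M borel"
    using borel_measurable_continuous_onI[OF h(1)] borel_measurable_continuous_onI[OF T] by auto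
  have conv: "(\<lambda>n. (\<Sum>k<N n. g ((T ^^ k) (w (N n)))) / real (N n)) \<longlonglongrightarrow> (\<integral>x. g x \<partial>\<nu>)"
    if g: "continuous_on UNIV g" for g :: "'a \<Rightarrow> real"
  proof -
    have gh: "continuous_on UNIV (\<lambda>s. g (h s))"
      by (rule continuous_on_compose2[OF g h(1)]) auto
    have [measurable]: "(\<lambda>s. g (h s)) \<in> borel_measurable borel" "g \<in> borel_measurable borel"
      using borel_measurable_continuous_onI[OF gh] borel_measurable_continuous_onI[OF g] by auto
    obtain B where "\<And>x. \<bar>g x\<bar> \<le> B" using bounded[OF g] by blast
    then have "(\<lambda>n. integral\<^sup>L ((\<mu> \<circ> id \<circ> r) n) (\<lambda>s. g (h s))) \<longlonglongrightarrow> integral\<^sup>L M (\<lambda>s. g (h s))"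
      using gh real_distr r(2,3)
      by (intro weak_conv_imp_integral_bdd_continuous_conv[where B = B])
         (auto simp: continuous_on_eq_continuous_at comp_def)
    moreover have "integral\<^sup>L ((\<mu> \<circ> id \<circ> r) n) (\<lambda>s. g (h s)) = (\<Sum>k<N n. g ((T ^^ k) (w (N n)))) / real (N n)" for n
      by (simp add: \<mu>_def integral_distr t integral_pmf_of_set N_def lessThan_empty_iff)
    moreover have "integral\<^sup>L M (\<lambda>s. g (h s)) = (\<integral>x. g x \<partial>\<nu>)"
      unfolding \<nu>_def by (subst integral_distr) auto
    ultimately show ?thesis by simp
  qed
  have "prob_space \<nu>" unfolding \<nu>_def by (rule M.prob_space_distr) simp
  then interpret \<nu>: prob_space \<nu> .
  have sets: "sets \<nu> = sets borel" by (simp add: \<nu>_def)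
  have [measurable]: "T \<in> \<nu> \<rightarrow>\<^sub>M borel" by (simp add: measurable_cong_sets[OF sets refl])
  have "distr \<nu> borel T = \<nu>"
  proof (rule borel_measure_eqI_continuous)
    show "finite_measure (distr \<nu> borel T)" by (rule \<nu>.finite_measure_distr) simp
    fix g :: "'a \<Rightarrow> real" assume g: "continuous_on UNIV g" and bnd: "\<And>x. \<bar>g x\<bar> \<le> 1"
    have [measurable]: "g \<in> borel_measurable borel" by (rule borel_measurable_continuous_onI[OF g])
    \<comment> \<open>The averages of \<open>g\<close> and of \<open>g\<close> after
      \<open>T\<close> differ only by the two end terms of the orbit.\<close>
    have null: "(\<lambda>n. (g ((T ^^ N n) (w (N n))) - g (w (N n))) / real (N n)) \<longlonglongrightarrow> 0"
    proof (rule Lim_null_comparison)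
      show "\<forall>\<^sub>F n in sequentially. norm ((g ((T ^^ N n) (w (N n))) - g (w (N n))) / real (N n)) \<le> 2 / real (N n)"
      proof (intro always_eventually allI)
        fix n
        have "\<bar>g ((T ^^ N n) (w (N n))) - g (w (N n))\<bar> \<le> 2"
          using bnd[of "(T ^^ N n) (w (N n))"] bnd[of "w (N n)"] by linarith
        then show "norm ((g ((T ^^ N n) (w (N n))) - g (w (N n))) / real (N n)) \<le> 2 / real (N n)"
          by (simp add: divide_right_mono)
      qed
      show "(\<lambda>n. 2 / real (N n)) \<longlonglongrightarrow> 0"
        by (rule filterlim_compose[OF lim_const_over_n N])
    qed
    have "(\<Sum>k<n. g (T ((T ^^ k) x))) - (\<Sum>k<n. g ((T ^^ k) x)) = g ((T ^^ n) x) - g x" for n x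
      by (induction n) auto
    then have "(\<Sum>k<n. g (T ((T ^^ k) x))) / real n - (\<Sum>k<n. g ((T ^^ k) x)) / real n = (g ((T ^^ n) x) - g x) / real n" for n x
      by (simp add: diff_divide_distrib[symmetric])
    moreover have "(\<lambda>n. (\<Sum>k<N n. g (T ((T ^^ k) (w (N n))))) / real (N n) - (\<Sum>k<N n. g ((T ^^ k) (w (N n)))) / real (N n))
        \<longlonglongrightarrow> (\<integral>x. g (T x) \<partial>\<nu>) - (\<integral>x. g x \<partial>\<nu>)"
      by (intro tendsto_diff conv g continuous_on_compose2[OF g T]) auto
    ultimately have "(\<lambda>n. (g ((T ^^ N n) (w (N n))) - g (w (N n))) / real (N n)) \<longlonglongrightarrow> (\<integral>x. g (T x) \<partial>\<nu>) - (\<integral>x. g x \<partial>\<nu>)"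
      by simp
    from LIMSEQ_unique[OF null this] have "(\<integral>x. g (T x) \<partial>\<nu>) = (\<integral>x. g x \<partial>\<nu>)"
      by simp
    then show "(\<integral>x. g x \<partial>distr \<nu> borel T) = (\<integral>x. g x \<partial>\<nu>)"
      by (subst integral_distr) auto
  qed (use sets \<open>prob_space \<nu>\<close> in \<open>auto simp: prob_space_def\<close>)
  moreover have "(\<integral>x. \<phi> x \<partial>\<nu>) = l"
    using conv[OF \<phi>] filterlim_compose[OF lim N] LIMSEQ_unique by blast
  ultimately show ?thesis using sets \<open>prob_space \<nu>\<close> by blast
qed

section \<open>The tangent flow of an isotopy\<close>

text \<open>Uniform convergence on a compact ball around the point controls the change of time,
  continuity of the single map at time \<open>t\<close> the change of point.\<close>

lemma continuous_on_jointly: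
  fixes g :: "real \<Rightarrow> 'a::heine_borel \<Rightarrow> 'b::metric_space"
  assumes cont: "\<And>t. t \<in> I \<Longrightarrow> continuous_on UNIV (g t)"
    and unif: "\<And>t K. t \<in> I \<Longrightarrow> compact K \<Longrightarrow> uniform_limit K g (g t) (at t within I)"
  shows "continuous_on (I \<times> UNIV) (\<lambda>(t, z). g t z)"
  unfolding continuous_on_iff
proof (intro ballI allI impI)
  fix p :: "real \<times> 'a" and e :: real assume "p \<in> I \<times> UNIV" "0 < e"
  then obtain t z where p: "p = (t, z)" and "t \<in> I" by auto
  have "uniform_limit (cball z 1) g (g t) (at t within I)" by (rule unif[OF \<open>t \<in> I\<close> compact_cball])
  then have "\<forall>\<^sub>F s in at t within I. \<forall>y\<in>cball z 1. dist (g s y) (g t y) < e / 2"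
    using half_gt_zero[OF \<open>0 < e\<close>] unfolding uniform_limit_iff by blast
  then obtain d1 where d1: "d1 > 0" "\<And>s y. s \<in> I \<Longrightarrow> s \<noteq> t \<Longrightarrow> dist s t < d1 \<Longrightarrow> y \<in> cball z 1 \<Longrightarrow> dist (g s y) (g t y) < e / 2"
    unfolding eventually_at by blast
  obtain d2 where d2: "d2 > 0" "\<And>y. dist y z < d2 \<Longrightarrow> dist (g t y) (g t z) < e / 2"
    using cont[OF \<open>t \<in> I\<close>] \<open>0 < e\<close> unfolding continuous_on_iff by (metis UNIV_I half_gt_zero)
  show "\<exists>d>0. \<forall>x'\<in>I \<times> UNIV. dist x' p < d \<longrightarrow>
      dist (case x' of (t, z) \<Rightarrow> g t z) (case p of (t, z) \<Rightarrow> g t z) < e"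
    unfolding p
  proof (intro exI[of _ "min 1 (min d1 d2)"] conjI ballI impI, goal_cases)
    case (2 x')
    obtain s y where x': "x' = (s, y)" by fastforce
    have "dist s t < d1" "dist y z < d2" "dist y z < 1"
      using dist_fst_le[of x' "(t, z)"] dist_snd_le[of x' "(t, z)"] 2 by (auto simp: x')
    then have "dist (g s y) (g t y) < e / 2" "dist (g t y) (g t z) < e / 2"
      using d1(2)[of s y] d2(2)[of y] 2 \<open>0 < e\<close> by (cases "s = t", auto simp: x' dist_commute)+
    then show ?case using dist_triangle_half_l[of "g s y" "g t y" e "g t z"]
      by (simp add: x' dist_commute)
  qed (use d1 d2 in auto)
qed

lemma extend_add: "0 \<le> t \<Longrightarrow> extend g (real k + t) = extend g t \<circ> (g 1 ^^ k)"
proof -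
  assume "0 \<le> t"
  then have "\<lfloor>real k + t\<rfloor> = int k + \<lfloor>t\<rfloor>" "frac (real k + t) = frac t"
    by (auto simp: frac_def)
  then show ?thesis using \<open>0 \<le> t\<close>
    by (simp add: extend_def nat_add_distrib add.commute[of k] funpow_add o_assoc)
qed

lemma extend_of_nat: "g 0 = id \<Longrightarrow> extend g (real k) = g 1 ^^ k"
  by (simp add: extend_def frac_def)

text \<open>The right endpoint is included because \<open>extend\<close> restarts there with
  \<open>g 0\<close>, the identity. Thus closed pieces agree at integer times and can be
  glued.\<close>

lemma extend_unit_interval: "g 0 = id \<Longrightarrow> t \<in> {real k..real k + 1} \<Longrightarrow> extend g t = g (t - real k) \<circ> (g 1 ^^ k)"
proof (cases "t = real k + 1")
  case True
  assume "g 0 = id"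
  then show ?thesis using True extend_of_nat[of g "Suc k"] by (simp add: add.commute)
next
  case False
  assume "t \<in> {real k..real k + 1}"
  then have "\<lfloor>t\<rfloor> = int k" using False by (auto simp: floor_eq_iff)
  then show ?thesis by (simp add: extend_def frac_def)
qed

lemma continuous_on_extend:
  fixes g :: "real \<Rightarrow> 'a::metric_space \<Rightarrow> 'a"
  assumes cont: "continuous_on ({0..1} \<times> UNIV) (\<lambda>(t, z). g t z)" and id: "g 0 = id"
  shows "continuous_on ({0..} \<times> UNIV) (\<lambda>(t, z). extend g t z)"
proof -
  have "continuous_on UNIV (g 1)"
    using continuous_on_compose2[OF cont continuous_on_Pair[OF continuous_on_const continuous_on_id], of 1 UNIV]
    by (simp add: image_subset_iff)
  then have pow: "continuous_on UNIV (g 1 ^^ k)" for k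
    by (induction k) (auto simp: id_def intro!: continuous_on_compose2[of UNIV "g 1"] simp del: o_apply simp: comp_def)
  have piece: "continuous_on ({real k..real k + 1} \<times> UNIV) (\<lambda>(t, z). extend g t z)" for k
  proof (rule continuous_on_eq)
    show "continuous_on ({real k..real k + 1} \<times> UNIV) (\<lambda>x. (\<lambda>(t, z). g t z) (fst x - real k, (g 1 ^^ k) (snd x)))"
      by (rule continuous_on_compose2[OF cont])
         (auto intro!: continuous_intros continuous_on_compose2[OF pow])
  qed (auto simp: extend_unit_interval[of g, OF id])
  have upto: "continuous_on ({0..real n} \<times> UNIV) (\<lambda>(t, z). extend g t z)" for n
  proof (induction n)
    case 0
    show ?case by (rule continuous_on_subset[OF piece[of 0]]) auto
  next
    case (Suc n)
    have "{0..real (Suc n)} \<times> UNIV = {0..real n} \<times> UNIV \<union> {real n..real n + 1} \<times> (UNIV :: 'a set)" by auto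
    then show ?case
      using continuous_on_closed_Un[OF _ _ Suc piece[of n]] by (simp add: closed_Times)
  qed
  \<comment> \<open>Clamping the time at 0 gives a function on the whole space, so continuity at a
    point can be read off from one open strip.\<close>
  have "isCont (\<lambda>(t, z). extend g (max 0 t) z) x" for x
  proof -
    obtain n :: nat where n: "fst x < real n" using reals_Archimedean2 by blast
    have "continuous_on ({..<real n} \<times> UNIV) (\<lambda>x. (\<lambda>(t, z). extend g t z) (max 0 (fst x), snd x))"
      by (rule continuous_on_compose2[OF upto[of n]]) (auto intro!: continuous_intros)
    then have "isCont (\<lambda>x. (\<lambda>(t, z). extend g t z) (max 0 (fst x), snd x)) x"
      using n by (cases x) (simp add: continuous_on_eq_continuous_at open_Times mem_Times_iff)
    then show ?thesis by (simp add: case_prod_unfold)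
  qed
  then have "continuous_on ({0..} \<times> UNIV) (\<lambda>(t, z). extend g (max 0 t) z)"
    by (intro continuous_at_imp_continuous_on) auto
  then show ?thesis by (rule continuous_on_eq) auto
qed

lemma the_deriv_plane: "(g has_derivative blinfun_apply A) (at z) \<Longrightarrow> the_deriv has_deriv_plane g z = A"
  unfolding the_deriv_def has_deriv_plane_def
  by (rule the_equality) (simp_all add: has_derivative_unique blinfun_apply_inject[symmetric])

lemma the_deriv_torus: "has_deriv_torus g z A \<Longrightarrow> the_deriv has_deriv_torus g z = A"
  unfolding the_deriv_def by (rule the_equality) (auto dest: has_deriv_torus_unique)

section \<open>Isotopies of the plane and their action on tangent vectors\<close>

locale plane_isotopy =
  fixes F :: "real \<Rightarrow> plane \<Rightarrow> plane"
  assumes isotopy: "isotopy has_deriv_plane F"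
begin

lemma F_0: "F 0 = id"
  using isotopy by (simp add: isotopy_def)

text \<open>Extending this action on the tangent bundle in time encodes the chain rule along the
  iterates, so \<open>continuous_on_extend\<close> gives joint continuity of the derivative of the
  extended flow as well.\<close>

definition tangent_map :: "real \<Rightarrow> plane \<times> plane \<Rightarrow> plane \<times> plane" where
  "tangent_map t = (\<lambda>(z, \<xi>). (F t z, the_deriv has_deriv_plane (F t) z \<xi>))"

lemma tangent_map_0: "tangent_map 0 = id"
proof -
  have "the_deriv has_deriv_plane id z = id_blinfun" for z
    by (rule the_deriv_plane) (simp add: id_def has_derivative_ident)
  then show ?thesis by (auto simp: tangent_map_def F_0)
qed

lemma has_derivative_F:
  assumes "t \<in> {0..1}"
  shows "(F t has_derivative blinfun_apply (the_deriv has_deriv_plane (F t) z)) (at z)"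
proof -
  have "C1_map has_deriv_plane (F t)" using isotopy assms by (auto simp: isotopy_def Diff1_def)
  then obtain A where "(F t has_derivative blinfun_apply A) (at z)" unfolding C1_map_def has_deriv_plane_def by blast
  then show ?thesis using the_deriv_plane by simp
qed

lemma deriv_F_nonzero:
  assumes "t \<in> {0..1}" "\<xi> \<noteq> 0"
  shows "the_deriv has_deriv_plane (F t) z \<xi> \<noteq> 0"
proof
  assume 0: "the_deriv has_deriv_plane (F t) z \<xi> = 0"
  have "bij (F t)" "C1_map has_deriv_plane (inv (F t))" using isotopy assms by (auto simp: isotopy_def Diff1_def)
  then obtain A where "(inv (F t) has_derivative blinfun_apply A) (at (F t z))" unfolding C1_map_def has_deriv_plane_def by blast
  from has_derivative_compose[OF has_derivative_F[OF assms(1)] this]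
  have "((\<lambda>x. x) has_derivative (\<lambda>h. A (the_deriv has_deriv_plane (F t) z h))) (at z)"
    using \<open>bij (F t)\<close> by (simp add: bij_is_inj)
  from has_derivative_unique[OF this has_derivative_ident] have "A (the_deriv has_deriv_plane (F t) z \<xi>) = \<xi>"
    by metis
  then show False using 0 assms(2) by (simp add: blinfun.zero_right)
qed

lemma continuous_on_tangent_map: "continuous_on ({0..1} \<times> UNIV) (\<lambda>(t, z). tangent_map t z)"
proof -
  have C1: "C1_map has_deriv_plane (F t)" if "t \<in> {0..1}" for t
    using isotopy that by (auto simp: isotopy_def Diff1_def)
  have lim: "uniform_limit K F (F t) (at t within {0..1})"
      "uniform_limit K (\<lambda>s. the_deriv has_deriv_plane (F s)) (the_deriv has_deriv_plane (F t)) (at t within {0..1})"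
    if "t \<in> {0..1}" "compact K" for t K
    using isotopy that by (auto simp: isotopy_def C1_continuous_path_def)
  have contF: "continuous_on ({0..1} \<times> UNIV) (\<lambda>(t, z). F t z)"
  proof (rule continuous_on_jointly)
    show "continuous_on UNIV (F t)" if "t \<in> {0..1}" for t
      by (rule has_derivative_continuous_on) (rule has_derivative_at_withinI[OF has_derivative_F[OF that]])
  qed (rule lim)
  have contD: "continuous_on ({0..1} \<times> UNIV) (\<lambda>(t, z). the_deriv has_deriv_plane (F t) z)"
    by (rule continuous_on_jointly) (use C1 lim in \<open>auto simp: C1_map_def\<close>)
  have proj: "continuous_on ({0..1} \<times> UNIV) (\<lambda>x :: real \<times> plane \<times> plane. (fst x, fst (snd x)))"
    by (intro continuous_intros)
  have "continuous_on ({0..1} \<times> UNIV) (\<lambda>x :: real \<times> plane \<times> plane. (\<lambda>(t, z). F t z) (fst x, fst (snd x)))"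
    by (rule continuous_on_compose2[OF contF proj]) auto
  moreover have "continuous_on ({0..1} \<times> UNIV) (\<lambda>x :: real \<times> plane \<times> plane.
      (\<lambda>(t, z). the_deriv has_deriv_plane (F t) z) (fst x, fst (snd x)))"
    by (rule continuous_on_compose2[OF contD proj]) auto
  then have "continuous_on ({0..1} \<times> UNIV) (\<lambda>x :: real \<times> plane \<times> plane.
      blinfun_apply ((\<lambda>(t, z). the_deriv has_deriv_plane (F t) z) (fst x, fst (snd x))) (snd (snd x)))"
    by (rule blinfun.continuous_on) (intro continuous_intros)
  ultimately have "continuous_on ({0..1} \<times> UNIV) (\<lambda>x :: real \<times> plane \<times> plane.
      ((\<lambda>(t, z). F t z) (fst x, fst (snd x)),
       blinfun_apply ((\<lambda>(t, z). the_deriv has_deriv_plane (F t) z) (fst x, fst (snd x))) (snd (snd x))))"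
    by (rule continuous_on_Pair)
  then show ?thesis by (simp add: tangent_map_def case_prod_unfold)
qed

abbreviation flow :: "real \<Rightarrow> plane \<Rightarrow> plane" where "flow \<equiv> extend F"

definition dflow :: "real \<Rightarrow> plane \<Rightarrow> plane \<Rightarrow> plane" where
  "dflow t z \<xi> = snd (extend tangent_map t (z, \<xi>))"

lemma tangent_map_funpow: "fst ((tangent_map 1 ^^ k) (z, \<xi>)) = (F 1 ^^ k) z"
  by (induction k) (auto simp: tangent_map_def case_prod_unfold)

lemma extend_tangent_map: "extend tangent_map t (z, \<xi>) = (flow t z, dflow t z \<xi>)"
  by (simp add: dflow_def prod_eq_iff extend_def tangent_map_def case_prod_unfold tangent_map_funpow[unfolded tangent_map_def case_prod_unfold])

lemma dflow_0: "dflow 0 z \<xi> = \<xi>" and flow_0: "flow 0 z = z"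
  by (simp_all add: dflow_def extend_def tangent_map_0 F_0)

lemma continuous_on_flow_dflow:
  "continuous_on ({0..} \<times> UNIV) (\<lambda>(t, z, \<xi>). (flow t z, dflow t z \<xi>))"
  using continuous_on_extend[OF continuous_on_tangent_map tangent_map_0]
  by (simp add: case_prod_unfold extend_tangent_map[symmetric])

lemma continuous_on_flow [continuous_intros]:
  assumes "continuous_on S a" "continuous_on S b" "\<And>x. x \<in> S \<Longrightarrow> 0 \<le> a x"
  shows "continuous_on S (\<lambda>x. flow (a x) (b x))"
proof -
  have "continuous_on S (\<lambda>x. fst ((\<lambda>(t, z, \<xi>). (flow t z, dflow t z \<xi>)) (a x, b x, 0)))"
    by (intro continuous_on_fst continuous_on_compose2[OF continuous_on_flow_dflow] continuous_intros assms) (use assms in auto)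
  then show ?thesis by simp
qed

lemma continuous_on_dflow [continuous_intros]:
  assumes "continuous_on S a" "continuous_on S b" "continuous_on S c" "\<And>x. x \<in> S \<Longrightarrow> 0 \<le> a x"
  shows "continuous_on S (\<lambda>x. dflow (a x) (b x) (c x))"
proof -
  have "continuous_on S (\<lambda>x. snd ((\<lambda>(t, z, \<xi>). (flow t z, dflow t z \<xi>)) (a x, b x, c x)))"
    by (intro continuous_on_snd continuous_on_compose2[OF continuous_on_flow_dflow] continuous_intros assms) (use assms in auto)
  then show ?thesis by simp
qed

lemma dflow_add: "0 \<le> t \<Longrightarrow> dflow (real k + t) z \<xi> = dflow t (flow (real k) z) (dflow (real k) z \<xi>)"
  using extend_add[of t tangent_map k] extend_of_nat[of tangent_map k] tangent_map_0
    extend_tangent_map[of "real k" z \<xi>] by (simp add: dflow_def)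

lemma has_derivative_funpow:
  "(F 1 ^^ k has_derivative (\<lambda>\<xi>. snd ((tangent_map 1 ^^ k) (z, \<xi>)))) (at z)"
proof (induction k)
  case 0
  then show ?case by (simp add: has_derivative_ident id_def)
next
  case (Suc k)
  have "((\<lambda>z. F 1 ((F 1 ^^ k) z)) has_derivative
      (\<lambda>\<xi>. blinfun_apply (the_deriv has_deriv_plane (F 1) ((F 1 ^^ k) z)) (snd ((tangent_map 1 ^^ k) (z, \<xi>))))) (at z)"
    by (rule has_derivative_compose[OF Suc has_derivative_F]) simp
  then show ?case by (simp add: comp_def) (simp add: tangent_map_def case_prod_unfold tangent_map_funpow[unfolded tangent_map_def case_prod_unfold])
qed

lemma has_derivative_flow:
  assumes "0 \<le> t"
  shows "(flow t has_derivative dflow t z) (at z)"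
proof -
  have "frac t \<in> {0..1}" by (simp add: frac_ge_0 less_imp_le[OF frac_lt_1])
  from has_derivative_compose[OF has_derivative_funpow has_derivative_F[OF this]]
  have "((\<lambda>z. F (frac t) ((F 1 ^^ nat \<lfloor>t\<rfloor>) z)) has_derivative
      (\<lambda>\<xi>. blinfun_apply (the_deriv has_deriv_plane (F (frac t)) ((F 1 ^^ nat \<lfloor>t\<rfloor>) z)) (snd ((tangent_map 1 ^^ nat \<lfloor>t\<rfloor>) (z, \<xi>))))) (at z)" .
  then show ?thesis
    by (simp add: extend_def dflow_def[abs_def] comp_def) (simp add: tangent_map_def case_prod_unfold tangent_map_funpow[unfolded tangent_map_def case_prod_unfold])
qed

lemma bounded_linear_dflow: "0 \<le> t \<Longrightarrow> bounded_linear (dflow t z)"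
  using has_derivative_flow has_derivative_bounded_linear by blast

lemma tangent_map_nonzero: "t \<in> {0..1} \<Longrightarrow> snd w \<noteq> 0 \<Longrightarrow> snd (tangent_map t w) \<noteq> 0"
  using deriv_F_nonzero by (simp add: tangent_map_def case_prod_unfold)

lemma dflow_nonzero:
  assumes "0 \<le> t" "\<xi> \<noteq> 0"
  shows "dflow t z \<xi> \<noteq> 0"
proof -
  have "snd ((tangent_map 1 ^^ k) (z, \<xi>)) \<noteq> 0" for k
    by (induction k) (use assms in \<open>auto simp: tangent_map_nonzero\<close>)
  moreover have "frac t \<in> {0..1}" by (simp add: frac_ge_0 less_imp_le[OF frac_lt_1])
  ultimately show ?thesis by (simp add: dflow_def extend_def tangent_map_nonzero)
qed

lemma inj_flow: "0 \<le> t \<Longrightarrow> inj (flow t)"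
proof -
  have "inj (F t)" if "t \<in> {0..1}" for t
    using isotopy that by (auto simp: isotopy_def Diff1_def bij_is_inj)
  moreover have "inj (F 1 ^^ k)" for k
    by (rule inj_fn) (rule calculation, simp)
  moreover have "frac t \<in> {0..1}" by (simp add: frac_ge_0 less_imp_le[OF frac_lt_1])
  ultimately show ?thesis unfolding extend_def by (intro inj_compose)
qed

end

section \<open>Angle lifts, torsion and linking\<close>

lemma circle_of_eq_iff_cis: "circle_of a = circle_of b \<longleftrightarrow> cis a = cis b"
  by (simp add: circle_of_eq_iff cis_eq_iff)

lemma to_complex_simps [simp]:
  "to_complex 0 = 0" "to_complex (u + v) = to_complex u + to_complex v" "to_complex (u - v) = to_complex u - to_complex v"
  "to_complex (r *\<^sub>R u) = of_real r * to_complex u" "to_complex (1, 0) = 1"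
  by (auto simp: to_complex_def complex_eq_iff prod_eq_iff)

lemma to_complex_eq_iff: "to_complex u = to_complex v \<longleftrightarrow> u = v"
  by (auto simp: to_complex_def prod_eq_iff)

lemma to_complex_eq_0 [simp]: "to_complex u = 0 \<longleftrightarrow> u = 0"
  using to_complex_eq_iff[of u 0] by simp

definition direction :: "real \<Rightarrow> plane" where
  "direction \<theta> = (cos \<theta>, sin \<theta>)"

lemma to_complex_direction [simp]: "to_complex (direction \<theta>) = cis \<theta>"
  by (simp add: to_complex_def direction_def complex_eq_iff)

lemma direction_nonzero [simp]: "direction \<theta> \<noteq> 0"
  using cis_neq_zero[of \<theta>] to_complex_eq_0[of "direction \<theta>"] by simp

lemma direction_0: "direction 0 = (1, 0)"
  by (simp add: direction_def)

lemma continuous_on_direction [continuous_intros]: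
  fixes g :: "'a::t2_space \<Rightarrow> real"
  shows "continuous_on S g \<Longrightarrow> continuous_on S (\<lambda>x. direction (g x))"
  unfolding direction_def by (intro continuous_intros)

lemma continuous_on_to_complex [continuous_intros]:
  "continuous_on S g \<Longrightarrow> continuous_on S (\<lambda>x. to_complex (g x))"
  unfolding to_complex_def by (intro continuous_intros)

lemma mean_variation_eq:
  assumes cont: "continuous_on {0..} \<phi>"
    and lift: "\<And>t. 0 \<le> t \<Longrightarrow> v t \<noteq> 0 \<and> to_complex (v t) = of_real (norm (to_complex (v t))) * cis (\<phi> t)"
  shows "mean_variation (\<lambda>t. oriented_angle (1, 0) (v t)) n = (\<phi> (real n) - \<phi> 0) / real n"
proof -
  let ?\<alpha> = "\<lambda>t. oriented_angle (1, 0) (v t)"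
  have \<alpha>: "?\<alpha> t = circle_of (\<phi> t)" if "0 \<le> t" for t
  proof -
    define w where "w = to_complex (v t)"
    have w: "w \<noteq> 0" "w = of_real (norm w) * cis (\<phi> t)" using lift[OF that] by (simp_all add: w_def)
    then have "cis (Arg w) = cis (\<phi> t)"
      by (simp add: cis_Arg sgn_eq) (metis nonzero_mult_div_cancel_left norm_eq_zero of_real_eq_0_iff)
    then show ?thesis by (simp add: oriented_angle_def circle_of_eq_iff_cis w_def)
  qed
  then have "is_lift ?\<alpha> \<phi>" using cont by (simp add: is_lift_def)
  define \<psi> where "\<psi> = (SOME \<phi>. is_lift ?\<alpha> \<phi>)"
  have "is_lift ?\<alpha> \<psi>" unfolding \<psi>_def by (rule someI[where P = "is_lift ?\<alpha>", OF \<open>is_lift ?\<alpha> \<phi>\<close>])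
  then have \<psi>: "continuous_on {0..} \<psi>" "\<And>t. 0 \<le> t \<Longrightarrow> circle_of (\<psi> t) = circle_of (\<phi> t)"
    using \<alpha> by (auto simp: is_lift_def)
  have "\<psi> (real n) - \<phi> (real n) = \<psi> 0 - \<phi> 0"
  proof (rule cis_1_imp_constant[where S = "{0..}" and f = "\<lambda>t. \<psi> t - \<phi> t"])
    show "cis (\<psi> t - \<phi> t) = 1" if "t \<in> {0..}" for t
      using \<psi>(2)[of t] that by (simp add: circle_of_eq_iff_cis cis_divide[symmetric])
  qed (auto intro!: continuous_intros \<psi> cont)
  then show ?thesis by (simp add: mean_variation_def Let_def \<psi>_def[symmetric] algebra_simps)
qed

text \<open>A convex set is contractible, so a nonvanishing continuous function on it has a
  continuous logarithm, whose imaginary part is the angle.\<close>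

lemma angle_lift_exists:
  fixes H :: "'a::real_normed_vector \<Rightarrow> complex"
  assumes "convex S" "continuous_on S H" "\<And>x. x \<in> S \<Longrightarrow> H x \<noteq> 0"
  shows "\<exists>\<Theta>. continuous_on S \<Theta> \<and> (\<forall>x\<in>S. H x = of_real (norm (H x)) * cis (\<Theta> x))"
proof -
  obtain g where g: "continuous_on S g" "\<And>x. x \<in> S \<Longrightarrow> H x = exp (g x)"
    using continuous_logarithm_on_contractible[OF assms(2) convex_imp_contractible[OF assms(1)] assms(3)] by blast
  show ?thesis
  proof (intro exI[of _ "\<lambda>x. Im (g x)"] conjI ballI)
    show "continuous_on S (\<lambda>x. Im (g x))" by (intro continuous_intros g)
    show "H x = of_real (norm (H x)) * cis (Im (g x))" if "x \<in> S" for x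
      using g(2)[OF that] by (simp add: exp_eq_polar norm_mult)
  qed
qed

lemma angle_lift_unique:
  fixes w :: "'a::topological_space \<Rightarrow> complex"
  assumes "connected S" "continuous_on S \<phi>" "continuous_on S \<psi>"
    and "\<And>x. x \<in> S \<Longrightarrow> w x \<noteq> 0"
    and \<phi>: "\<And>x. x \<in> S \<Longrightarrow> w x = of_real (norm (w x)) * cis (\<phi> x)"
    and \<psi>: "\<And>x. x \<in> S \<Longrightarrow> w x = of_real (norm (w x)) * cis (\<psi> x)"
    and "y \<in> S" "\<phi> y = \<psi> y" "x \<in> S"
  shows "\<phi> x = \<psi> x"
proof -
  have "\<phi> x - \<psi> x = \<phi> y - \<psi> y"
  proof (rule cis_1_imp_constant[OF \<open>connected S\<close>])
    fix x assume x: "x \<in> S"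
    have "of_real (norm (w x)) * cis (\<phi> x) = of_real (norm (w x)) * cis (\<psi> x)"
      using \<phi>[OF x] \<psi>[OF x] by simp
    then have "cis (\<phi> x) = cis (\<psi> x)" using assms(4)[OF x] by simp
    then show "cis (\<phi> x - \<psi> x) = 1" by (simp add: cis_divide[symmetric])
  qed (intro continuous_intros assms | fact)+
  then show ?thesis using \<open>\<phi> y = \<psi> y\<close> by simp
qed

lemma to_complex_polar:
  assumes "u \<noteq> 0"
  shows "u = norm (to_complex u) *\<^sub>R direction (Arg (to_complex u))"
proof -
  have "to_complex u = to_complex (norm (to_complex u) *\<^sub>R direction (Arg (to_complex u)))"
    using rcis_cmod_Arg[of "to_complex u"] by (simp add: rcis_def)
  then show ?thesis by (simp only: to_complex_eq_iff)
qed

section \<open>The real angle of a transported vector, and linking realised by it\<close>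

context plane_isotopy begin

lemma dflow_scaleR: "0 \<le> t \<Longrightarrow> dflow t p (r *\<^sub>R \<xi>) = r *\<^sub>R dflow t p \<xi>"
  by (rule linear_scale[OF bounded_linear.linear[OF bounded_linear_dflow]])

text \<open>The initial angle is a real number and not a point of the circle: this makes the
  parameter domain convex, so a global lift exists, and the condition at time 0 fixes it.\<close>

definition angle_function :: "(real \<times> plane \<times> real \<Rightarrow> real) \<Rightarrow> bool" where
  "angle_function \<Theta> \<longleftrightarrow> continuous_on ({0..} \<times> UNIV) \<Theta> \<and>
     (\<forall>t\<ge>0. \<forall>p \<theta>. to_complex (dflow t p (direction \<theta>)) =
        of_real (norm (to_complex (dflow t p (direction \<theta>)))) * cis (\<Theta> (t, p, \<theta>))) \<and>
     (\<forall>p \<theta>. \<Theta> (0, p, \<theta>) = \<theta>)"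

lemma angle_function_exists: "\<exists>\<Theta>. angle_function \<Theta>"
proof -
  define H :: "real \<times> plane \<times> real \<Rightarrow> complex" where
    "H = (\<lambda>(t, p, \<theta>). to_complex (dflow t p (direction \<theta>)))"
  have "convex ({0..} \<times> UNIV :: (real \<times> plane \<times> real) set)" by (intro convex_Times) auto
  moreover have "continuous_on ({0..} \<times> UNIV) H"
    unfolding H_def case_prod_unfold by (intro continuous_intros) auto
  moreover have "H x \<noteq> 0" if "x \<in> {0..} \<times> UNIV" for x
    using that by (auto simp: H_def dflow_nonzero)
  ultimately obtain \<Theta> where \<Theta>: "continuous_on ({0..} \<times> UNIV) \<Theta>"
      "\<And>x. x \<in> {0..} \<times> UNIV \<Longrightarrow> H x = of_real (norm (H x)) * cis (\<Theta> x)"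
    using angle_lift_exists[of "{0..} \<times> UNIV" H] by blast
  define c where "c = \<Theta> (0, 0, 0)"
  have c: "\<Theta> (0, p, \<theta>) - \<theta> = c" for p \<theta>
  proof -
    have cis: "cis (\<Theta> (0, p, \<theta>)) = cis \<theta>" for p \<theta>
      using \<Theta>(2)[of "(0, p, \<theta>)"] by (simp add: H_def dflow_0)
    have "(\<lambda>x. \<Theta> (0, x) - snd x) (p, \<theta>) = (\<lambda>x. \<Theta> (0, x) - snd x) (0, 0)"
    proof (rule cis_1_imp_constant[where S = UNIV and f = "\<lambda>x. \<Theta> (0, x) - snd x"])
      show "continuous_on UNIV (\<lambda>x. \<Theta> (0, x) - snd x)"
        by (intro continuous_intros continuous_on_compose2[OF \<Theta>(1)]) auto
      show "cis (\<Theta> (0, x) - snd x) = 1" for x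
        using cis[of "fst x" "snd x"] by (simp add: cis_divide[symmetric])
    qed auto
    then show ?thesis by (simp add: c_def)
  qed
  have "cis c = 1"
    using \<Theta>(2)[of "(0, 0, 0)"] by (simp add: H_def dflow_0 c_def)
  then have "cis (\<Theta> x - c) = cis (\<Theta> x)" for x by (simp add: cis_divide[symmetric])
  then show ?thesis unfolding angle_function_def
    using \<Theta> c by (intro exI[of _ "\<lambda>x. \<Theta> x - c"]) (auto intro!: continuous_intros simp: H_def algebra_simps)
qed

definition angle :: "real \<Rightarrow> plane \<Rightarrow> real \<Rightarrow> real" where
  "angle t p \<theta> = (SOME \<Theta>. angle_function \<Theta>) (t, p, \<theta>)"

lemma
  shows continuous_on_angle_aux: "continuous_on ({0..} \<times> UNIV) (\<lambda>(t, p, \<theta>). angle t p \<theta>)"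
    and angle_direction: "0 \<le> t \<Longrightarrow> to_complex (dflow t p (direction \<theta>)) =
        of_real (norm (to_complex (dflow t p (direction \<theta>)))) * cis (angle t p \<theta>)"
    and angle_0 [simp]: "angle 0 p \<theta> = \<theta>"
proof -
  define \<Theta> where "\<Theta> = (SOME \<Theta>. angle_function \<Theta>)"
  have "angle_function \<Theta>" unfolding \<Theta>_def by (rule someI_ex[OF angle_function_exists])
  moreover have "angle t p \<theta> = \<Theta> (t, p, \<theta>)" for t p \<theta> by (simp add: angle_def \<Theta>_def)
  moreover have "(\<lambda>(t, p, \<theta>). \<Theta> (t, p, \<theta>)) = \<Theta>" by auto
  ultimately show "continuous_on ({0..} \<times> UNIV) (\<lambda>(t, p, \<theta>). angle t p \<theta>)"
    "0 \<le> t \<Longrightarrow> to_complex (dflow t p (direction \<theta>)) =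
        of_real (norm (to_complex (dflow t p (direction \<theta>)))) * cis (angle t p \<theta>)"
    "angle 0 p \<theta> = \<theta>"
    by (simp_all only: angle_function_def)
qed

lemma continuous_on_angle [continuous_intros]:
  assumes "continuous_on S a" "continuous_on S b" "continuous_on S c" "\<And>x. x \<in> S \<Longrightarrow> 0 \<le> a x"
  shows "continuous_on S (\<lambda>x. angle (a x) (b x) (c x))"
proof -
  have "continuous_on S (\<lambda>x. (\<lambda>(t, p, \<theta>). angle t p \<theta>) (a x, b x, c x))"
    by (rule continuous_on_compose2[OF continuous_on_angle_aux]) (use assms in \<open>auto intro!: continuous_intros\<close>)
  then show ?thesis by simp
qed

lemma angle_lift:
  assumes "0 \<le> t" "0 < r"
  shows "to_complex (dflow t p (r *\<^sub>R direction \<theta>)) =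
    of_real (norm (to_complex (dflow t p (r *\<^sub>R direction \<theta>)))) * cis (angle t p \<theta>)"
  using assms angle_direction[of t p \<theta>] by (simp add: dflow_scaleR norm_mult mult.assoc)

lemma angle_unique:
  assumes "continuous_on {0..} \<psi>" "\<xi> = r *\<^sub>R direction \<theta>" "0 < r" "\<psi> 0 = \<theta>"
    and "\<And>t. 0 \<le> t \<Longrightarrow> to_complex (dflow t p \<xi>) = of_real (norm (to_complex (dflow t p \<xi>))) * cis (\<psi> t)"
    and "0 \<le> t"
  shows "\<psi> t = angle t p \<theta>"
proof (rule angle_lift_unique[where S = "{0..}" and w = "\<lambda>t. to_complex (dflow t p \<xi>)" and y = 0
      and \<phi> = \<psi> and \<psi> = "\<lambda>t. angle t p \<theta>"])
  show "continuous_on {0..} (\<lambda>t. angle t p \<theta>)" by (intro continuous_intros) auto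
  have "\<xi> \<noteq> 0" using assms(2,3) by (simp)
  then show "to_complex (dflow t p \<xi>) \<noteq> 0" if "t \<in> {0..}" for t
    using that dflow_nonzero by simp
  show "to_complex (dflow t p \<xi>) = of_real (norm (to_complex (dflow t p \<xi>))) * cis (angle t p \<theta>)" if "t \<in> {0..}" for t
    unfolding assms(2) by (rule angle_lift) (use that assms in auto)
qed (use assms in auto)

text \<open>Both sides lift the angle of the same moving vector and agree at \<open>t = 0\<close>.
  This is the exact cocycle relation behind the Birkhoff sums.\<close>

lemma angle_add:
  assumes "0 \<le> t"
  shows "angle (real k + t) p \<theta> = angle t (flow (real k) p) (angle (real k) p \<theta>)"
proof (rule angle_unique[where \<psi> = "\<lambda>t. angle (real k + t) p \<theta>" and r = "norm (to_complex (dflow (real k) p (direction \<theta>)))"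
      and \<xi> = "dflow (real k) p (direction \<theta>)"])
  show "continuous_on {0..} (\<lambda>t. angle (real k + t) p \<theta>)" by (intro continuous_intros) auto
  have "to_complex (dflow (real k) p (direction \<theta>)) =
      to_complex (norm (to_complex (dflow (real k) p (direction \<theta>))) *\<^sub>R direction (angle (real k) p \<theta>))"
    using angle_direction[of "real k" p \<theta>] by simp
  then show "dflow (real k) p (direction \<theta>) =
      norm (to_complex (dflow (real k) p (direction \<theta>))) *\<^sub>R direction (angle (real k) p \<theta>)"
    by (simp only: to_complex_eq_iff)
  show "0 < norm (to_complex (dflow (real k) p (direction \<theta>)))"
    using dflow_nonzero by simp
  show "to_complex (dflow t (flow (real k) p) (dflow (real k) p (direction \<theta>))) =
      of_real (norm (to_complex (dflow t (flow (real k) p) (dflow (real k) p (direction \<theta>))))) * cis (angle (real k + t) p \<theta>)"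
    if "0 \<le> t" for t
    using angle_direction[of "real k + t" p \<theta>] that by (simp add: dflow_add)
qed (use assms in auto)

lemma angle_variation_cong:
  assumes "cis \<theta> = cis \<theta>'" "0 \<le> t"
  shows "angle t p \<theta> - \<theta> = angle t p \<theta>' - \<theta>'"
proof -
  have "angle t p \<theta> - \<theta> + \<theta>' = angle t p \<theta>'"
  proof (rule angle_unique[where r = 1 and \<psi> = "\<lambda>t. angle t p \<theta> - \<theta> + \<theta>'" and \<xi> = "direction \<theta>"])
    show "direction \<theta> = 1 *\<^sub>R direction \<theta>'" using assms(1) by (simp add: to_complex_eq_iff[symmetric])
    have "cis (angle t p \<theta> - \<theta> + \<theta>') = cis (angle t p \<theta>)" for t
      using assms(1) by (simp add: cis_mult[symmetric] cis_divide[symmetric])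
    then show "to_complex (dflow t p (direction \<theta>)) =
        of_real (norm (to_complex (dflow t p (direction \<theta>)))) * cis (angle t p \<theta> - \<theta> + \<theta>')" if "0 \<le> t" for t
      using angle_direction[OF that] by simp
  qed (use assms in \<open>auto intro!: continuous_intros\<close>)
  then show ?thesis by simp
qed

text \<open>An injective linear map keeps vectors of different directions from becoming positively
  proportional, so the difference of angles never meets a multiple of \<open>2 * pi\<close> and
  stays in the gap where it starts.\<close>

lemma angle_between:
  assumes "0 \<le> t" "0 < \<theta>" "\<theta> < 2 * pi"
  shows "0 < angle t p \<theta> - angle t p 0" "angle t p \<theta> - angle t p 0 < 2 * pi"
proof -
  define \<delta> where "\<delta> s = angle s p \<theta> - angle s p 0" for s
  have \<delta>0: "\<delta> 0 = \<theta>" by (simp add: \<delta>_def)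
  have cont: "continuous_on {0..t} \<delta>" unfolding \<delta>_def by (intro continuous_intros) auto
  have ne: "cis (\<delta> s) \<noteq> 1" if "0 \<le> s" for s
  proof
    assume "cis (\<delta> s) = 1"
    then have eq: "cis (angle s p \<theta>) = cis (angle s p 0)" by (simp add: \<delta>_def cis_divide[symmetric])
    define m where "m = norm (to_complex (dflow s p (direction \<theta>)))"
    define n where "n = norm (to_complex (dflow s p (direction 0)))"
    have pos: "m > 0" "n > 0" using that dflow_nonzero by (auto simp: m_def n_def)
    have "to_complex (n *\<^sub>R dflow s p (direction \<theta>)) = to_complex (m *\<^sub>R dflow s p (direction 0))"
      using angle_direction[OF that, of p \<theta>] angle_direction[OF that, of p 0] eq
      by (simp add: m_def[symmetric] n_def[symmetric])
    then have "n *\<^sub>R dflow s p (direction \<theta>) - m *\<^sub>R dflow s p (direction 0) = 0"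
      by (simp only: to_complex_eq_iff) simp
    then have "dflow s p (n *\<^sub>R direction \<theta> - m *\<^sub>R direction 0) = 0"
      using that by (simp add: linear_diff[OF bounded_linear.linear[OF bounded_linear_dflow[OF that]]] dflow_scaleR)
    then have "n *\<^sub>R direction \<theta> - m *\<^sub>R direction 0 = (0 :: plane)"
      using dflow_nonzero that by blast
    then have "n * cos \<theta> = m" "sin \<theta> = 0" using pos by (auto simp: direction_def zero_prod_def)
    then have "cos \<theta> > 0" using pos zero_less_mult_pos[of n "cos \<theta>"] by simp
    moreover have "\<bar>cos \<theta>\<bar> = 1" using \<open>sin \<theta> = 0\<close> sin_cos_squared_add[of \<theta>] by (simp add: abs_square_eq_1)
    ultimately have "cis \<theta> = 1" using \<open>sin \<theta> = 0\<close> by (simp add: complex_eq_iff)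
    then obtain k :: int where "\<theta> = 2 * pi * of_int k" by (auto simp: cis_eq_1_iff)
    then show False using assms(2,3) by (simp add: zero_less_mult_iff)
  qed
  show "0 < angle t p \<theta> - angle t p 0"
  proof (rule ccontr)
    assume "\<not> ?thesis"
    then have "\<exists>s. 0 \<le> s \<and> s \<le> t \<and> \<delta> s = 0"
      by (intro IVT2' cont) (use assms \<delta>0 in \<open>auto simp: \<delta>_def\<close>)
    then obtain s where "0 \<le> s" "\<delta> s = 0" by auto
    then show False using ne[of s] by simp
  qed
  show "angle t p \<theta> - angle t p 0 < 2 * pi"
  proof (rule ccontr)
    assume "\<not> ?thesis"
    then have "\<exists>s. 0 \<le> s \<and> s \<le> t \<and> \<delta> s = 2 * pi"
      by (intro IVT' cont) (use assms \<delta>0 in \<open>auto simp: \<delta>_def\<close>)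
    then obtain s where s: "0 \<le> s" "\<delta> s = 2 * pi" by auto
    then show False using ne[of s] by simp
  qed
qed

text \<open>With the initial angle reduced to \<open>[0, 2 * pi)\<close>, the difference from the
  reference direction lies in that interval both at the start and at time \<open>t\<close>. This
  makes torsion independent of the vector.\<close>

lemma angle_variation_comparison:
  assumes "0 \<le> t"
  shows "\<bar>(angle t p \<theta> - \<theta>) - angle t p 0\<bar> \<le> 2 * pi"
proof -
  define \<theta>' where "\<theta>' = 2 * pi * frac (\<theta> / (2 * pi))"
  have "\<theta> - \<theta>' = 2 * pi * of_int \<lfloor>\<theta> / (2 * pi)\<rfloor>" by (simp add: \<theta>'_def frac_def algebra_simps)
  then have "cis \<theta> = cis \<theta>'" unfolding cis_eq_iff by blast
  then have eq: "angle t p \<theta> - \<theta> = angle t p \<theta>' - \<theta>'" using angle_variation_cong assms by blast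
  have "0 \<le> \<theta>'" "\<theta>' < 2 * pi"
    using frac_ge_0 frac_lt_1 by (auto simp: \<theta>'_def)
  then show ?thesis
    unfolding eq using angle_between[OF assms, of \<theta>' p] by (cases "\<theta>' = 0") auto
qed

text \<open>The difference quotient of the flow along the segment extends continuously to the diagonal,
  where it is the derivative; its angle is the chord lift to which the arc theorem applies.\<close>
lemma linking_n_eq_angle_variation:
  assumes "x \<noteq> y"
  defines "\<theta> \<equiv> Arg (to_complex (y - x))"
  shows "\<exists>p. linking_n F x y n = (angle (real n) p \<theta> - \<theta>) / real n"
proof -
  define e where "e = y - x"
  have "e \<noteq> 0" using assms by (simp add: e_def)
  define pt where "pt s = x + s *\<^sub>R e" for s :: real
  define D :: "(real \<times> real \<times> real) set" where "D = {(t, s, s'). 0 \<le> t \<and> 0 \<le> s \<and> s \<le> s' \<and> s' \<le> 1}"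
  \<comment> \<open>Hadamard's integral form of the difference quotient, defined also for
    \<open>s = s'\<close>.\<close>
  define V where "V = (\<lambda>(t, s, s'). integral (cbox 0 1) (\<lambda>u::real. dflow t (pt (s + u * (s' - s))) e))"
  have "continuous_on (D \<times> cbox 0 1)
      (\<lambda>(x, u). (\<lambda>(t, s, s') u. dflow t (pt (s + u * (s' - s))) e) x u)"
    unfolding case_prod_unfold pt_def by (intro continuous_intros) (auto simp: D_def)
  from integral_continuous_on_param[OF this] have contV: "continuous_on D V"
    by (simp add: V_def case_prod_unfold)
  have V: "(s' - s) *\<^sub>R V (t, s, s') = flow t (pt s') - flow t (pt s)" if "(t, s, s') \<in> D" for t s s'
  proof -
    have "((\<lambda>u. (s' - s) *\<^sub>R dflow t (pt (s + u * (s' - s))) e) has_integral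
        flow t (pt (s + 1 * (s' - s))) - flow t (pt (s + 0 * (s' - s)))) {0..1}"
    proof (rule fundamental_theorem_of_calculus)
      fix u :: real
      have t: "0 \<le> t" using that by (simp add: D_def)
      have "((\<lambda>u. pt (s + u * (s' - s))) has_derivative (\<lambda>h. h *\<^sub>R ((s' - s) *\<^sub>R e))) (at u within {0..1})"
        unfolding pt_def by (auto intro!: derivative_eq_intros simp: algebra_simps)
      from has_derivative_compose[OF this has_derivative_flow[OF t]]
      show "((\<lambda>u. flow t (pt (s + u * (s' - s)))) has_vector_derivative
          (s' - s) *\<^sub>R dflow t (pt (s + u * (s' - s))) e) (at u within {0..1})"
        unfolding has_vector_derivative_def by (simp add: dflow_scaleR[OF t] mult.commute)
    qed simp
    moreover have "(\<lambda>u. dflow t (pt (s + u * (s' - s))) e) integrable_on {0..1}"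
      using that unfolding pt_def by (intro integrable_continuous_real continuous_intros) (auto simp: D_def)
    ultimately show ?thesis
      by (simp add: V_def has_integral_iff)
  qed
  have Vdiag: "V (t, s, s) = dflow t (pt s) e" for t s by (simp add: V_def)
  have V0: "V (0, s, s') = e" for s s' by (simp add: V_def dflow_0)
  have inj_pt: "pt s = pt s' \<longleftrightarrow> s = s'" for s s' using \<open>e \<noteq> 0\<close> by (simp add: pt_def)
  have nz: "V z \<noteq> 0" if "z \<in> D" for z
  proof -
    obtain t s s' where z: "z = (t, s, s')" by (cases z)
    show ?thesis
    proof (cases "s = s'")
      case True
      then show ?thesis using that \<open>e \<noteq> 0\<close> by (auto simp: z Vdiag D_def dflow_nonzero)
    next
      case False
      have "flow t (pt s') \<noteq> flow t (pt s)"
        using that False inj_flow[of t] inj_pt by (auto simp: z D_def inj_eq)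
      then show ?thesis using V[of t s s'] that by (auto simp: z)
    qed
  qed
  have "convex D"
  proof (rule convexI)
    fix p q :: "real \<times> real \<times> real" and u v :: real
    assume *: "p \<in> D" "q \<in> D" "0 \<le> u" "0 \<le> v" "u + v = 1"
    obtain a b c a' b' c' where pq: "p = (a, b, c)" "q = (a', b', c')" by (cases p; cases q)
    have "u * b \<le> u * c" "v * b' \<le> v * c'" "0 \<le> u * a" "0 \<le> v * a'" "0 \<le> u * b" "0 \<le> v * b'"
      using * by (auto simp: pq D_def intro: mult_left_mono)
    moreover have "u * c + v * c' \<le> 1" by (rule convex_bound_le) (use * in \<open>auto simp: pq D_def\<close>)
    ultimately show "u *\<^sub>R p + v *\<^sub>R q \<in> D" by (auto simp: pq D_def)
  qed
  moreover have "continuous_on D (\<lambda>z. to_complex (V z))" by (intro continuous_intros contV)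
  ultimately obtain \<Theta> where \<Theta>: "continuous_on D \<Theta>"
      "\<And>z. z \<in> D \<Longrightarrow> to_complex (V z) = of_real (norm (to_complex (V z))) * cis (\<Theta> z)"
    using angle_lift_exists[of D "\<lambda>z. to_complex (V z)"] nz by (metis to_complex_eq_0)
  \<comment> \<open>At time 0 every chord and every tangent is represented by \<open>e\<close>, so
    all angles start from the same real number.\<close>
  have start: "\<Theta> (0, s, s') = \<Theta> (0, 0, 1)" if "0 \<le> s" "s \<le> s'" "s' \<le> 1" for s s'
  proof (rule angle_lift_unique[where S = "D \<inter> {0} \<times> UNIV" and w = "\<lambda>z. to_complex (V z)" and \<psi> = "\<lambda>_. \<Theta> (0, 0, 1)" and y = "(0, 0, 1)"])
    have "convex ({0} \<times> UNIV :: (real \<times> real \<times> real) set)" by (intro convex_Times) auto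
    then show "connected (D \<inter> {0} \<times> UNIV)" using \<open>convex D\<close> by (intro convex_connected convex_Int)
    fix z assume z: "z \<in> D \<inter> {0} \<times> UNIV"
    then show "to_complex (V z) = of_real (norm (to_complex (V z))) * cis (\<Theta> z)" using \<Theta>(2) by auto
    have "V z = V (0, 0, 1)" using z by (auto simp: V0)
    then show "to_complex (V z) = of_real (norm (to_complex (V z))) * cis (\<Theta> (0, 0, 1))"
      using \<Theta>(2)[of "(0, 0, 1)"] by (simp add: D_def)
  qed (use that nz \<Theta> in \<open>auto simp: D_def intro: continuous_on_subset\<close>)
  have cont_t: "continuous_on {0..} (\<lambda>t. \<Theta> (t, s, s'))" if "0 \<le> s" "s \<le> s'" "s' \<le> 1" for s s'
    by (rule continuous_on_compose2[OF \<Theta>(1)]) (use that in \<open>auto intro!: continuous_intros simp: D_def\<close>)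

  interpret chord_lift "\<lambda>s. to_complex (flow (real n) (pt s))" "\<lambda>(s, s'). \<Theta> (real n, s, s')" 0 1
  proof
    show "continuous_on {0..1} (\<lambda>s. to_complex (flow (real n) (pt s)))"
      unfolding pt_def by (intro continuous_intros) auto
    show "continuous_on {(s, s'). 0 \<le> s \<and> s \<le> s' \<and> s' \<le> 1} (\<lambda>(s, s'). \<Theta> (real n, s, s'))"
      unfolding case_prod_unfold
      by (rule continuous_on_compose2[OF \<Theta>(1)]) (auto intro!: continuous_intros simp: D_def)
    fix s s' :: real assume s: "0 \<le> s" "s < s'" "s' \<le> 1"
    then show "to_complex (flow (real n) (pt s')) \<noteq> to_complex (flow (real n) (pt s))"
      using inj_eq[OF inj_flow[of "real n"]] inj_pt by (simp add: to_complex_eq_iff)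
    have D: "(real n, s, s') \<in> D" using s by (simp add: D_def)
    have *: "to_complex (flow (real n) (pt s')) - to_complex (flow (real n) (pt s)) = of_real (s' - s) * to_complex (V (real n, s, s'))"
      using arg_cong[OF V[OF D], of to_complex] by simp
    show "to_complex (flow (real n) (pt s')) - to_complex (flow (real n) (pt s)) =
        of_real (norm (to_complex (flow (real n) (pt s')) - to_complex (flow (real n) (pt s)))) *
        cis (case (s, s') of (s, s') \<Rightarrow> \<Theta> (real n, s, s'))"
    proof -
      have "norm (of_real (s' - s) :: complex) = s' - s" using s by (simp only: norm_of_real)
      moreover have "of_real (s' - s) * to_complex (V (real n, s, s')) =
          of_real (s' - s) * (of_real (norm (to_complex (V (real n, s, s')))) * cis (\<Theta> (real n, s, s')))"
        using \<Theta>(2)[OF D] by (rule arg_cong)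
      ultimately show ?thesis unfolding * norm_mult by (simp only: of_real_mult mult.assoc prod.case)
    qed
  qed simp
  obtain s where s: "0 \<le> s" "s \<le> 1" "\<Theta> (real n, s, s) = \<Theta> (real n, 0, 1)"
    using tangent_parallel_to_chord by auto

  have "linking_n F x y n = (\<Theta> (real n, 0, 1) - \<Theta> (0, 0, 1)) / real n"
    unfolding linking_n_def
  proof (rule mean_variation_eq[OF cont_t])
    fix t :: real assume "0 \<le> t"
    then have D: "(t, 0, 1) \<in> D" by (simp add: D_def)
    have "V (t, 0, 1) = flow t y - flow t x"
      using V[OF D] by (simp add: pt_def e_def)
    then show "flow t y - flow t x \<noteq> 0 \<and> to_complex (flow t y - flow t x) =
        of_real (norm (to_complex (flow t y - flow t x))) * cis (\<Theta> (t, 0, 1))"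
      using nz[OF D] \<Theta>(2)[OF D] by simp
  qed auto
  moreover have "\<Theta> (t, s, s) - \<Theta> (0, s, s) + \<theta> = angle t (pt s) \<theta>" if "0 \<le> t" for t
  proof (rule angle_unique[where \<psi> = "\<lambda>t. \<Theta> (t, s, s) - \<Theta> (0, s, s) + \<theta>" and \<xi> = e and r = "norm (to_complex e)"])
    show "continuous_on {0..} (\<lambda>t. \<Theta> (t, s, s) - \<Theta> (0, s, s) + \<theta>)"
      by (intro continuous_intros cont_t) (use s in auto)
    show polar: "e = norm (to_complex e) *\<^sub>R direction \<theta>"
      using to_complex_polar[OF \<open>e \<noteq> 0\<close>] unfolding \<theta>_def e_def[symmetric] .
    have "to_complex e = of_real (norm (to_complex e)) * cis (\<Theta> (0, s, s))"
      using \<Theta>(2)[of "(0, s, s)"] s by (simp add: V0 D_def)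
    moreover have "to_complex e = of_real (norm (to_complex e)) * cis \<theta>"
      using arg_cong[OF polar, of to_complex] by simp
    ultimately have "of_real (norm (to_complex e)) * cis (\<Theta> (0, s, s)) = of_real (norm (to_complex e)) * cis \<theta>"
      by simp
    then have "cis (\<Theta> (0, s, s)) = cis \<theta>" using \<open>e \<noteq> 0\<close> by simp
    then have cis: "cis (\<Theta> (t, s, s) - \<Theta> (0, s, s) + \<theta>) = cis (\<Theta> (t, s, s))" for t
      by (simp add: cis_mult[symmetric] cis_divide[symmetric])
    show "to_complex (dflow t (pt s) e) = of_real (norm (to_complex (dflow t (pt s) e))) * cis (\<Theta> (t, s, s) - \<Theta> (0, s, s) + \<theta>)"
      if "0 \<le> t" for t
      unfolding cis using \<Theta>(2)[of "(t, s, s)"] that s by (simp add: Vdiag D_def)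
  qed (use that \<open>e \<noteq> 0\<close> in auto)
  then have "angle (real n) (pt s) \<theta> - \<theta> = \<Theta> (real n, s, s) - \<Theta> (0, s, s)" by (metis add_diff_cancel_right' of_nat_0_le_iff)
  ultimately show ?thesis
    using s start[of s s] by (intro exI[of _ "pt s"]) simp
qed

end

section \<open>Descent to the torus\<close>

text \<open>A metric form of quotient map. It passes to products, hence from the circle to the torus
  and to the space of directions, and continuity of a function can be tested upstairs.\<close>

definition submetry :: "('a::metric_space \<Rightarrow> 'b::metric_space) \<Rightarrow> bool" where
  "submetry P \<longleftrightarrow> (\<forall>a y. \<exists>b. P b = y \<and> dist a b \<le> dist (P a) y)"

lemma submetry_circle_of: "submetry circle_of"
  unfolding submetry_def
proof (intro allI)
  fix a :: real and y :: circle
  obtain b where "circle_of b = y" "\<bar>a - b\<bar> = flat_dist (circle_of a) y" by (rule flat_dist_attained)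
  then show "\<exists>b. circle_of b = y \<and> dist a b \<le> dist (circle_of a) y"
    by (auto simp: dist_circle_def dist_real_def)
qed

lemma submetry_map_prod:
  assumes "submetry P" "submetry Q"
  shows "submetry (map_prod P Q)"
  unfolding submetry_def
proof (intro allI)
  fix a :: "'a \<times> 'c" and y :: "'b \<times> 'd"
  obtain b c where "P b = fst y" "dist (fst a) b \<le> dist (P (fst a)) (fst y)"
    "Q c = snd y" "dist (snd a) c \<le> dist (Q (snd a)) (snd y)"
    using assms unfolding submetry_def by metis
  then show "\<exists>b. map_prod P Q b = y \<and> dist a b \<le> dist (map_prod P Q a) y"
    by (intro exI[of _ "(b, c)"])
       (auto simp: dist_prod_def prod_eq_iff intro!: real_sqrt_le_mono add_mono power_mono)
qed

lemma submetry_surj: "submetry P \<Longrightarrow> surj P"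
  unfolding submetry_def surj_def by metis

lemma submetry_continuous_on:
  fixes g :: "'b::metric_space \<Rightarrow> 'c::metric_space"
  assumes "submetry P" "continuous_on UNIV (\<lambda>a. g (P a))"
  shows "continuous_on UNIV g"
  unfolding continuous_on_iff
proof (intro ballI allI impI)
  fix x and e :: real assume "0 < e"
  obtain a where a: "P a = x" using submetry_surj[OF assms(1)] by (metis surjD)
  obtain d where d: "d > 0" "\<And>b. dist b a < d \<Longrightarrow> dist (g (P b)) (g (P a)) < e"
    using assms(2) \<open>0 < e\<close> unfolding continuous_on_iff by (metis UNIV_I)
  show "\<exists>d>0. \<forall>y\<in>UNIV. dist y x < d \<longrightarrow> dist (g y) (g x) < e"
  proof (intro exI[of _ d] conjI ballI impI \<open>d > 0\<close>)
    fix y assume "dist y x < d"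
    obtain b where "P b = y" "dist a b \<le> dist (P a) y" using assms(1) unfolding submetry_def by metis
    then show "dist (g y) (g x) < e" using d(2)[of b] a \<open>dist y x < d\<close> by (simp add: dist_commute)
  qed
qed

lemma submetry_descend:
  fixes g :: "'a::metric_space \<Rightarrow> 'c::metric_space"
  assumes "submetry P" "continuous_on UNIV g" "\<And>a b. P a = P b \<Longrightarrow> g a = g b"
  obtains g' where "continuous_on UNIV g'" "\<And>a. g' (P a) = g a"
proof -
  define g' where "g' y = g (SOME a. P a = y)" for y
  have g': "g' (P a) = g a" for a
    unfolding g'_def by (rule assms(3)) (rule someI[where P = "\<lambda>b. P b = P a"], rule refl)
  show thesis
    by (rule that[of g', OF submetry_continuous_on[OF assms(1)]]) (simp_all add: g' assms(2))
qed

lemma continuous_on_circle_of [continuous_intros]: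
  assumes "continuous_on S g"
  shows "continuous_on S (\<lambda>x. circle_of (g x))"
proof -
  have "continuous_on UNIV circle_of"
    using open_circle_iff_quotient by (simp add: continuous_on_open_vimage)
  then show ?thesis by (rule continuous_on_compose2[OF _ assms]) simp
qed

lemma submetry_torus_of: "submetry torus_of"
  unfolding torus_of_def by (intro submetry_map_prod submetry_circle_of)

lemma continuous_on_torus_of [continuous_intros]:
  "continuous_on S g \<Longrightarrow> continuous_on S (\<lambda>x. torus_of (g x))"
  unfolding torus_of_def map_prod_def case_prod_unfold by (intro continuous_intros)

lemma torus_of_eq_iff: "torus_of p = torus_of q \<longleftrightarrow> cis (fst p) = cis (fst q) \<and> cis (snd p) = cis (snd q)"
  by (cases p; cases q) (simp add: torus_of_def circle_of_eq_iff_cis)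

definition frame_of :: "plane \<times> real \<Rightarrow> torus \<times> circle" where
  "frame_of = map_prod torus_of circle_of"

lemma frame_of_Pair [simp]: "frame_of (p, \<theta>) = (torus_of p, circle_of \<theta>)"
  by (simp add: frame_of_def)

lemma submetry_frame_of: "submetry frame_of"
  unfolding frame_of_def by (intro submetry_map_prod submetry_circle_of submetry_torus_of)

lemma circle_of_surj_unit: obtains a where "a \<in> {0..1}" "circle_of (2 * pi * a) = x"
proof -
  obtain b where b: "circle_of b = x" by (rule circle_of_surj)
  have "2 * pi * frac (b / (2 * pi)) - b = 2 * pi * of_int (- \<lfloor>b / (2 * pi)\<rfloor>)"
    by (simp add: frac_def algebra_simps)
  then have "circle_of (2 * pi * frac (b / (2 * pi))) = x"
    unfolding b[symmetric] circle_of_eq_iff by blast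
  then show thesis by (intro that[of "frac (b / (2 * pi))"]) (auto simp: frac_ge_0 less_imp_le[OF frac_lt_1])
qed

text \<open>Three coordinates from a plane curve: its second coordinate is used as the parameter of
  the same curve once more.\<close>

lemma space_filling_frame:
  obtains h :: "real \<Rightarrow> torus \<times> circle" where "continuous_on UNIV h" "h ` {0..1} = UNIV"
proof -
  define h :: "real \<Rightarrow> torus \<times> circle" where
    "h t = ((circle_of (2 * pi * schoenberg 0 t), circle_of (2 * pi * schoenberg 0 (schoenberg 1 t))),
      circle_of (2 * pi * schoenberg 1 (schoenberg 1 t)))" for t
  have S: "continuous_on UNIV (\<lambda>t. schoenberg j (g t))" if "continuous_on UNIV g" for j and g :: "real \<Rightarrow> real"
    by (rule continuous_on_compose2[OF continuous_on_schoenberg that]) simp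
  have "continuous_on UNIV h"
    unfolding h_def by (intro continuous_intros S)
  moreover have "w \<in> h ` {0..1}" for w
  proof -
    obtain u v w' where w: "w = ((u, v), w')" by (metis prod.exhaust)
    obtain a b c where abc: "a \<in> {0..1}" "circle_of (2 * pi * a) = u" "b \<in> {0..1}" "circle_of (2 * pi * b) = v"
      "c \<in> {0..1}" "circle_of (2 * pi * c) = w'"
      by (metis circle_of_surj_unit)
    obtain s where s: "s \<in> {0..1}" "schoenberg 0 s = b" "schoenberg 1 s = c"
      by (rule schoenberg_surj[OF abc(3,5)])
    obtain t where t: "t \<in> {0..1}" "schoenberg 0 t = a" "schoenberg 1 t = s"
      by (rule schoenberg_surj[OF abc(1) s(1)])
    have "h t = w" by (simp only: h_def w t s abc)
    then show ?thesis using t(1) by blast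
  qed
  ultimately show thesis by (intro that[of h]) auto
qed

section \<open>Periodicity of the lifted flow, and torsion as an average over directions\<close>

locale torus_isotopy_lift = plane_isotopy F for F +
  fixes f :: "real \<Rightarrow> torus \<Rightarrow> torus"
  assumes lift: "\<And>t. t \<in> {0..1} \<Longrightarrow> torus_of \<circ> F t = f t \<circ> torus_of"
begin

lemma torus_of_flow: "torus_of (flow t p) = extend f t (torus_of p)"
proof -
  have F: "torus_of (F t q) = f t (torus_of q)" if "t \<in> {0..1}" for t q
    using fun_cong[OF lift[OF that], of q] by simp
  have "torus_of ((F 1 ^^ k) p) = (f 1 ^^ k) (torus_of p)" for k
    by (induction k) (simp_all add: F)
  moreover have "frac t \<in> {0..1}" by (simp add: frac_ge_0 less_imp_le[OF frac_lt_1])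
  ultimately show ?thesis by (simp add: extend_def F)
qed

text \<open>The difference of the two displacements lies in the lattice at all times, is continuous
  in \<open>t\<close> and vanishes at time 0; so the flow commutes with deck translations.\<close>

lemma flow_translate:
  assumes "torus_of p = torus_of q" "0 \<le> t"
  shows "flow t p - p = flow t q - q"
proof -
  have cis: "cis (fst (flow t p)) = cis (fst (flow t q)) \<and> cis (snd (flow t p)) = cis (snd (flow t q))" for t
    using assms(1) by (simp flip: torus_of_eq_iff add: torus_of_flow)
  have *: "cis (fst p) = cis (fst q)" "cis (snd p) = cis (snd q)"
    using assms(1) by (auto simp: torus_of_eq_iff)
  define \<delta> where "\<delta> t = (flow t p - p) - (flow t q - q)" for t
  have cont: "continuous_on {0..} \<delta>" unfolding \<delta>_def by (intro continuous_intros) auto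
  have "fst (\<delta> t) = fst (\<delta> 0)"
    by (rule cis_1_imp_constant[where S = "{0..}" and f = "\<lambda>t. fst (\<delta> t)"])
       (use cis * assms(2) in \<open>auto intro!: continuous_intros cont simp: \<delta>_def cis_divide[symmetric]\<close>)
  moreover have "snd (\<delta> t) = snd (\<delta> 0)"
    by (rule cis_1_imp_constant[where S = "{0..}" and f = "\<lambda>t. snd (\<delta> t)"])
       (use cis * assms(2) in \<open>auto intro!: continuous_intros cont simp: \<delta>_def cis_divide[symmetric]\<close>)
  ultimately have "\<delta> t = \<delta> 0" by (simp add: prod_eq_iff)
  then show ?thesis by (simp add: \<delta>_def flow_0)
qed

lemma dflow_translate:
  assumes "torus_of p = torus_of q" "0 \<le> t"
  shows "dflow t p = dflow t q"
proof -
  define v where "v = p - q"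
  have per: "torus_of (x + v) = torus_of x" for x
    using assms(1) by (simp add: torus_of_eq_iff v_def cis_mult[symmetric] cis_divide[symmetric])
  have "flow t (x + v) - v = flow t x" for x
    using flow_translate[OF per[of x] assms(2)] by (simp add: algebra_simps)
  moreover have "((\<lambda>x. flow t (x + v) - v) has_derivative dflow t (q + v)) (at q)"
  proof -
    have "((\<lambda>x. x + v) has_derivative (\<lambda>h. h)) (at q)" by (auto intro!: derivative_eq_intros)
    from has_derivative_diff[OF has_derivative_compose[OF this has_derivative_flow[OF assms(2)]] has_derivative_const[of v]]
    show ?thesis by simp
  qed
  ultimately have "(flow t has_derivative dflow t (q + v)) (at q)" by simp
  then show ?thesis
    using has_derivative_unique[OF _ has_derivative_flow[OF assms(2)]] by (simp add: v_def)
qed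

lemma angle_translate:
  assumes "torus_of p = torus_of q" "0 \<le> t"
  shows "angle t p \<theta> = angle t q \<theta>"
proof (rule angle_unique[where \<psi> = "\<lambda>t. angle t p \<theta>" and \<xi> = "direction \<theta>" and r = 1])
  show "to_complex (dflow t q (direction \<theta>)) = of_real (norm (to_complex (dflow t q (direction \<theta>)))) * cis (angle t p \<theta>)"
    if "0 \<le> t" for t
    using angle_direction[OF that, of p \<theta>] dflow_translate[OF assms(1) that] by simp
qed (use assms in \<open>auto intro!: continuous_intros\<close>)

lemma the_deriv_extend:
  assumes "0 \<le> t"
  shows "blinfun_apply (the_deriv has_deriv_torus (extend f t) (torus_of p)) = dflow t p"
proof -
  have app: "blinfun_apply (Blinfun (dflow t p)) = dflow t p"
    by (rule bounded_linear_Blinfun_apply[OF bounded_linear_dflow[OF assms]])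
  have "has_deriv_torus (extend f t) (torus_of p) (Blinfun (dflow t p))"
    unfolding has_deriv_torus_def has_deriv_plane_def app
    using has_derivative_flow[OF assms] torus_of_flow by (intro exI[of _ p] exI[of _ "flow t"]) auto
  then show ?thesis using app by (simp add: the_deriv_torus)
qed

lemma torsion_n_eq:
  assumes "0 < r"
  shows "torsion_n f (torus_of p) (r *\<^sub>R direction \<theta>) n = (angle (real n) p \<theta> - \<theta>) / real n"
proof -
  have "torsion_n f (torus_of p) (r *\<^sub>R direction \<theta>) n = (angle (real n) p \<theta> - angle 0 p \<theta>) / real n"
    unfolding torsion_n_def
  proof (rule mean_variation_eq)
    show "continuous_on {0..} (\<lambda>t. angle t p \<theta>)" by (intro continuous_intros) auto
    fix t :: real assume "0 \<le> t"
    then show "blinfun_apply (the_deriv has_deriv_torus (extend f t) (torus_of p)) (r *\<^sub>R direction \<theta>) \<noteq> 0 \<and>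
        to_complex (blinfun_apply (the_deriv has_deriv_torus (extend f t) (torus_of p)) (r *\<^sub>R direction \<theta>)) =
        of_real (norm (to_complex (blinfun_apply (the_deriv has_deriv_torus (extend f t) (torus_of p)) (r *\<^sub>R direction \<theta>)))) * cis (angle t p \<theta>)"
      unfolding the_deriv_extend[OF \<open>0 \<le> t\<close>]
      using dflow_nonzero[of t "r *\<^sub>R direction \<theta>" p] angle_lift[of t r p \<theta>] assms by simp
  qed
  then show ?thesis by simp
qed

lemma torsion_n_e1: "torsion_n f (torus_of p) (1, 0) n = angle (real n) p 0 / real n"
  using torsion_n_eq[of 1 p 0 n] by (simp add: direction_0)

lemma angle_average_tendsto_iff:
  "(\<lambda>n. (angle (real n) p \<theta> - \<theta>) / real n) \<longlonglongrightarrow> \<tau> \<longleftrightarrow> torsion_n f (torus_of p) (1, 0) \<longlonglongrightarrow> \<tau>"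
proof -
  have "(\<lambda>n. (angle (real n) p \<theta> - \<theta>) / real n - angle (real n) p 0 / real n) \<longlonglongrightarrow> 0"
  proof (rule Lim_null_comparison)
    show "\<forall>\<^sub>F n in sequentially. norm ((angle (real n) p \<theta> - \<theta>) / real n - angle (real n) p 0 / real n) \<le> 2 * pi / real n"
    proof (intro always_eventually allI)
      fix n
      show "norm ((angle (real n) p \<theta> - \<theta>) / real n - angle (real n) p 0 / real n) \<le> 2 * pi / real n"
        using angle_variation_comparison[of "real n" p \<theta>]
        by (simp add: diff_divide_distrib[symmetric] divide_right_mono)
    qed
    show "(\<lambda>n. 2 * pi / real n) \<longlonglongrightarrow> 0" by (rule lim_const_over_n)
  qed
  then have "(\<lambda>n. (angle (real n) p \<theta> - \<theta>) / real n) \<longlonglongrightarrow> \<tau> \<longleftrightarrow> (\<lambda>n. angle (real n) p 0 / real n) \<longlonglongrightarrow> \<tau>"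
    by (rule Lim_transform_eq)
  then show ?thesis by (simp add: torsion_n_e1[abs_def])
qed

text \<open>Changing the vector changes the averages by at most \<open>2 * pi / n\<close>. With one
  reference vector, \<open>torsion\<close> becomes a pointwise limit of continuous functions, which
  gives its measurability.\<close>

lemma has_torsion_iff: "has_torsion f z \<tau> \<longleftrightarrow> torsion_n f z (1, 0) \<longlonglongrightarrow> \<tau>"
proof
  assume "has_torsion f z \<tau>"
  then obtain \<xi> where \<xi>: "\<xi> \<noteq> 0" "torsion_n f z \<xi> \<longlonglongrightarrow> \<tau>" by (auto simp: has_torsion_def)
  obtain p where p: "torus_of p = z" using submetry_surj[OF submetry_torus_of] by (metis surjD)
  define r \<theta> where "r = norm (to_complex \<xi>)" and "\<theta> = Arg (to_complex \<xi>)"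
  have "\<xi> = r *\<^sub>R direction \<theta>" unfolding r_def \<theta>_def by (rule to_complex_polar[OF \<xi>(1)])
  moreover have "r > 0" using \<xi>(1) by (simp add: r_def)
  ultimately have "torsion_n f z \<xi> n = (angle (real n) p \<theta> - \<theta>) / real n" for n
    using torsion_n_eq[of r p \<theta> n] p by simp
  then have "torsion_n f z \<xi> = (\<lambda>n. (angle (real n) p \<theta> - \<theta>) / real n)" by (rule ext)
  then show "torsion_n f z (1, 0) \<longlonglongrightarrow> \<tau>"
    using \<xi>(2) angle_average_tendsto_iff[of p \<theta> \<tau>] p by simp
next
  assume "torsion_n f z (1, 0) \<longlonglongrightarrow> \<tau>"
  then show "has_torsion f z \<tau>" unfolding has_torsion_def by (intro exI[of _ "(1, 0)"]) (simp add: zero_prod_def)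
qed

lemma torsion_eq_lim: "torsion f z = lim (torsion_n f z (1, 0))"
  by (simp add: torsion_def has_torsion_iff lim_def)

lemma continuous_on_torsion_n: "continuous_on UNIV (\<lambda>z. torsion_n f z (1, 0) n)"
  by (rule submetry_continuous_on[OF submetry_torus_of])
     (cases "n = 0"; auto simp: torsion_n_e1 intro!: continuous_intros)

lemma continuous_on_f1: "continuous_on UNIV (f 1)"
proof (rule submetry_continuous_on[OF submetry_torus_of])
  have "continuous_on UNIV (\<lambda>p. torus_of (flow 1 p))" by (intro continuous_intros) auto
  moreover have "extend f 1 = f 1"
  proof -
    have "f 0 = id"
    proof
      fix z
      obtain p where "torus_of p = z" using submetry_surj[OF submetry_torus_of] by (metis surjD)
      then show "f 0 z = id z" using fun_cong[OF lift[of 0], of p] by (simp add: F_0)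
    qed
    then show ?thesis using extend_of_nat[of f 1] by simp
  qed
  ultimately show "continuous_on UNIV (\<lambda>p. f 1 (torus_of p))" by (simp add: torus_of_flow)
qed

text \<open>The action on oriented directions and the angle it turns them by: torsion at time n is a
  Birkhoff average of a continuous function on the compact space of directions.\<close>
lemma frame_map:
  obtains T :: "torus \<times> circle \<Rightarrow> torus \<times> circle" and \<phi> :: "torus \<times> circle \<Rightarrow> real" where
    "continuous_on UNIV T" "continuous_on UNIV \<phi>"
    "\<And>p \<theta>. T (frame_of (p, \<theta>)) = frame_of (F 1 p, angle 1 p \<theta>)"
    "\<And>p \<theta>. \<phi> (frame_of (p, \<theta>)) = angle 1 p \<theta> - \<theta>"
proof -
  have flow1: "flow 1 p = F 1 p" for p using extend_of_nat[of F 1] F_0 by simp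
  have compat: "torus_of (fst a) = torus_of (fst b) \<and> cis (snd a) = cis (snd b)" if "frame_of a = frame_of b" for a b
    using that by (cases a; cases b) (simp add: circle_of_eq_iff_cis)
  have per: "angle 1 (fst a) (snd a) - snd a = angle 1 (fst b) (snd b) - snd b" if "frame_of a = frame_of b" for a b
    using compat[OF that] angle_translate[of "fst a" "fst b" 1 "snd a"] angle_variation_cong[of "snd a" "snd b" 1 "fst b"] by simp
  obtain T where T: "continuous_on UNIV T" "\<And>a. T (frame_of a) = frame_of (flow 1 (fst a), angle 1 (fst a) (snd a))"
  proof (rule submetry_descend[OF submetry_frame_of, of "\<lambda>a. frame_of (flow 1 (fst a), angle 1 (fst a) (snd a))"])
    show "continuous_on UNIV (\<lambda>a. frame_of (flow 1 (fst a), angle 1 (fst a) (snd a)))"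
      unfolding frame_of_Pair by (intro continuous_intros) auto
    fix a b assume *: "frame_of a = frame_of b"
    have "cis (angle 1 (fst a) (snd a)) = cis (angle 1 (fst a) (snd a) - snd a) * cis (snd a)"
      by (simp add: cis_mult)
    also have "\<dots> = cis (angle 1 (fst b) (snd b) - snd b) * cis (snd b)"
      using per[OF *] compat[OF *] by simp
    also have "\<dots> = cis (angle 1 (fst b) (snd b))" by (simp add: cis_mult)
    finally show "frame_of (flow 1 (fst a), angle 1 (fst a) (snd a)) = frame_of (flow 1 (fst b), angle 1 (fst b) (snd b))"
      using compat[OF *] by (simp add: torus_of_flow circle_of_eq_iff_cis)
  qed blast
  have "continuous_on UNIV (\<lambda>a. angle 1 (fst a) (snd a) - snd a)" by (intro continuous_intros) auto
  then obtain \<phi> where \<phi>: "continuous_on UNIV \<phi>" "\<And>a. \<phi> (frame_of a) = angle 1 (fst a) (snd a) - snd a"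
    by (rule submetry_descend[OF submetry_frame_of]) (rule per, assumption, blast)
  show thesis
    by (rule that[of T \<phi>]) (use T \<phi> in \<open>simp_all add: flow1 del: frame_of_Pair\<close>)
qed

end

section \<open>The invariant measure, its torsion, and points on both sides of
  \<open>l\<close>\<close>

theorem corollary3p3:
  fixes f :: "real \<Rightarrow> torus \<Rightarrow> torus" and F :: "real \<Rightarrow> plane \<Rightarrow> plane"
    and x y :: plane and l :: real
  assumes "isotopy has_deriv_torus f"
    and "isotopy has_deriv_plane F"
    and "\<And>t. t \<in> {0..1} \<Longrightarrow> torus_of \<circ> F t = f t \<circ> torus_of"
    and "x \<noteq> y"
    and "has_linking F x y l"
  shows "(\<exists>\<mu>. invariant_prob (f 1) \<mu> \<and>
              (AE z in \<mu>. \<exists>\<tau>. has_torsion f z \<tau>) \<and> integrable \<mu> (torsion f) \<and>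
              torsion_measure f \<mu> = l) \<and>
         (\<exists>z \<tau>. has_torsion f z \<tau> \<and> \<tau> \<ge> l) \<and>
         (\<exists>z \<tau>. has_torsion f z \<tau> \<and> \<tau> \<le> l)"
proof -
  interpret torus_isotopy_lift F f by unfold_locales (fact assms)+
  obtain T \<phi> where T: "continuous_on UNIV T" and \<phi>: "continuous_on UNIV \<phi>"
    and T_frame: "\<And>p \<theta>. T (frame_of (p, \<theta>)) = frame_of (F 1 p, angle 1 p \<theta>)"
    and \<phi>_frame: "\<And>p \<theta>. \<phi> (frame_of (p, \<theta>)) = angle 1 p \<theta> - \<theta>"
    by (rule frame_map) blast
  have F_pow: "flow (real k) p = (F 1 ^^ k) p" for k p using extend_of_nat[of F k] F_0 by simp
  have T_pow: "(T ^^ k) (frame_of (p, \<theta>)) = frame_of (flow (real k) p, angle (real k) p \<theta>)" for k p \<theta>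
  proof (induction k)
    case (Suc k)
    have "angle (real (Suc k)) p \<theta> = angle 1 (flow (real k) p) (angle (real k) p \<theta>)"
      using angle_add[of 1 k p \<theta>] by (simp add: add.commute)
    then show ?case using Suc by (simp add: T_frame F_pow del: frame_of_Pair of_nat_Suc)
  qed (simp add: flow_0)
  \<comment> \<open>The cocycle relation makes the sum telescope to the angle turned, with no error
    term.\<close>
  have sum: "(\<Sum>k<n. \<phi> ((T ^^ k) (frame_of (p, \<theta>)))) = angle (real n) p \<theta> - \<theta>" for n p \<theta>
  proof (induction n)
    case (Suc n)
    have "angle (real (Suc n)) p \<theta> = angle 1 (flow (real n) p) (angle (real n) p \<theta>)"
      using angle_add[of 1 n p \<theta>] by (simp add: add.commute)
    then show ?case using Suc by (simp add: T_pow \<phi>_frame del: frame_of_Pair of_nat_Suc)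
  qed simp
  define \<theta> where "\<theta> = Arg (to_complex (y - x))"
  obtain p where p: "\<And>n. linking_n F x y n = (angle (real n) (p n) \<theta> - \<theta>) / real n"
    using linking_n_eq_angle_variation[OF assms(4)] unfolding \<theta>_def by metis
  have "(\<lambda>n. (\<Sum>k<n. \<phi> ((T ^^ k) (frame_of (p n, \<theta>)))) / real n) \<longlonglongrightarrow> l"
    using assms(5) unfolding sum has_linking_def p[symmetric] by simp
  moreover obtain h :: "real \<Rightarrow> torus \<times> circle" where h: "continuous_on UNIV h" "h ` {0..1} = UNIV"
    by (rule space_filling_frame)
  ultimately obtain \<nu> where \<nu>: "sets \<nu> = sets borel" "prob_space \<nu>" "distr \<nu> borel T = \<nu>" "(\<integral>w. \<phi> w \<partial>\<nu>) = l"
    using invariant_measure_from_orbit_averages[OF h T \<phi>, of "\<lambda>n. frame_of (p n, \<theta>)"] by blast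
  interpret \<nu>: prob_space \<nu> by (rule \<nu>(2))
  have meas: "g \<in> \<nu> \<rightarrow>\<^sub>M borel" if "continuous_on UNIV g" for g :: "torus \<times> circle \<Rightarrow> 'b::topological_space"
    using borel_measurable_continuous_onI[OF that] measurable_cong_sets[OF \<nu>(1) refl] by blast
  interpret E: measure_preserving_map \<nu> T
  proof
    show "T \<in> \<nu> \<rightarrow>\<^sub>M \<nu>" using meas[OF T] measurable_cong_sets[OF refl \<nu>(1)] by blast
    show "distr \<nu> \<nu> T = \<nu>" using \<nu>(3) distr_cong[where f = T and g = T, OF refl \<nu>(1) refl] by simp
  qed
  obtain B where B: "\<And>w. \<bar>\<phi> w\<bar> \<le> B"
  proof -
    have "compact (\<phi> ` h ` {0..1})"
      by (intro compact_continuous_image continuous_on_subset[OF \<phi>] continuous_on_subset[OF h(1)]) auto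
    then have "bounded (range \<phi>)" unfolding h(2) by (rule compact_imp_bounded)
    then show thesis using that unfolding bounded_iff by auto
  qed
  have birk: "E.birkhoff_sum \<phi> n (frame_of (p, \<theta>)) / real n = (angle (real n) p \<theta> - \<theta>) / real n" for n p \<theta>
    unfolding E.birkhoff_sum_def sum ..
  \<comment> \<open>Existence and value of the limit depend only on the base point, so convergence
    for almost every direction descends to the torus.\<close>
  have tendsto: "(\<lambda>n. E.birkhoff_sum \<phi> n w / real n) \<longlonglongrightarrow> \<tau> \<longleftrightarrow> has_torsion f (fst w) \<tau>" for w \<tau>
  proof -
    obtain p \<theta> where "w = frame_of (p, \<theta>)" using submetry_surj[OF submetry_frame_of] by (metis surjD surj_pair)
    then show ?thesis using angle_average_tendsto_iff[of p \<theta> \<tau>] by (simp add: birk has_torsion_iff del: frame_of_Pair) (simp add: frame_of_def)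
  qed
  have AE_conv: "AE w in \<nu>. (\<lambda>n. E.birkhoff_sum \<phi> n w / real n) \<longlonglongrightarrow> torsion f (fst w)"
    using E.birkhoff_ergodic[OF meas[OF \<phi>] B]
  proof eventually_elim
    case (elim w)
    then obtain \<tau> where \<tau>: "(\<lambda>n. E.birkhoff_sum \<phi> n w / real n) \<longlonglongrightarrow> \<tau>" by (auto simp: convergent_def)
    then have "torsion f (fst w) = \<tau>"
      unfolding tendsto has_torsion_iff torsion_eq_lim by (rule limI)
    then show ?case using \<tau> by simp
  qed

  define \<mu> where "\<mu> = distr \<nu> borel (fst :: torus \<times> circle \<Rightarrow> torus)"
  have [measurable]: "fst \<in> \<nu> \<rightarrow>\<^sub>M (borel :: torus measure)" by (intro meas continuous_intros)
  have prob: "prob_space \<mu>" unfolding \<mu>_def by (rule \<nu>.prob_space_distr) simp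
  then interpret \<mu>: prob_space \<mu> .
  have [measurable]: "f 1 \<in> borel \<rightarrow>\<^sub>M borel" by (rule borel_measurable_continuous_onI[OF continuous_on_f1])
  have [measurable]: "T \<in> \<nu> \<rightarrow>\<^sub>M borel" by (rule meas[OF T])
  \<comment> \<open>The projection to the torus intertwines \<open>T\<close> with
    \<open>f 1\<close>, which carries invariance from \<open>\<nu>\<close> to its image.\<close>
  have fst_T: "fst (T w) = f 1 (fst w)" for w
  proof -
    obtain p \<theta> where "w = frame_of (p, \<theta>)" using submetry_surj[OF submetry_frame_of] by (metis surjD surj_pair)
    then show ?thesis using fun_cong[OF lift[of 1], of p] by (simp add: T_frame[simplified])
  qed
  have "distr \<mu> borel (f 1) = distr \<nu> borel (\<lambda>w. f 1 (fst w))"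
    unfolding \<mu>_def by (subst distr_distr) (auto simp: comp_def)
  also have "\<dots> = distr (distr \<nu> borel T) borel fst"
    by (subst distr_distr) (auto simp: comp_def fst_T intro!: borel_measurable_continuous_onI continuous_intros)
  finally have "distr \<mu> borel (f 1) = \<mu>" by (simp add: \<nu>(3) \<mu>_def)
  then have inv: "invariant_prob (f 1) \<mu>" using prob by (simp add: invariant_prob_def \<mu>_def)

  have [measurable]: "(\<lambda>z. torsion_n f z (1, 0) n) \<in> borel_measurable borel" for n
    by (rule borel_measurable_continuous_onI[OF continuous_on_torsion_n])
  have tors [measurable]: "torsion f \<in> borel_measurable borel"
    unfolding torsion_eq_lim[abs_def] by measurable
  have ex: "AE z in \<mu>. \<exists>\<tau>. has_torsion f z \<tau>"
  proof -
    have "AE w in \<nu>. convergent (torsion_n f (fst w) (1, 0))"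
      using AE_conv by eventually_elim (auto simp: tendsto has_torsion_iff convergent_def)
    moreover have "{z \<in> space borel. convergent (\<lambda>n. torsion_n f z (1, 0) n)} \<in> sets borel"
      unfolding Cauchy_convergent_iff[symmetric] by measurable
    ultimately have "AE z in \<mu>. convergent (torsion_n f z (1, 0))"
      unfolding \<mu>_def by (subst AE_distr_iff) auto
    then show ?thesis by (simp add: convergent_def has_torsion_iff)
  qed
  have avg_bound: "\<bar>E.birkhoff_sum \<phi> n w / real n\<bar> \<le> B" for n w
  proof (cases "n = 0")
    case True
    then show ?thesis using order_trans[OF abs_ge_zero B] by simp
  next
    case False
    then show ?thesis using E.birkhoff_sum_bound[of \<phi> B n w] B by (simp add: field_simps)
  qed
  have [measurable]: "\<phi> \<in> borel_measurable \<nu>" by (rule meas[OF \<phi>])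
  have tors_fst: "(\<lambda>w. torsion f (fst w)) \<in> borel_measurable \<nu>" by measurable
  have int_fst: "integrable \<nu> (\<lambda>w. torsion f (fst w))"
    by (rule integrable_dominated_convergence[where w = "\<lambda>_. B", OF tors_fst _ _ AE_conv])
       (use avg_bound in auto)
  have "(\<lambda>n. \<integral>w. E.birkhoff_sum \<phi> n w / real n \<partial>\<nu>) \<longlonglongrightarrow> (\<integral>w. torsion f (fst w) \<partial>\<nu>)"
    by (rule integral_dominated_convergence[where w = "\<lambda>_. B", OF tors_fst _ _ AE_conv])
       (use avg_bound in auto)
  \<comment> \<open>By invariance each average with \<open>n \<ge> 1\<close> has integral exactly
    \<open>l\<close>; only \<open>n = 0\<close>, a division by zero, is set apart.\<close>
  moreover have "(\<lambda>n. \<integral>w. E.birkhoff_sum \<phi> n w / real n \<partial>\<nu>) \<longlonglongrightarrow> l"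
  proof (rule tendsto_eventually, rule eventually_sequentiallyI[of 1])
    fix n :: nat assume "1 \<le> n"
    have "integrable \<nu> (\<lambda>w. \<phi> ((T ^^ k) w))" for k
      by (rule E.integrable_bounded[where B = B]) (use B in \<open>auto intro: measurable_compose[OF E.funpow_measurable]\<close>)
    then have "(\<integral>w. E.birkhoff_sum \<phi> n w \<partial>\<nu>) = (\<Sum>k<n. \<integral>w. \<phi> ((T ^^ k) w) \<partial>\<nu>)"
      unfolding E.birkhoff_sum_def by (rule Bochner_Integration.integral_sum)
    also have "\<dots> = real n * l" by (simp add: E.integral_compose \<nu>(4))
    finally show "(\<integral>w. E.birkhoff_sum \<phi> n w / real n \<partial>\<nu>) = l" using \<open>1 \<le> n\<close> by simp
  qed
  ultimately have "(\<integral>w. torsion f (fst w) \<partial>\<nu>) = l" by (rule LIMSEQ_unique)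
  then have tm: "torsion_measure f \<mu> = l"
    unfolding torsion_measure_def \<mu>_def by (subst integral_distr) auto
  have int: "integrable \<mu> (torsion f)"
    unfolding \<mu>_def using int_fst by (subst integrable_distr_eq) auto

  \<comment> \<open>Torsion exists almost everywhere with mean \<open>l\<close> under a probability
    measure, so it cannot be below \<open>l\<close> wherever it exists.\<close>
  have ge: "\<exists>z \<tau>. has_torsion f z \<tau> \<and> \<tau> \<ge> l"
  proof (rule ccontr)
    assume "\<not> ?thesis"
    then have *: "torsion f z < l" if "has_torsion f z \<tau>" for z \<tau>
      using that by (metis has_torsion_iff limI not_le torsion_eq_lim)
    have "(\<integral>z. torsion f z \<partial>\<mu>) < (\<integral>z. l \<partial>\<mu>)"
      by (rule \<mu>.integral_less_AE_space)
         (use ex * int in \<open>auto simp: \<mu>.emeasure_space_1\<close>)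
    then show False using tm by (simp add: torsion_measure_def \<mu>.prob_space)
  qed
  have le: "\<exists>z \<tau>. has_torsion f z \<tau> \<and> \<tau> \<le> l"
  proof (rule ccontr)
    assume "\<not> ?thesis"
    then have *: "l < torsion f z" if "has_torsion f z \<tau>" for z \<tau>
      using that by (metis has_torsion_iff limI not_le torsion_eq_lim)
    have "(\<integral>z. l \<partial>\<mu>) < (\<integral>z. torsion f z \<partial>\<mu>)"
      by (rule \<mu>.integral_less_AE_space)
         (use ex * int in \<open>auto simp: \<mu>.emeasure_space_1\<close>)
    then show False using tm by (simp add: torsion_measure_def \<mu>.prob_space)
  qed
  show ?thesis using inv ex int tm ge le by blast
qed

end
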